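(* For all $n\in\mathbb{N}_0$, \[ (E_{-n},E_{-n})=\frac{2\,(abcdq^{2n};q)_\infty}{(q^{n+1},abq^{n+1},acq^n,adq^n,bcq^n,bdq^n,cdq^n;q)_\infty\,(abcdq^n;q)_n}, \] \[ (E_{n+1},E_{n+1})=\frac{2\,(abcdq^{2n+1};q)_\infty}{(q^{n+1},abq^{n+1},acq^{n+1},adq^{n+1},bcq^{n+1},bdq^{n+1},cdq^n;q)_\infty\,(abcdq^n;q)_{n+1}}. \]
   Context: Let $K=\mathbb{Q}(\sqrt{-ab},b,\sqrt{-cd},d,q^{1/2})$ be the field of rational functions in the five indeterminates $\sqrt{-ab},b,\sqrt{-cd},d,q^{1/2}$; put $a=-(\sqrt{-ab})^2/b$, $c=-(\sqrt{-cd})^2/d$. Let $*$ be the field involution of $K$ inverting the five generators. Let $\mathcal{A}=K[z,z^{-1}]$; for $f=\sum_n f_nz^n\in\mathcal{A}$ put $f^*=\sum_n f_n^*z^{-n}$. Write $(x;q)_n=\prod_{j=0}^{n-1}(1-xq^j)$, $(x;q)_\infty=\prod_{j\ge0}(1-xq^j)$ and $(x_1,\dots,x_r;q)_\infty=\prod_i(x_i;q)_\infty$. Let \[ \Delta=\frac{(z^2,qz^{-2};q)_\infty}{(az,bz,cz,dz,aqz^{-1},bqz^{-1},cz^{-1},dz^{-1};q)_\infty}, \] expanded as a power series in $z$ and $q^{1/2}z^{-1}$ with coefficients in $\mathcal{R}=\mathbb{Q}[a^{\pm1},b^{\pm1},(cq^{-1/2})^{\pm1},(dq^{-1/2})^{\pm1}]$,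 hence regarded as an element of $\mathcal{R}((q^{1/2}))[[z^{\pm1}]]$. With $\mathrm{ct}$ denoting the coefficient of $z^0$, put $(f,g)=\mathrm{ct}(fg^*\Delta)\in K\otimes_{\mathcal{R}[q^{\pm1/2}]}\mathcal{R}((q^{1/2}))$. Infinite products of parameters on the right-hand sides are expanded in $\mathcal{R}((q^{1/2}))$ (e.g. $ac=q^{1/2}\cdot a\cdot(cq^{-1/2})$). Order monomials by $1<z<z^{-1}<z^2<z^{-2}<\cdots$; the non-symmetric Askey--Wilson polynomial $E_n\in\mathcal{A}$ ($n\in\mathbb{Z}$) is the unique element of the form $z^n+$ (lower-order terms) with $(E_n,z^m)=0$ whenever $z^m<z^n$.
   Formalization: The factor 2 in both right-hand sides is replaced by 1: for n=0, E_0=1 and ct(Δ) has leading coefficient 1 in q^{1/2}, whereas the printed right-hand side has leading coefficient 2, so the printed formulas fail for this Δ. *)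

theory Defs
  imports
    "HOL-Analysis.Infinite_Products"
    "HOL-Library.Poly_Mapping"
    "HOL-Library.Product_Plus"
    "HOL-Computational_Algebra.Fraction_Field"
    "HOL-Computational_Algebra.Formal_Laurent_Series"
begin

section \<open>The field K and its involution\<close>

text \<open>\<open>K\<close> is the fraction field of \<open>Q[x1][x2][x3][x4][x5]\<close>, where from the innermost to the outermost
  indeterminate \<open>x1 = sqrt(-ab)\<close>, \<open>x2 = b\<close>, \<open>x3 = sqrt(-cd)\<close>, \<open>x4 = d\<close>, \<open>x5 = q^(1/2)\<close>.\<close>

type_synonym K = "rat poly poly poly poly poly fract"

definition K_rat :: "rat \<Rightarrow> K" where "K_rat r = Fract [:[:[:[:[:r:]:]:]:]:] 1"

definition K_sqrt_mab :: K where "K_sqrt_mab = Fract [:[:[:[:[:0, 1:]:]:]:]:] 1"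
definition K_b :: K where "K_b = Fract [:[:[:[:0, 1:]:]:]:] 1"
definition K_sqrt_mcd :: K where "K_sqrt_mcd = Fract [:[:[:0, 1:]:]:] 1"
definition K_d :: K where "K_d = Fract [:[:0, 1:]:] 1"
definition K_s :: K where "K_s = Fract [:0, 1:] 1"

definition K_a :: K where "K_a = - (K_sqrt_mab ^ 2) / K_b"
definition K_c :: K where "K_c = - (K_sqrt_mcd ^ 2) / K_d"

definition K_star :: "K \<Rightarrow> K" where
  "K_star = (THE \<sigma>. (\<forall>x y. \<sigma> (x + y) = \<sigma> x + \<sigma> y) \<and> (\<forall>x y. \<sigma> (x * y) = \<sigma> x * \<sigma> y) \<and> \<sigma> 1 = 1 \<and>
     (\<forall>x. \<sigma> (\<sigma> x) = x) \<and>
     (\<forall>x \<in> {K_sqrt_mab, K_b, K_sqrt_mcd, K_d, K_s}. \<sigma> x = inverse x))"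


section \<open>Laurent polynomials\<close>

text \<open>\<open>p :: 'a laurent\<close> is the Laurent polynomial whose coefficient of the \<open>n\<close>-th power is
  \<open>lookup p n\<close>; multiplication is convolution.\<close>

type_synonym 'a laurent = "int \<Rightarrow>\<^sub>0 'a"

abbreviation zpow :: "int \<Rightarrow> K laurent" where "zpow n \<equiv> Poly_Mapping.single n 1"

definition laurent_star :: "K laurent \<Rightarrow> K laurent" where
  "laurent_star f = (\<Sum>n \<in> Poly_Mapping.keys f. Poly_Mapping.single (- n) (K_star (Poly_Mapping.lookup f n)))"


section \<open>The ring R, and the tensor product of K and R((s))\<close>

text \<open>\<open>R\<close> is the ring of Laurent polynomials over the rationals in \<open>a\<close>, \<open>b\<close>, \<open>c' = c q^(-1/2)\<close>,
  \<open>d' = d q^(-1/2)\<close>, as the group algebra of \<open>Z^4\<close>. Throughout, \<open>s = q^(1/2)\<close>, so \<open>c = s c'\<close>,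
  \<open>d = s d'\<close>; in \<open>R fps\<close>, \<open>R fls\<close> and \<open>R laurent\<close> the variable is \<open>s\<close>.\<close>

type_synonym R = "(int \<times> int \<times> int \<times> int) \<Rightarrow>\<^sub>0 rat"

definition R_a :: R where "R_a = Poly_Mapping.single (1, 0, 0, 0) 1"
definition R_b :: R where "R_b = Poly_Mapping.single (0, 1, 0, 0) 1"
definition R_c' :: R where "R_c' = Poly_Mapping.single (0, 0, 1, 0) 1"
definition R_d' :: R where "R_d' = Poly_Mapping.single (0, 0, 0, 1) 1"

definition R_to_K :: "R \<Rightarrow> K" where
  "R_to_K r = (\<Sum>(i, j, k, l) \<in> Poly_Mapping.keys r. K_rat (Poly_Mapping.lookup r (i, j, k, l)) *
     K_a powi i * K_b powi j * (K_c / K_s) powi k * (K_d / K_s) powi l)"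

text \<open>\<open>R laurent\<close> serves as \<open>R[q^(1/2), q^(-1/2)]\<close>; these are its maps to \<open>K\<close> and to \<open>R((q^(1/2)))\<close>.\<close>

definition S_to_K :: "R laurent \<Rightarrow> K" where
  "S_to_K p = (\<Sum>m \<in> Poly_Mapping.keys p. R_to_K (Poly_Mapping.lookup p m) * K_s powi m)"

definition S_to_fls :: "R laurent \<Rightarrow> R fls" where
  "S_to_fls p = (\<Sum>m \<in> Poly_Mapping.keys p. fls_const (Poly_Mapping.lookup p m) * fls_X_intpow m)"

text \<open>The tensor product over \<open>R[q^(1/2), q^(-1/2)]\<close> is the free abelian group on \<open>K \<times> R((s))\<close> modulo
  the subgroup generated by the usual relations. Only its group structure is needed.\<close>

inductive_set tensor_rel :: "((K \<times> R fls) \<Rightarrow>\<^sub>0 int) set" where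
  add_left: "Poly_Mapping.single (k + k', x) 1 - Poly_Mapping.single (k, x) 1
     - Poly_Mapping.single (k', x) 1 \<in> tensor_rel"
| add_right: "Poly_Mapping.single (k, x + x') 1 - Poly_Mapping.single (k, x) 1
     - Poly_Mapping.single (k, x') 1 \<in> tensor_rel"
| balanced: "Poly_Mapping.single (k * S_to_K p, x) 1
     - Poly_Mapping.single (k, S_to_fls p * x) 1 \<in> tensor_rel"
| zero: "0 \<in> tensor_rel"
| diff: "u \<in> tensor_rel \<Longrightarrow> v \<in> tensor_rel \<Longrightarrow> u - v \<in> tensor_rel"

lemma tensor_rel_uminus: "- u \<in> tensor_rel" if "u \<in> tensor_rel"
proof -
  have "0 - u \<in> tensor_rel" by (rule tensor_rel.diff[OF tensor_rel.zero that])
  then show ?thesis by (simp only: diff_0)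
qed

lemma tensor_rel_add: "u + v \<in> tensor_rel" if "u \<in> tensor_rel" "v \<in> tensor_rel"
proof -
  have "u - (- v) \<in> tensor_rel" by (rule tensor_rel.diff[OF that(1) tensor_rel_uminus[OF that(2)]])
  then show ?thesis by (simp only: diff_minus_eq_add)
qed

quotient_type tensor = "(K \<times> R fls) \<Rightarrow>\<^sub>0 int" / "\<lambda>u v. u - v \<in> tensor_rel"
proof (rule equivpI)
  show "reflp (\<lambda>u v. u - v \<in> tensor_rel)"
    by (rule reflpI) (simp only: diff_self tensor_rel.zero)
  show "symp (\<lambda>u v. u - v \<in> tensor_rel)"
  proof (rule sympI)
    fix u v assume "u - v \<in> tensor_rel"
    then have "- (u - v) \<in> tensor_rel" by (rule tensor_rel_uminus)
    then show "v - u \<in> tensor_rel" by (simp only: minus_diff_eq)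
  qed
  show "transp (\<lambda>u v. u - v \<in> tensor_rel)"
  proof (rule transpI)
    fix u v w assume "u - v \<in> tensor_rel" "v - w \<in> tensor_rel"
    then have "(u - v) + (v - w) \<in> tensor_rel" by (rule tensor_rel_add)
    also have "(u - v) + (v - w) = u - w" by (simp only: add_diff_eq diff_add_cancel)
    finally show "u - w \<in> tensor_rel" .
  qed
qed

instantiation tensor :: ab_group_add
begin

lift_definition zero_tensor :: tensor is "0 :: (K \<times> R fls) \<Rightarrow>\<^sub>0 int" .

lift_definition plus_tensor :: "tensor \<Rightarrow> tensor \<Rightarrow> tensor" is "\<lambda>u v. u + v"
  by (simp only: add_diff_add tensor_rel_add)

lift_definition uminus_tensor :: "tensor \<Rightarrow> tensor" is "\<lambda>u. - u"
  by (simp only: minus_diff_minus tensor_rel_uminus)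

lift_definition minus_tensor :: "tensor \<Rightarrow> tensor \<Rightarrow> tensor" is "\<lambda>u v. u - v"
proof -
  fix u u' v v' :: "(K \<times> R fls) \<Rightarrow>\<^sub>0 int"
  assume "u - u' \<in> tensor_rel" "v - v' \<in> tensor_rel"
  then have "(u - u') - (v - v') \<in> tensor_rel" by (rule tensor_rel.diff)
  also have "(u - u') - (v - v') = (u - v) - (u' - v')" by (simp only: diff_conv_add_uminus minus_add_distrib minus_minus ac_simps)
  finally show "(u - v) - (u' - v') \<in> tensor_rel" .
qed

instance
proof
  fix x y z :: tensor
  show "x + y + z = x + (y + z)"
    by transfer (simp only: add.assoc diff_self tensor_rel.zero)
  show "x + y = y + x"
    by transfer (metis add.commute diff_self tensor_rel.zero)
  show "0 + x = x"
    by transfer (simp only: add_0 diff_self tensor_rel.zero)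
  show "- x + x = 0"
    by transfer (simp only: left_minus diff_self tensor_rel.zero)
  show "x - y = x + - y"
    by transfer (simp only: diff_conv_add_uminus[symmetric] diff_self tensor_rel.zero)
qed

end

definition tensor_of :: "K \<Rightarrow> R fls \<Rightarrow> tensor" (infixr "\<otimes>\<^sub>S" 75)
  where "k \<otimes>\<^sub>S x = abs_tensor (Poly_Mapping.single (k, x) 1)"


section \<open>q-shifted factorials and formal inverses\<close>

definition qpoch :: "'a::comm_ring_1 \<Rightarrow> 'a \<Rightarrow> nat \<Rightarrow> 'a" where
  "qpoch x q n = (\<Prod>j<n. 1 - x * q ^ j)"

text \<open>The topology on \<open>'a fps\<close> underlying \<open>prodinf\<close> is the adic topology of its variable.\<close>

definition qpoch_inf :: "'a::comm_ring_1 fps \<Rightarrow> 'a fps \<Rightarrow> 'a fps" where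
  "qpoch_inf x q = prodinf (\<lambda>j. 1 - x * q ^ j)"

definition qpochs_inf :: "'a::comm_ring_1 fps list \<Rightarrow> 'a fps \<Rightarrow> 'a fps" where
  "qpochs_inf xs q = (\<Prod>x\<leftarrow>xs. qpoch_inf x q)"

lemma qpoch_inf_limit:
  fixes x q :: "'a::comm_ring_1 fps"
  assumes q: "fps_nth q 0 = 0" and x: "1 - fps_nth x 0 \<noteq> 0"
  shows "(\<lambda>n. \<Prod>j\<le>n. 1 - x * q ^ j) \<longlonglongrightarrow> qpoch_inf x q"
    and "fps_nth (qpoch_inf x q) 0 = 1 - fps_nth x 0"
proof -
  define P where "P = (\<lambda>n. \<Prod>j\<le>n. 1 - x * q ^ j)"
  have qz: "fps_nth (y * q ^ j) k = 0" if "k < j" for y j k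
    using that
  proof (induction j arbitrary: k)
    case (Suc j)
    have "fps_nth (y * q ^ Suc j) k = fps_nth ((y * q ^ j) * q) k"
      by (simp only: power_Suc2 mult.assoc)
    also have "\<dots> = (\<Sum>i=0..k. fps_nth (y * q ^ j) i * fps_nth q (k - i))"
      by (simp only: fps_mult_nth)
    also have "\<dots> = 0"
    proof (rule sum.neutral, rule ballI)
      fix i assume "i \<in> {0..k}"
      then consider "i < j" | "k - i = 0" using Suc.prems by force
      then show "fps_nth (y * q ^ j) i * fps_nth q (k - i) = 0"
        by cases (simp_all only: Suc.IH q mult_zero_left mult_zero_right)
    qed
    finally show ?case .
  qed (simp only: not_less_zero)
  have step: "fps_nth (P (Suc n)) k = fps_nth (P n) k" if "k \<le> n" for n k
  proof -
    have "P (Suc n) = P n - (P n * x) * q ^ Suc n"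
      by (simp only: P_def prod.atMost_Suc right_diff_distrib mult_1_right mult.assoc)
    moreover have "fps_nth ((P n * x) * q ^ Suc n) k = 0" by (rule qz) (use that in simp)
    ultimately show ?thesis by (simp only: fps_sub_nth diff_0_right)
  qed
  have stable: "fps_nth (P n) k = fps_nth (P k) k" if "k \<le> n" for n k
    using that by (induction n rule: dec_induct) (simp_all only: step)
  define L where "L = Abs_fps (\<lambda>k. fps_nth (P k) k)"
  have lim: "P \<longlonglongrightarrow> L"
  proof (rule tendsto_fpsI)
    fix k show "\<forall>\<^sub>F n in sequentially. fps_nth (P n) k = fps_nth L k"
      using eventually_ge_at_top[of k] unfolding L_def fps_nth_Abs_fps
      by eventually_elim (rule stable)
  qed
  have L0: "fps_nth L 0 = 1 - fps_nth x 0"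
    by (simp add: L_def P_def)
  have Lnz: "L \<noteq> 0" using L0 x by (metis fps_zero_nth)
  have fnz: "1 - x * q ^ j \<noteq> 0" for j
  proof
    assume "1 - x * q ^ j = 0"
    then have "fps_nth (1 - x * q ^ j) 0 = 0" by simp
    then show False
    proof (cases j)
      case 0
      then show ?thesis using \<open>fps_nth (1 - x * q ^ j) 0 = 0\<close> x
        by (simp only: power_0 mult_1_right fps_sub_nth fps_one_nth if_True simp_thms)
    next
      case (Suc i)
      then have "fps_nth (x * q ^ j) 0 = 0" by (intro qz) simp
      then have "(1::'a) = 0" using \<open>fps_nth (1 - x * q ^ j) 0 = 0\<close>
        by (simp only: fps_sub_nth fps_one_nth if_True simp_thms diff_0_right)
      then show ?thesis by (rule notE[OF one_neq_zero])
    qed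
  qed
  have raw: "raw_has_prod (\<lambda>j. 1 - x * q ^ j) 0 p \<longleftrightarrow> p = L" for p
    unfolding raw_has_prod_def add_0_right P_def[symmetric]
    using lim Lnz LIMSEQ_unique[of P p L] by blast
  have hp: "(\<lambda>j. 1 - x * q ^ j) has_prod p \<longleftrightarrow> p = L" for p
    unfolding has_prod_def raw using fnz by blast
  have eq: "qpoch_inf x q = L" unfolding qpoch_inf_def prodinf_def by (rule the_equality) (use hp in blast)+
  show "(\<lambda>n. \<Prod>j\<le>n. 1 - x * q ^ j) \<longlonglongrightarrow> qpoch_inf x q"
    using lim unfolding eq P_def .
  show "fps_nth (qpoch_inf x q) 0 = 1 - fps_nth x 0" unfolding eq by (rule L0)
qed

text \<open>Inverses of series with coefficients in \<open>R\<close>, which is not a field: \<open>fps_inv1\<close> is the inverse of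
  a series with constant term 1, \<open>fps_inv2\<close> of a bivariate series with constant term 1.\<close>

definition fps_inv1 :: "'a::comm_ring_1 fps \<Rightarrow> 'a fps" where
  "fps_inv1 f = fps_right_inverse f 1"

definition fps_inv2 :: "'a::comm_ring_1 fps fps \<Rightarrow> 'a fps fps" where
  "fps_inv2 f = fps_right_inverse f (fps_inv1 (fps_nth f 0))"


section \<open>The weight function\<close>

text \<open>\<open>Delta\<close> as an element of \<open>R[[z]][[w]]\<close> with \<open>w = q^(1/2) / z\<close>, so that \<open>q^(1/2) = z w\<close>.\<close>

definition Delta :: "R fps fps" where
  "Delta = (let z = fps_const fps_X; w = fps_X; s = z * w; q = s ^ 2;
      a = fps_const (fps_const R_a); b = fps_const (fps_const R_b);
      c' = fps_const (fps_const R_c'); d' = fps_const (fps_const R_d')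
    in qpochs_inf [z ^ 2, w ^ 2] q *
       fps_inv2 (qpochs_inf [a * z, b * z, c' * s * z, d' * s * z, a * s * w, b * s * w, c' * w, d' * w] q))"

text \<open>The coefficient of \<open>z^k\<close> in \<open>Delta\<close>, as an element of \<open>R((s))\<close>: the term \<open>z^i w^j\<close> is \<open>s^j z^(i-j)\<close>.\<close>

definition Delta_coeff :: "int \<Rightarrow> R fls" where
  "Delta_coeff k = fps_to_fls (Abs_fps (\<lambda>j.
     if 0 \<le> int j + k then fps_nth (fps_nth Delta j) (nat (int j + k)) else 0))"

text \<open>This fixes the normalisation of the norms: \<open>(1, 1)\<close> is the image of \<open>Delta_coeff 0\<close>, whose leading
  coefficient is 1, whereas the leading coefficient of \<open>2 (abcd; q) / (q, abq, ac, ad, bc, bd, cd; q)\<close>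
  is 2. A factor 2 in front of the norm formulas belongs to the symmetric weight, with numerator
  \<open>(z^2, z^(-2); q)\<close> and denominator \<open>(az, a/z, bz, b/z, cz, c/z, dz, d/z; q)\<close>; for the
  non-symmetric weight \<open>Delta\<close> the correct factor is 1.\<close>

lemma ct_Delta_leading: "fls_nth (Delta_coeff 0) 0 = 1"
proof -
  define z where "z = (fps_const fps_X :: R fps fps)"
  define w where "w = (fps_X :: R fps fps)"
  define q where "q = (z * w) ^ 2"
  define num where "num = qpochs_inf [z ^ 2, w ^ 2] q"
  define den where "den = qpochs_inf [fps_const (fps_const R_a) * z, fps_const (fps_const R_b) * z,
    fps_const (fps_const R_c') * (z * w) * z, fps_const (fps_const R_d') * (z * w) * z,
    fps_const (fps_const R_a) * (z * w) * w, fps_const (fps_const R_b) * (z * w) * w,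
    fps_const (fps_const R_c') * w, fps_const (fps_const R_d') * w] q"
  have w0: "fps_nth w 0 = 0" by (simp add: w_def)
  have q0: "fps_nth q 0 = 0" by (simp only: q_def power2_eq_square fps_mult_nth_0 w0 mult_zero_right)
  have z0: "fps_nth (fps_nth z 0) 0 = 0" by (simp add: z_def)
  have factor: "fps_nth (fps_nth (qpoch_inf x q) 0) 0 = 1" if "fps_nth (fps_nth x 0) 0 = 0" for x :: "R fps fps"
  proof -
    have c: "fps_nth (1 - fps_nth x 0) 0 = 1" by (simp only: fps_sub_nth that fps_one_nth if_True diff_0_right simp_thms)
    then have "1 - fps_nth x 0 \<noteq> 0" by (metis fps_zero_nth zero_neq_one)
    from qpoch_inf_limit(2)[OF q0 this] c show ?thesis by (simp only:)
  qed
  have num0: "fps_nth (fps_nth num 0) 0 = 1"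
    by (simp only: num_def qpochs_inf_def list.map prod_list.Cons prod_list.Nil fps_mult_nth_0
      factor power2_eq_square z0 w0 fps_zero_nth mult_zero_left mult_zero_right mult_1 fps_one_nth if_True simp_thms)
  have inv0: "fps_nth (fps_nth (fps_inv2 f) 0) 0 = 1" for f :: "R fps fps"
    by (simp only: fps_inv2_def fps_inv1_def fps_nth_Abs_fps fps_right_inverse_constructor.simps)
  have D: "Delta = num * fps_inv2 den"
    by (simp only: Delta_def Let_def num_def den_def z_def w_def q_def)
  have "fps_nth (fps_nth Delta 0) 0 = fps_nth (fps_nth num 0) 0 * fps_nth (fps_nth (fps_inv2 den) 0) 0"
    unfolding D fps_mult_nth_0 ..
  also have "\<dots> = 1" by (simp only: num0 inv0 mult_1)
  finally have "fps_nth (fps_nth Delta 0) 0 = 1" .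
  then show ?thesis by (simp add: Delta_coeff_def)
qed

definition pairing :: "K laurent \<Rightarrow> K laurent \<Rightarrow> tensor" where
  "pairing f g = (let h = f * laurent_star g in
     \<Sum>n \<in> Poly_Mapping.keys h. Poly_Mapping.lookup h n \<otimes>\<^sub>S Delta_coeff (- n))"


section \<open>Non-symmetric Askey--Wilson polynomials\<close>

text \<open>\<open>z^m\<close> precedes \<open>z^n\<close> in the ordering \<open>1 < z < z^(-1) < z^2 < z^(-2) < \<dots>\<close>\<close>

definition mono_rank :: "int \<Rightarrow> int" where
  "mono_rank n = (if n > 0 then 2 * n - 1 else - 2 * n)"

definition mono_less :: "int \<Rightarrow> int \<Rightarrow> bool" where
  "mono_less m n \<longleftrightarrow> mono_rank m < mono_rank n"

definition is_nonsym_AW :: "int \<Rightarrow> K laurent \<Rightarrow> bool" where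
  "is_nonsym_AW n f \<longleftrightarrow>
     Poly_Mapping.lookup f n = 1 \<and> (\<forall>m. Poly_Mapping.lookup f m \<noteq> 0 \<longrightarrow> m = n \<or> mono_less m n) \<and>
     (\<forall>m. mono_less m n \<longrightarrow> pairing f (zpow m) = 0)"


section \<open>The parameters in the power series ring over R\<close>

definition P_q :: "R fps" where "P_q = fps_X ^ 2"
definition P_a :: "R fps" where "P_a = fps_const R_a"
definition P_b :: "R fps" where "P_b = fps_const R_b"
definition P_c :: "R fps" where "P_c = fps_const R_c' * fps_X"
definition P_d :: "R fps" where "P_d = fps_const R_d' * fps_X"

text \<open>The image of a power series in \<open>s\<close> in the tensor product.\<close>

definition tensor_fps :: "R fps \<Rightarrow> tensor" where
  "tensor_fps x = 1 \<otimes>\<^sub>S fps_to_fls x"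

end

theory Submission
  imports Defs
begin

text \<open>The weight has two hidden reflection symmetries: \<open>(1 - a z) (1 - b z) \<Delta>\<close> is \<open>1 - z\<^sup>2\<close> times a series
  invariant under \<open>z \<mapsto> 1 / z\<close>, and exchanging \<open>z\<close> with \<open>w = q\<^sup>1\<^sup>/\<^sup>2 / z\<close> gives the same for
  \<open>z \<mapsto> q / z\<close>. In terms of moments these are two linear recursions, which express every moment by the
  constant term of \<open>\<Delta>\<close>, with coefficients in \<open>K\<close>; the recursions are invariant under the involution, so
  the pairing is a Hermitian form over \<open>K\<close> times that constant term. They also give the effect of
  \<open>a \<mapsto> a q\<close> on the constant term, which is therefore known up to a factor independent of the parameters,
  and for \<open>(a, b, c, d) = (1, -1, q\<^sup>1\<^sup>/\<^sup>2, -q\<^sup>1\<^sup>/\<^sup>2)\<close> the weight is 1.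

  The Demazure--Lusztig operators attached to the two reflections are unitary, and so is multiplication
  by \<open>z\<close>. The polynomial \<open>E\<^sub>-\<^sub>n\<close> arises from \<open>E\<^sub>n\<close>, and \<open>E\<^sub>n\<^sub>+\<^sub>1\<close> from \<open>E\<^sub>-\<^sub>n\<close>, by such a unitary operator
  minus a scalar; orthogonality holds since the two polynomials are, modulo lower terms, eigenvectors of
  Cherednik's operator with eigenvalues \<open>\<eta>\<close>, \<open>\<eta>'\<close> such that \<open>\<eta>' \<eta>\<^sup>*\<close> is not 1, and the norms are multiplied by an explicit factor at each step.\<close>

section \<open>Infinite q-shifted factorials as adic limits\<close>

text \<open>The involution inverts q and so does not act on \<open>R((s))\<close>, whereas the
  constant term is an infinite product that lives only there. The recursions are therefore solved
  twice: inside \<open>K\<close>, giving the moments \<open>nmoment\<close>, whose behaviour under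
  the involution is an induction; and inside the tensor product, where dividing by the determinant
  abcd q^k - 1 just rescales the left factor. Only the defining relations of the tensor product are
  used. In particular it is not known that k times the constant term determines k, so a given
  polynomial \<open>f\<close> is compared with the constructed \<open>E\<close> through norms
  instead of being identified with it. The symmetry under z -> q/z comes for free: in the variables
  z and w it is the first symmetry with the two pairs of parameters exchanged, provided the second
  pair is divided by s. Infinite products never cross the tensor sign: successive norms differ by
  finitely many factors, and the one infinite product that matters is the constant term itself, at n
  = 0.\<close>

definition agree :: "nat \<Rightarrow> 'a fps \<Rightarrow> 'a fps \<Rightarrow> bool" where
  "agree N f g \<longleftrightarrow> (\<forall>k<N. fps_nth f k = fps_nth g k)"

lemma agree_refl [simp]: "agree N f f"
  and agree_sym: "agree N f g \<Longrightarrow> agree N g f"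
  and agree_trans: "agree N f g \<Longrightarrow> agree N g h \<Longrightarrow> agree N f h"
  by (auto simp: agree_def)

lemma agree_mono: "agree N f g \<Longrightarrow> M \<le> N \<Longrightarrow> agree M f g"
  by (auto simp: agree_def)

lemma agree_eqI: "(\<And>N. agree N f g) \<Longrightarrow> f = g"
  by (rule fps_ext) (auto simp: agree_def)

lemma agree_diff: "agree N f f' \<Longrightarrow> agree N g g' \<Longrightarrow> agree N (f - g) (f' - g')"
  for f g :: "'a::ab_group_add fps"
  by (auto simp: agree_def)

lemma agree_mult:
  fixes f g :: "'a::comm_ring_1 fps"
  assumes "agree N f f'" "agree N g g'" shows "agree N (f * g) (f' * g')"
  using assms by (auto simp: agree_def fps_mult_nth intro!: sum.cong)

lemma agree_power: "agree N f g \<Longrightarrow> agree N (f ^ n) (g ^ n)"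
  for f g :: "'a::comm_ring_1 fps"
  by (induction n) (auto intro: agree_mult)

text \<open>The difference of the inverses is f' (g - f) g', so congruences modulo powers of the
  variable pass to inverses over any commutative ring.\<close>

lemma agree_inverse:
  fixes f g :: "'a::comm_ring_1 fps"
  assumes "f * f' = 1" "g * g' = 1" "agree N f g" shows "agree N f' g'"
proof -
  have "f' = f' * (g * g')" "g' = g' * (f * f')" using assms by simp_all
  moreover have "agree N (f' * (g * g')) (f' * (f * g'))"
    by (intro agree_mult agree_refl agree_sym[OF assms(3)])
  ultimately show ?thesis by (simp add: mult_ac)
qed

lemma agree_power_0:
  fixes x :: "'a::comm_ring_1 fps"
  assumes "fps_nth x 0 = 0" shows "agree n (y * x ^ n) 0"
proof (induction n)
  case (Suc n)
  have "fps_nth (y * x ^ Suc n) k = 0" if "k < Suc n" for k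
  proof -
    have "fps_nth (y * x ^ Suc n) k = fps_nth ((y * x ^ n) * x) k" by (simp add: mult_ac)
    also have "\<dots> = (\<Sum>i=0..k. fps_nth (y * x ^ n) i * fps_nth x (k - i))"
      by (rule fps_mult_nth)
    also have "\<dots> = 0"
    proof (rule sum.neutral, rule ballI)
      fix i assume "i \<in> {0..k}"
      then have "i < n \<or> k - i = 0" using that by auto
      then show "fps_nth (y * x ^ n) i * fps_nth x (k - i) = 0"
        using Suc assms by (auto simp: agree_def)
    qed
    finally show ?thesis .
  qed
  then show ?case by (simp add: agree_def)
qed (simp add: agree_def)

lemma qpoch_Suc: "qpoch x q (Suc n) = qpoch x q n * (1 - x * q ^ n)"
  by (simp add: qpoch_def)

lemma qpoch_0 [simp]: "qpoch x q 0 = 1"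
  by (simp add: qpoch_def)

lemma qpoch_rec: "qpoch x q (Suc n) = (1 - x) * qpoch (x * q) q n"
  by (simp add: qpoch_def prod.lessThan_Suc_shift mult.assoc del: prod.lessThan_Suc)

lemma agree_qpoch: "agree N x y \<Longrightarrow> agree N q r \<Longrightarrow> agree N (qpoch x q n) (qpoch y r n)"
  by (induction n) (auto simp: qpoch_Suc intro!: agree_mult agree_diff agree_power)

lemma qpoch_stable:
  fixes x q :: "'a::comm_ring_1 fps"
  assumes q: "fps_nth q 0 = 0" and "N \<le> n" shows "agree N (qpoch x q N) (qpoch x q n)"
  using assms(2)
proof (induction n rule: dec_induct)
  case (step n)
  have "agree n (x * q ^ n) 0" by (rule agree_power_0[OF q])
  then have "agree N (x * q ^ n) 0" using step.hyps by (meson agree_mono)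
  then have "agree N (qpoch x q n * (1 - x * q ^ n)) (qpoch x q n * (1 - 0))"
    by (intro agree_mult agree_diff agree_refl)
  then show ?case using step.IH by (simp add: qpoch_Suc) (meson agree_sym agree_trans)
qed simp

text \<open>The bridge from \<open>prodinf\<close> to finite products. \<open>prodinf\<close> sees
  only nonzero limits, which the condition on the constant coefficient of \<open>x\<close> ensures;
  from here on identities between infinite products are checked on truncations.\<close>

lemma qpoch_inf_agree:
  fixes x q :: "'a::comm_ring_1 fps"
  assumes q: "fps_nth q 0 = 0" and x: "1 - fps_nth x 0 \<noteq> 0" and n: "N \<le> n"
  shows "agree N (qpoch_inf x q) (qpoch x q n)"
  unfolding agree_def
proof (intro allI impI)
  fix k assume k: "k < N"
  have "\<forall>\<^sub>F m in sequentially. fps_nth (\<Prod>j\<le>m. 1 - x * q ^ j) k = fps_nth (qpoch_inf x q) k"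
    using qpoch_inf_limit(1)[OF q x] unfolding tendsto_fps_iff by blast
  then obtain m0 where m0: "\<And>m. m \<ge> m0 \<Longrightarrow> fps_nth (\<Prod>j\<le>m. 1 - x * q ^ j) k = fps_nth (qpoch_inf x q) k"
    by (auto simp: eventually_sequentially)
  define m where "m = max m0 N"
  have "fps_nth (qpoch x q (Suc m)) k = fps_nth (qpoch_inf x q) k"
    using m0[of m] by (simp add: qpoch_def m_def lessThan_Suc_atMost)
  moreover have "agree N (qpoch x q N) (qpoch x q (Suc m))"
    by (rule qpoch_stable[OF q]) (simp add: m_def)
  moreover have "agree N (qpoch x q N) (qpoch x q n)"
    by (rule qpoch_stable[OF q n])
  ultimately show "fps_nth (qpoch_inf x q) k = fps_nth (qpoch x q n) k"
    using k by (auto simp: agree_def)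
qed

text \<open>Truncations of arbitrarily large length are enough, so lengths such as
  \<open>Suc N\<close> or \<open>2 * N\<close> may be chosen to suit a recursion.\<close>

lemma qpoch_inf_eqI:
  fixes x q :: "'a::comm_ring_1 fps"
  assumes "fps_nth q 0 = 0" "1 - fps_nth x 0 \<noteq> 0" "\<And>N. \<exists>n\<ge>N. agree N f (qpoch x q n)"
  shows "qpoch_inf x q = f"
proof (rule agree_eqI)
  fix N
  obtain n where "n \<ge> N" "agree N f (qpoch x q n)" using assms(3) by blast
  then show "agree N (qpoch_inf x q) f"
    using qpoch_inf_agree[OF assms(1,2), of N n] by (meson agree_sym agree_trans)
qed

lemma agree_qpoch_inf:
  fixes x y q :: "'a::comm_ring_1 fps"
  assumes "fps_nth q 0 = 0" "1 - fps_nth x 0 \<noteq> 0" "1 - fps_nth y 0 \<noteq> 0" "agree N x y"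
  shows "agree N (qpoch_inf x q) (qpoch_inf y q)"
  using qpoch_inf_agree[OF assms(1,2) order_refl, of N] qpoch_inf_agree[OF assms(1,3) order_refl, of N]
    agree_qpoch[OF assms(4) agree_refl, of q N] by (meson agree_sym agree_trans)

lemma qpoch_inf_rec:
  fixes x q :: "'a::comm_ring_1 fps"
  assumes "fps_nth q 0 = 0" "1 - fps_nth x 0 \<noteq> 0"
  shows "qpoch_inf x q = (1 - x) * qpoch_inf (x * q) q"
proof (rule qpoch_inf_eqI[OF assms])
  fix N
  have "agree N ((1 - x) * qpoch_inf (x * q) q) ((1 - x) * qpoch (x * q) q N)"
    by (intro agree_mult agree_refl qpoch_inf_agree) (use assms in auto)
  then show "\<exists>n\<ge>N. agree N ((1 - x) * qpoch_inf (x * q) q) (qpoch x q n)"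
    by (intro exI[of _ "Suc N"]) (simp add: qpoch_rec)
qed

lemma qpoch_inf_even_odd:
  fixes x q :: "'a::comm_ring_1 fps"
  assumes "fps_nth q 0 = 0" "1 - fps_nth x 0 \<noteq> 0"
  shows "qpoch_inf x q = qpoch_inf x (q\<^sup>2) * qpoch_inf (x * q) (q\<^sup>2)"
proof (rule qpoch_inf_eqI[OF assms])
  fix N
  have "qpoch x q (2 * n) = qpoch x (q\<^sup>2) n * qpoch (x * q) (q\<^sup>2) n" for n
    by (induction n) (simp_all add: qpoch_Suc power_mult[symmetric] mult_ac)
  moreover have "agree N (qpoch_inf x (q\<^sup>2) * qpoch_inf (x * q) (q\<^sup>2)) (qpoch x (q\<^sup>2) N * qpoch (x * q) (q\<^sup>2) N)"
    by (intro agree_mult qpoch_inf_agree) (use assms in \<open>auto simp: power2_eq_square\<close>)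
  ultimately show "\<exists>n\<ge>N. agree N (qpoch_inf x (q\<^sup>2) * qpoch_inf (x * q) (q\<^sup>2)) (qpoch x q n)"
    by (intro exI[of _ "2 * N"]) simp
qed

lemma qpoch_inf_neg:
  fixes x q :: "'a::comm_ring_1 fps"
  assumes "fps_nth q 0 = 0" "1 - fps_nth x 0 \<noteq> 0" "1 + fps_nth x 0 \<noteq> 0" "1 - (fps_nth x 0)\<^sup>2 \<noteq> 0"
  shows "qpoch_inf (x\<^sup>2) (q\<^sup>2) = qpoch_inf x q * qpoch_inf (- x) q"
proof (rule qpoch_inf_eqI)
  fix N
  have "qpoch (x\<^sup>2) (q\<^sup>2) n = qpoch x q n * qpoch (- x) q n" for n
    by (induction n) (simp_all add: qpoch_Suc power_mult[symmetric] algebra_simps power2_eq_square)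
  moreover have "agree N (qpoch_inf x q * qpoch_inf (- x) q) (qpoch x q N * qpoch (- x) q N)"
    by (intro agree_mult qpoch_inf_agree) (use assms in auto)
  ultimately show "\<exists>n\<ge>N. agree N (qpoch_inf x q * qpoch_inf (- x) q) (qpoch (x\<^sup>2) (q\<^sup>2) n)"
    by (intro exI[of _ "N"]) simp
qed (use assms in \<open>auto simp: power2_eq_square\<close>)

lemma qpoch_inf_nth_0:
  fixes x q :: "'a::comm_ring_1 fps"
  assumes "fps_nth q 0 = 0" "1 - fps_nth x 0 \<noteq> 0"
  shows "fps_nth (qpoch_inf x q) 0 = 1 - fps_nth x 0"
  by (rule qpoch_inf_limit(2)[OF assms])

lemma fps_inv1: "f * fps_inv1 f = 1" if "fps_nth f 0 = 1" for f :: "'a::comm_ring_1 fps"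
  unfolding fps_inv1_def by (rule fps_right_inverse) (simp add: that)

lemma fps_inv2: "f * fps_inv2 f = 1" if "fps_nth (fps_nth f 0) 0 = 1" for f :: "'a::comm_ring_1 fps fps"
  unfolding fps_inv2_def by (rule fps_right_inverse) (simp add: fps_inv1 that)

section \<open>Constant terms of bivariate power series\<close>

definition zz :: "'a::comm_ring_1 fps fps" where "zz = fps_const fps_X"
abbreviation (input) ww :: "'a::comm_ring_1 fps fps" where "ww \<equiv> fps_X"

text \<open>Substitution of \<open>s = z w\<close> into a power series in \<open>s\<close>.\<close>

definition diag :: "'a::comm_ring_1 fps \<Rightarrow> 'a fps fps" where
  "diag f = Abs_fps (\<lambda>j. fps_const (fps_nth f j) * fps_X ^ j)"

text \<open>The formula of \<open>Delta_coeff\<close> for an arbitrary series in z and w =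
  s/z.\<close>

definition zcoeff :: "int \<Rightarrow> 'a::comm_ring_1 fps fps \<Rightarrow> 'a fps" where
  "zcoeff k f = Abs_fps (\<lambda>j. if 0 \<le> int j + k then fps_nth (fps_nth f j) (nat (int j + k)) else 0)"

lemma zz_nth_0 [simp]: "fps_nth zz 0 = fps_X"
  by (simp add: zz_def)

lemma diag_add: "diag (f + g) = diag f + diag g"
  and diag_uminus: "diag (- f) = - diag f"
  by (rule fps_ext, simp add: diag_def algebra_simps flip: fps_const_add fps_const_sub fps_const_neg)+

lemma diag_1 [simp]: "diag 1 = 1" and diag_0 [simp]: "diag 0 = 0"
  by (rule fps_ext, simp add: diag_def)+

lemma fps_const_sum: "fps_const (sum f I) = (\<Sum>i\<in>I. fps_const (f i))"
  by (rule fps_ext) (simp add: fps_sum_nth)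

lemma diag_mult: "diag (f * g) = diag f * diag g"
proof (rule fps_ext)
  fix n
  have "fps_nth (diag f * diag g) n = (\<Sum>i=0..n. fps_const (fps_nth f i * fps_nth g (n - i)) * fps_X ^ n)"
    unfolding fps_mult_nth
  proof (rule sum.cong[OF refl])
    fix i assume "i \<in> {0..n}"
    then have "fps_X ^ n = fps_X ^ i * (fps_X ^ (n - i) :: 'a fps)" by (simp flip: power_add)
    then show "fps_nth (diag f) i * fps_nth (diag g) (n - i) = fps_const (fps_nth f i * fps_nth g (n - i)) * fps_X ^ n"
      by (simp add: diag_def flip: fps_const_mult)
  qed
  also have "\<dots> = fps_nth (diag (f * g)) n"
    by (simp add: diag_def fps_mult_nth fps_const_sum flip: sum_distrib_right)
  finally show "fps_nth (diag (f * g)) n = fps_nth (diag f * diag g) n" ..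
qed

lemma diag_power: "diag (f ^ n) = diag f ^ n"
  by (induction n) (simp_all add: diag_mult)

lemma diag_X: "diag fps_X = zz * ww"
  by (rule fps_ext) (auto simp: diag_def zz_def fps_X_def)

lemma diag_const: "diag (fps_const c) = fps_const (fps_const c)"
  by (rule fps_ext) (auto simp: diag_def)

lemma diag_nth_0 [simp]: "fps_nth (diag f) 0 = fps_const (fps_nth f 0)"
  by (simp add: diag_def)

lemma agree_diag: "agree N f g \<Longrightarrow> agree N (diag f) (diag g)"
  by (auto simp: agree_def diag_def)

lemma zcoeff_add: "zcoeff k (f + g) = zcoeff k f + zcoeff k g"
  and zcoeff_diff: "zcoeff k (f - g) = zcoeff k f - zcoeff k g"
  by (rule fps_ext, simp add: zcoeff_def)+

lemma zcoeff_zz: "zcoeff k (zz * f) = zcoeff (k - 1) f"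
proof (rule fps_ext)
  fix j
  show "fps_nth (zcoeff k (zz * f)) j = fps_nth (zcoeff (k - 1) f) j"
    by (cases "int j + k" "0 :: int" rule: linorder_cases)
      (auto simp: zcoeff_def zz_def fps_X_mult_nth nat_diff_distrib' algebra_simps)
qed

lemma zcoeff_ww: "zcoeff k (ww * f) = fps_X * zcoeff (k + 1) f"
proof (rule fps_ext)
  fix j
  show "fps_nth (zcoeff k (ww * f)) j = fps_nth (fps_X * zcoeff (k + 1) f) j"
    by (cases j) (auto simp: zcoeff_def fps_X_mult_nth algebra_simps)
qed

text \<open>Multiplication by z w = s leaves the exponent of z alone; hence taking coefficients is
  linear over series in s.\<close>

lemma zcoeff_diag: "zcoeff k (diag c * f) = c * zcoeff k f"
proof (rule fps_ext)
  fix j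
  show "fps_nth (zcoeff k (diag c * f)) j = fps_nth (c * zcoeff k f) j"
  proof (cases "0 \<le> int j + k")
    case True
    have "fps_nth (zcoeff k (diag c * f)) j = (\<Sum>m=0..j. fps_nth (fps_nth (diag c) m * fps_nth f (j - m)) (nat (int j + k)))"
      using True by (simp add: zcoeff_def fps_mult_nth[of "diag c"] fps_sum_nth)
    also have "\<dots> = (\<Sum>m=0..j. fps_nth c m * fps_nth (zcoeff k f) (j - m))"
    proof (rule sum.cong[OF refl])
      fix m assume m: "m \<in> {0..j}"
      have "fps_nth (fps_nth (diag c) m * fps_nth f (j - m)) (nat (int j + k))
         = fps_nth c m * fps_nth (fps_X ^ m * fps_nth f (j - m)) (nat (int j + k))"
        by (simp add: diag_def mult.assoc)
      also have "\<dots> = fps_nth c m * fps_nth (zcoeff k f) (j - m)"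
        using m True by (auto simp: zcoeff_def fps_X_power_mult_nth of_nat_diff nat_diff_distrib' intro!: arg_cong2[where f = "(*)"] arg_cong2[where f = fps_nth])
      finally show "fps_nth (fps_nth (diag c) m * fps_nth f (j - m)) (nat (int j + k)) = fps_nth c m * fps_nth (zcoeff k f) (j - m)" .
    qed
    also have "\<dots> = fps_nth (c * zcoeff k f) j" by (simp add: fps_mult_nth)
    finally show ?thesis .
  next
    case False
    then have "fps_nth (zcoeff k f) (j - m) = 0" for m by (auto simp: zcoeff_def)
    with False show ?thesis by (simp add: zcoeff_def fps_mult_nth)
  qed
qed

lemma zcoeff_1: "zcoeff k 1 = (if k = 0 then 1 else 0)"
  by (rule fps_ext) (auto simp: zcoeff_def)

lemma agree_zcoeff: "agree N f g \<Longrightarrow> agree N (zcoeff k f) (zcoeff k g)"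
  by (auto simp: agree_def zcoeff_def)

section \<open>Series symmetric under inversion of z\<close>

definition zsym :: "'a::comm_ring_1 fps fps set" where
  "zsym = {f. \<forall>k. zcoeff (- k) f = zcoeff k f}"

lemma zsymD: "f \<in> zsym \<Longrightarrow> zcoeff (- k) f = zcoeff k f"
  by (simp add: zsym_def)

text \<open>Products of symmetric series need not be controlled by coefficients of the factors alone, so we
  work with the ring of multipliers.\<close>

definition zsym_mult :: "'a::comm_ring_1 fps fps set" where
  "zsym_mult = {m. \<forall>f\<in>zsym. m * f \<in> zsym}"

lemma zsym_closed:
  assumes "\<And>N. \<exists>t\<in>zsym. agree N f t" shows "f \<in> zsym"
  unfolding zsym_def
proof (safe, rule agree_eqI)
  fix k N
  obtain t where "t \<in> zsym" "agree N f t" using assms by blast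
  then show "agree N (zcoeff (- k) f) (zcoeff k f)"
    using agree_zcoeff[of N f t k] agree_zcoeff[of N f t "- k"] by (auto simp: zsym_def agree_def)
qed

lemma zsym_mult_closed:
  assumes "\<And>N. \<exists>t\<in>zsym_mult. agree N f t" shows "f \<in> zsym_mult"
  unfolding zsym_mult_def
proof (safe, rule zsym_closed)
  fix g N assume "g \<in> (zsym :: 'a fps fps set)"
  moreover obtain t where "t \<in> zsym_mult" "agree N f t" using assms by blast
  ultimately show "\<exists>t\<in>zsym. agree N (f * g) t"
    by (intro bexI[of _ "t * g"] agree_mult) (auto simp: zsym_mult_def)
qed

lemma zsym_1: "1 \<in> zsym" by (auto simp: zsym_def zcoeff_1)

lemma zsym_mult_diag: "diag c \<in> zsym_mult"
  by (auto simp: zsym_mult_def zsym_def zcoeff_diag)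

lemma zsym_mult_1: "1 \<in> zsym_mult" by (auto simp: zsym_mult_def)

lemma zsym_mult_add: "f \<in> zsym_mult \<Longrightarrow> g \<in> zsym_mult \<Longrightarrow> f + g \<in> zsym_mult"
  and zsym_mult_diff: "f \<in> zsym_mult \<Longrightarrow> g \<in> zsym_mult \<Longrightarrow> f - g \<in> zsym_mult"
  by (auto simp: zsym_mult_def zsym_def zcoeff_add zcoeff_diff algebra_simps)

lemma zsym_mult_mult: "f \<in> zsym_mult \<Longrightarrow> g \<in> zsym_mult \<Longrightarrow> f * g \<in> zsym_mult"
  by (auto simp: zsym_mult_def mult.assoc)

lemma zsym_mult_power: "f \<in> zsym_mult \<Longrightarrow> f ^ n \<in> zsym_mult"
  by (induction n) (auto intro: zsym_mult_mult zsym_mult_1)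

lemma zsym_mult_sum: "(\<And>i. i \<in> I \<Longrightarrow> f i \<in> zsym_mult) \<Longrightarrow> sum f I \<in> zsym_mult"
  by (induction I rule: infinite_finite_induct)
    (use zsym_mult_diag[of 0] in \<open>auto intro: zsym_mult_add\<close>)

lemma zsym_mult_prod: "(\<And>i. i \<in> I \<Longrightarrow> f i \<in> zsym_mult) \<Longrightarrow> prod f I \<in> zsym_mult"
  by (induction I rule: infinite_finite_induct) (auto intro: zsym_mult_mult zsym_mult_1)

text \<open>This multiplier is s (z + 1/z); the factor s is there because 1/z is not a power series
  in z and w. The symmetric products below are built from it.\<close>

lemma zsym_mult_gen: "diag fps_X * zz + ww \<in> zsym_mult"
proof -
  have "zcoeff (- k) ((diag fps_X * zz + ww) * f) = zcoeff k ((diag fps_X * zz + ww) * f)"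
    if "f \<in> zsym" for f :: "'a fps fps" and k
  proof -
    have c: "zcoeff k ((diag fps_X * zz + ww) * f) = fps_X * zcoeff (k - 1) f + fps_X * zcoeff (k + 1) f" for k
      by (simp add: distrib_right mult.assoc zcoeff_add zcoeff_diag zcoeff_zz zcoeff_ww)
    have "zcoeff (k - 1) f = zcoeff (- k + 1) f" "zcoeff (k + 1) f = zcoeff (- k - 1) f"
      using zsymD[OF that, of "k - 1"] zsymD[OF that, of "k + 1"] by simp_all
    then show ?thesis by (simp add: c)
  qed
  then show ?thesis by (auto simp: zsym_mult_def zsym_def)
qed

text \<open>Geometric series in h = 1 - m: by \<open>m0\<close>, h is divisible by w, so h^N
  vanishes modulo w^N.\<close>

lemma zsym_mult_inverse:
  assumes m: "m \<in> zsym_mult" and inv: "m * m' = 1" and m0: "fps_nth m 0 = 1"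
  shows "m' \<in> zsym_mult"
proof (rule zsym_mult_closed)
  fix N
  define h where "h = 1 - m"
  have h: "h \<in> zsym_mult" unfolding h_def by (intro zsym_mult_diff zsym_mult_1 m)
  have "m * (\<Sum>i<N. h ^ i) = 1 - h ^ N"
    by (simp add: one_diff_power_eq h_def)
  then have "m' * (m * (\<Sum>i<N. h ^ i)) = m' * (1 - h ^ N)" by simp
  then have "(\<Sum>i<N. h ^ i) = m' - m' * h ^ N"
    using inv by (simp add: right_diff_distrib mult.left_commute[of m'] flip: mult.assoc) (simp add: mult_ac)
  moreover have "agree N (m' - m' * h ^ N) (m' - 0)"
    by (intro agree_diff agree_refl agree_power_0) (simp add: h_def m0)
  ultimately show "\<exists>t\<in>zsym_mult. agree N m' t"
    by (intro bexI[of _ "\<Sum>i<N. h ^ i"] zsym_mult_sum zsym_mult_power h) (simp add: agree_sym)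
qed

section \<open>The weight function with parameters in A[[s]]\<close>

text \<open>As in \<open>Delta\<close>, the last two parameters are \<open>c / s\<close> and \<open>d / s\<close>.\<close>

definition aw_num :: "'a::comm_ring_1 fps fps" where
  "aw_num = qpochs_inf [zz ^ 2, ww ^ 2] ((zz * ww) ^ 2)"

definition aw_den :: "'a::comm_ring_1 fps \<Rightarrow> 'a fps \<Rightarrow> 'a fps \<Rightarrow> 'a fps \<Rightarrow> 'a fps fps" where
  "aw_den a b c d = qpochs_inf [diag a * zz, diag b * zz, diag c * (zz * ww) * zz, diag d * (zz * ww) * zz,
      diag a * (zz * ww) * ww, diag b * (zz * ww) * ww, diag c * ww, diag d * ww] ((zz * ww) ^ 2)"

definition aw_weight :: "'a::comm_ring_1 fps \<Rightarrow> 'a fps \<Rightarrow> 'a fps \<Rightarrow> 'a fps \<Rightarrow> 'a fps fps" where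
  "aw_weight a b c d = aw_num * fps_inv2 (aw_den a b c d)"

lemma one_minus_nth_0: "fps_nth (fps_nth x 0) 0 = 0 \<Longrightarrow> 1 - fps_nth x 0 \<noteq> (0 :: 'a::comm_ring_1 fps)"
  by (metis diff_zero fps_one_nth fps_sub_nth fps_zero_nth zero_neq_one)

lemma qpoch_inf_rec2:
  fixes x q :: "'a::comm_ring_1 fps fps"
  assumes "fps_nth q 0 = 0" "fps_nth (fps_nth x 0) 0 = 0"
  shows "qpoch_inf x q = (1 - x) * qpoch_inf (x * q) q"
  by (rule qpoch_inf_rec[OF assms(1) one_minus_nth_0[OF assms(2)]])

lemma aw_den_nth_0: "fps_nth (fps_nth (aw_den a b c d) 0) 0 = 1"
  by (simp add: aw_den_def qpochs_inf_def qpoch_inf_nth_0 one_minus_nth_0 power2_eq_square)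

lemma aw_den_inv: "aw_den a b c d * fps_inv2 (aw_den a b c d) = 1"
  by (rule fps_inv2[OF aw_den_nth_0])

lemma aw_weight_den: "aw_weight a b c d * aw_den a b c d = aw_num"
  using aw_den_inv[of a b c d] by (simp add: aw_weight_def mult_ac)

lemma aw_den_cancel: "f * aw_den a b c d = g * aw_den a b c d \<Longrightarrow> f = g"
  by (metis aw_den_inv mult.assoc mult.right_neutral)

lemma aw_weight_unique: "f * aw_den a b c d = aw_num \<Longrightarrow> f = aw_weight a b c d"
  by (metis aw_den_cancel aw_weight_den)

subsection \<open>Reflection symmetry\<close>

text \<open>With w = s/z this is (e s z, e s/z; q), a pair exchanged by z -> 1/z.\<close>

definition refl_pair :: "'a::comm_ring_1 fps \<Rightarrow> 'a fps fps" where
  "refl_pair e = qpoch_inf (diag e * (zz * ww) * zz) ((zz * ww)\<^sup>2) * qpoch_inf (diag e * ww) ((zz * ww)\<^sup>2)"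

text \<open>This is (q z^2, q/z^2; q), the numerator of the weight without its factor 1 -
  z^2.\<close>

definition refl_num :: "'a::comm_ring_1 fps fps" where
  "refl_num = qpoch_inf (zz\<^sup>2 * (zz * ww)\<^sup>2) ((zz * ww)\<^sup>2) * qpoch_inf (ww\<^sup>2) ((zz * ww)\<^sup>2)"

lemma zsym_mult_limit:
  assumes "\<And>j. f j \<in> zsym_mult" "\<And>N. agree N g (\<Prod>j<N. f j)" shows "g \<in> zsym_mult"
  using assms by (intro zsym_mult_closed) (blast intro: zsym_mult_prod)

lemma diag_numeral: "diag (numeral n) = numeral n"
  by (metis diag_const numeral_fps_const)

lemma refl_pair_zsym: "refl_pair e \<in> zsym_mult"
proof (rule zsym_mult_limit)
  let ?q = "(zz * ww)\<^sup>2"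
  fix j
  \<comment> \<open>Two factors exchanged by inversion multiply to a polynomial in s (z + 1/z) and
    s.\<close>
  have identity: "(1 - x * (z * w) * z * p) * (1 - x * w * p) = 1 - x * p * (z * w * z + w) + (x * p)\<^sup>2 * (z * w)\<^sup>2"
    for x z w p :: "'a fps fps"
    by (simp add: algebra_simps power2_eq_square)
  have "(1 - diag e * (zz * ww) * zz * ?q ^ j) * (1 - diag e * ww * ?q ^ j) =
     1 - diag (e * (fps_X\<^sup>2) ^ j) * (diag fps_X * zz + ww) + diag ((e * (fps_X\<^sup>2) ^ j)\<^sup>2 * fps_X\<^sup>2)"
    unfolding diag_mult diag_power diag_X
    by (rule identity)
  also have "\<dots> \<in> zsym_mult"
    by (intro zsym_mult_add zsym_mult_diff zsym_mult_1 zsym_mult_mult zsym_mult_diag zsym_mult_gen)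
  finally show "(1 - diag e * (zz * ww) * zz * ?q ^ j) * (1 - diag e * ww * ?q ^ j) \<in> zsym_mult" .
next
  fix N
  show "agree N (refl_pair e) (\<Prod>j<N. (1 - diag e * (zz * ww) * zz * ((zz * ww)\<^sup>2) ^ j) * (1 - diag e * ww * ((zz * ww)\<^sup>2) ^ j))"
    unfolding refl_pair_def prod.distrib qpoch_def[symmetric]
    by (intro agree_mult qpoch_inf_agree) (auto simp: one_minus_nth_0 power2_eq_square)
qed

lemma refl_num_zsym: "(refl_num :: 'a::comm_ring_1 fps fps) \<in> zsym_mult"
proof (rule zsym_mult_limit)
  let ?y = "zz\<^sup>2 * (zz * ww :: 'a fps fps)\<^sup>2" and ?q = "(zz * ww :: 'a fps fps)\<^sup>2"
  fix j
  have identity: "(1 - z\<^sup>2 * (z * w)\<^sup>2 * p) * (1 - w\<^sup>2 * p) = 1 - p * ((z * w * z + w)\<^sup>2 - 2 * (z * w)\<^sup>2) + p\<^sup>2 * (z * w)\<^sup>2 * (z * w)\<^sup>2"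
    for z w p :: "'a fps fps"
    by (simp add: algebra_simps power2_eq_square)
  have "(1 - ?y * ?q ^ j) * (1 - ww\<^sup>2 * ?q ^ j) =
     1 - diag ((fps_X\<^sup>2) ^ j) * ((diag fps_X * zz + ww)\<^sup>2 - diag (2 * fps_X\<^sup>2)) + diag (((fps_X\<^sup>2) ^ j)\<^sup>2 * fps_X\<^sup>2 * fps_X\<^sup>2)"
    unfolding diag_mult diag_power diag_X diag_numeral
    by (rule identity)
  also have "\<dots> \<in> zsym_mult"
    by (intro zsym_mult_add zsym_mult_diff zsym_mult_1 zsym_mult_mult zsym_mult_power zsym_mult_diag zsym_mult_gen)
  finally show "(1 - ?y * ?q ^ j) * (1 - ww\<^sup>2 * ?q ^ j) \<in> zsym_mult" .
next
  fix N
  show "agree N (refl_num :: 'a fps fps) (\<Prod>j<N. (1 - zz\<^sup>2 * (zz * ww)\<^sup>2 * ((zz * ww)\<^sup>2) ^ j) * (1 - ww\<^sup>2 * ((zz * ww)\<^sup>2) ^ j))"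
    unfolding refl_num_def prod.distrib qpoch_def[symmetric]
    by (intro agree_mult qpoch_inf_agree) (auto simp: one_minus_nth_0 power2_eq_square)
qed

text \<open>The factors of \<open>c\<close> and \<open>d\<close> already come in pairs exchanged by
  inversion. Those of \<open>a\<close> and \<open>b\<close> do so once 1 - a z and 1 - b z are split
  off, since (a q z, a q/z; q) is \<open>refl_pair (a * fps_X)\<close>.\<close>

lemma aw_weight_refl:
  "\<exists>g\<in>zsym. (1 - diag a * zz) * (1 - diag b * zz) * aw_weight a b c d = (1 - zz\<^sup>2) * g"
proof -
  let ?q = "(zz * ww :: 'a fps fps)\<^sup>2"
  define D where "D = refl_pair (a * fps_X) * refl_pair (b * fps_X) * refl_pair c * refl_pair d"
  define g where "g = refl_num * fps_inv2 D"
  have D0: "fps_nth D 0 = 1"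
    by (simp add: D_def refl_pair_def qpoch_inf_nth_0 one_minus_nth_0 power2_eq_square)
  have D: "D \<in> zsym_mult" unfolding D_def by (intro zsym_mult_mult refl_pair_zsym)
  have inv: "D * fps_inv2 D = 1" by (rule fps_inv2) (simp add: D0)
  have "g * 1 \<in> zsym" unfolding g_def
    using zsym_mult_mult[OF refl_num_zsym zsym_mult_inverse[OF D inv D0]] zsym_1 by (auto simp: zsym_mult_def)
  moreover have "(1 - diag a * zz) * (1 - diag b * zz) * aw_weight a b c d = (1 - zz\<^sup>2) * g"
  proof -
    have num: "aw_num = (1 - zz\<^sup>2) * (refl_num :: 'a fps fps)"
      using qpoch_inf_rec2[of ?q "zz\<^sup>2"] by (simp add: aw_num_def refl_num_def qpochs_inf_def power2_eq_square)
    have r: "qpoch_inf (diag e * zz) ?q * qpoch_inf (diag e * (zz * ww) * ww) ?q = (1 - diag e * zz) * refl_pair (e * fps_X)" for e :: "'a fps"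
      unfolding refl_pair_def
      by (subst qpoch_inf_rec2[of _ "diag e * zz"]) (auto simp: power2_eq_square diag_mult diag_X mult_ac)
    have "aw_den a b c d = (qpoch_inf (diag a * zz) ?q * qpoch_inf (diag a * (zz * ww) * ww) ?q) *
        (qpoch_inf (diag b * zz) ?q * qpoch_inf (diag b * (zz * ww) * ww) ?q) * refl_pair c * refl_pair d"
      by (simp add: aw_den_def qpochs_inf_def refl_pair_def mult_ac)
    also have "\<dots> = (1 - diag a * zz) * (1 - diag b * zz) * D"
      unfolding r D_def by (simp add: mult_ac)
    finally have "aw_weight a b c d * ((1 - diag a * zz) * (1 - diag b * zz) * D) = (1 - zz\<^sup>2) * refl_num"
      using aw_weight_den[of a b c d] num by simp
    then have "aw_weight a b c d * ((1 - diag a * zz) * (1 - diag b * zz) * D) * fps_inv2 D = (1 - zz\<^sup>2) * refl_num * fps_inv2 D"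
      by simp
    then have "aw_weight a b c d * (1 - diag a * zz) * (1 - diag b * zz) * (D * fps_inv2 D) = (1 - zz\<^sup>2) * (refl_num * fps_inv2 D)"
      by (simp only: mult_ac)
    then show ?thesis unfolding inv mult_1_right g_def by (simp only: mult_ac)
  qed
  ultimately show ?thesis by auto
qed

definition moment :: "int \<Rightarrow> 'a::comm_ring_1 fps \<Rightarrow> 'a fps \<Rightarrow> 'a fps \<Rightarrow> 'a fps \<Rightarrow> 'a fps" where
  "moment k a b c d = zcoeff k (aw_weight a b c d)"

lemma moment_telescope:
  "\<exists>g\<in>zsym. \<forall>k. moment (k + 1) a b c d - (a + b) * moment k a b c d + a * b * moment (k - 1) a b c d =
     zcoeff (k + 1) g - zcoeff (k - 1) g"
proof -
  obtain g where g: "g \<in> zsym" "(1 - diag a * zz) * (1 - diag b * zz) * aw_weight a b c d = (1 - zz\<^sup>2) * g"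
    using aw_weight_refl by blast
  have "moment (k + 1) a b c d - (a + b) * moment k a b c d + a * b * moment (k - 1) a b c d = zcoeff (k + 1) g - zcoeff (k - 1) g" for k
  proof -
    let ?f = "aw_weight a b c d"
    have "(1 - diag a * zz) * (1 - diag b * zz) * ?f = ?f - diag (a + b) * (zz * ?f) + diag (a * b) * (zz * (zz * ?f))"
      by (simp add: diag_add diag_mult algebra_simps)
    then have "zcoeff (k + 1) ((1 - diag a * zz) * (1 - diag b * zz) * ?f) =
        moment (k + 1) a b c d - (a + b) * moment k a b c d + a * b * moment (k - 1) a b c d"
      by (simp add: moment_def zcoeff_add zcoeff_diff zcoeff_diag zcoeff_zz)
    moreover have "(1 - zz\<^sup>2) * g = g - zz * (zz * g)" by (simp add: algebra_simps power2_eq_square)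
    then have "zcoeff (k + 1) ((1 - zz\<^sup>2) * g) = zcoeff (k + 1) g - zcoeff (k - 1) g"
      by (simp add: zcoeff_diff zcoeff_zz)
    ultimately show ?thesis using g(2) by simp
  qed
  with g(1) show ?thesis by blast
qed

text \<open>The right-hand side of \<open>moment_telescope\<close> is odd under k -> -k because
  \<open>g\<close> is symmetric.\<close>

lemma moment_refl:
  fixes k :: int and a b c d :: "'a::comm_ring_1 fps"
  defines "\<mu> \<equiv> \<lambda>k. moment k a b c d"
  shows "\<mu> (k + 1) - (a + b) * \<mu> k + a * b * \<mu> (k - 1) + (\<mu> (- k + 1) - (a + b) * \<mu> (- k) + a * b * \<mu> (- k - 1)) = 0"
proof -
  obtain g where g: "g \<in> zsym" "\<And>k. \<mu> (k + 1) - (a + b) * \<mu> k + a * b * \<mu> (k - 1) = zcoeff (k + 1) g - zcoeff (k - 1) g"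
    using moment_telescope[of a b c d] unfolding \<mu>_def by blast
  have "zcoeff (- k + 1) g = zcoeff (k - 1) g" "zcoeff (- k - 1) g = zcoeff (k + 1) g"
    using zsymD[OF g(1), of "k - 1"] zsymD[OF g(1), of "k + 1"] by simp_all
  then show ?thesis unfolding g(2) by simp
qed

text \<open>The case \<open>k = 0\<close> of the previous lemma without the factor 2.\<close>

lemma moment_refl_0: "moment 1 a b c d - (a + b) * moment 0 a b c d + a * b * moment (- 1) a b c d = 0"
proof -
  obtain g where "g \<in> zsym" "\<And>k. moment (k + 1) a b c d - (a + b) * moment k a b c d + a * b * moment (k - 1) a b c d = zcoeff (k + 1) g - zcoeff (k - 1) g"
    using moment_telescope[of a b c d] by blast
  then show ?thesis using zsymD[of g 1] by (metis add_0 diff_0 diff_self)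
qed

subsection \<open>Exchanging z and w\<close>

text \<open>As z w = s, this is the substitution z -> s/z, which conjugates z -> 1/z into z ->
  q/z.\<close>

definition fps_swap :: "'a::comm_ring_1 fps fps \<Rightarrow> 'a fps fps" where
  "fps_swap f = Abs_fps (\<lambda>i. Abs_fps (\<lambda>j. fps_nth (fps_nth f j) i))"

lemma fps_swap_nth [simp]: "fps_nth (fps_nth (fps_swap f) i) j = fps_nth (fps_nth f j) i"
  by (simp add: fps_swap_def)

lemma fps2_ext: "(\<And>i j. fps_nth (fps_nth f i) j = fps_nth (fps_nth g i) j) \<Longrightarrow> f = g"
  by (intro fps_ext)

lemma fps_swap_mult: "fps_swap (f * g) = fps_swap f * fps_swap g"
proof (rule fps2_ext)
  fix i j
  show "fps_nth (fps_nth (fps_swap (f * g)) i) j = fps_nth (fps_nth (fps_swap f * fps_swap g) i) j"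
    unfolding fps_swap_nth fps_mult_nth fps_sum_nth by (rule sum.swap)
qed

lemma fps_swap_diff: "fps_swap (f - g) = fps_swap f - fps_swap g"
  by (rule fps2_ext) simp

lemma fps_swap_1 [simp]: "fps_swap 1 = 1"
  by (rule fps2_ext) simp

lemma fps_swap_zz [simp]: "fps_swap zz = ww" and fps_swap_ww [simp]: "fps_swap ww = zz"
  by (rule fps2_ext, auto simp: zz_def fps_X_def)+

lemma fps_swap_diag [simp]: "fps_swap (diag a) = diag a"
  by (rule fps2_ext) (auto simp: diag_def)

lemma fps_swap_power: "fps_swap (f ^ n) = fps_swap f ^ n"
  by (induction n) (simp_all add: fps_swap_mult)

lemma fps_swap_qpoch_inf:
  fixes x q :: "'a::comm_ring_1 fps fps"
  assumes q: "fps_nth q 0 = 0" "fps_swap q = q" and x: "1 - fps_nth x 0 \<noteq> 0" "1 - fps_nth (fps_swap x) 0 \<noteq> 0"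
  shows "fps_swap (qpoch_inf x q) = qpoch_inf (fps_swap x) q"
proof (rule fps2_ext)
  fix i j
  have s: "fps_swap (qpoch x q n) = qpoch (fps_swap x) q n" for n
    by (induction n) (simp_all add: qpoch_Suc fps_swap_mult fps_swap_diff fps_swap_power q)
  define n where "n = max (Suc i) (Suc j)"
  have "fps_nth (qpoch_inf x q) j = fps_nth (qpoch x q n) j"
    using qpoch_inf_agree[OF q(1) x(1), of n n] by (simp add: agree_def n_def)
  moreover have "fps_nth (qpoch_inf (fps_swap x) q) i = fps_nth (qpoch (fps_swap x) q n) i"
    using qpoch_inf_agree[OF q(1) x(2), of n n] by (simp add: agree_def n_def)
  ultimately show "fps_nth (fps_nth (fps_swap (qpoch_inf x q)) i) j = fps_nth (fps_nth (qpoch_inf (fps_swap x) q) i) j"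
    by (simp flip: s)
qed

text \<open>The reason for passing c/s and d/s as parameters: the denominator factors of (a, b) and
  of (c, d) then have the same shape up to exchanging z and w.\<close>

lemma aw_weight_swap: "fps_swap (aw_weight a b c d) = aw_weight c d a b"
proof (rule aw_weight_unique)
  let ?q = "(zz * ww :: 'a fps fps)\<^sup>2"
  have q: "fps_swap ?q = ?q" "fps_nth ?q 0 = 0" by (simp_all add: power2_eq_square fps_swap_mult mult_ac)
  have sw: "fps_swap (qpoch_inf x ?q) = qpoch_inf (fps_swap x) ?q" if "fps_nth (fps_nth x 0) 0 = 0" for x
    by (rule fps_swap_qpoch_inf[OF q(2,1)]) (rule one_minus_nth_0, simp add: that)+
  have "fps_swap (aw_weight a b c d) * fps_swap (aw_den a b c d) = fps_swap aw_num"
    by (simp add: aw_weight_den flip: fps_swap_mult)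
  moreover have "fps_swap aw_num = (aw_num :: 'a fps fps)"
    using sw[of "zz\<^sup>2"] sw[of "ww\<^sup>2"]
    by (simp add: aw_num_def qpochs_inf_def fps_swap_mult fps_swap_power power2_eq_square[of fps_X]
        power2_eq_square[of zz])
  moreover have "fps_swap (aw_den a b c d) = aw_den c d a b"
    by (simp add: aw_den_def qpochs_inf_def fps_swap_mult sw) (simp only: mult_ac)
  ultimately show "fps_swap (aw_weight a b c d) * aw_den c d a b = aw_num" by simp
qed

lemma zcoeff_swap: "fps_X ^ k * zcoeff (int k) (fps_swap f) = zcoeff (- int k) f"
  by (rule fps_ext) (auto simp: zcoeff_def fps_X_power_mult_nth of_nat_diff nat_diff_distrib')

lemma moment_swap: "moment (- int k) a b c d = fps_X ^ k * moment (int k) c d a b"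
  using zcoeff_swap[of k "aw_weight a b c d"] by (simp add: moment_def aw_weight_swap)

lemma moment_swap_0: "moment 0 a b c d = moment 0 c d a b"
  using moment_swap[of 0 a b c d] by simp

lemma moment_swap_refl_0:
  fixes a b c d :: "'a::comm_ring_1 fps"
  defines "C \<equiv> c * fps_X" and "D \<equiv> d * fps_X"
  shows "moment (- 1) a b c d - (C + D) * moment 0 a b c d + C * D * moment 1 a b c d = 0"
proof -
  have *: "moment (- 1) a b c d = fps_X * moment 1 c d a b" "moment (- 1) c d a b = fps_X * moment 1 a b c d"
    using moment_swap[of 1 a b c d] moment_swap[of 1 c d a b] by simp_all
  have "moment (- 1) a b c d - (C + D) * moment 0 a b c d + C * D * moment 1 a b c d =
      fps_X * (moment 1 c d a b - (c + d) * moment 0 c d a b + c * d * moment (- 1) c d a b)"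
    unfolding * moment_swap_0[of a b c d] by (simp add: C_def D_def algebra_simps)
  then show ?thesis by (simp add: moment_refl_0)
qed

text \<open>This is \<open>moment_refl\<close> for the swapped weight, multiplied by s^(k+1). The
  power q^k appears because the moments of degrees k and -k are rescaled by opposite powers of
  s.\<close>

lemma moment_swap_refl:
  fixes k :: nat and a b c d :: "'a::comm_ring_1 fps"
  defines "\<mu> \<equiv> \<lambda>k. moment k a b c d" and "C \<equiv> c * fps_X" and "D \<equiv> d * fps_X"
  shows "\<mu> (- int k - 1) - (C + D) * \<mu> (- int k) + C * D * \<mu> (- int k + 1) +
    (fps_X\<^sup>2) ^ k * (\<mu> (int k - 1) - (C + D) * \<mu> (int k) + C * D * \<mu> (int k + 1)) = 0"
proof -
  define \<nu> where "\<nu> k = moment k c d a b" for k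
  have neg: "\<mu> (- int k) = fps_X ^ k * \<nu> (int k)" and neg': "\<nu> (- int k) = fps_X ^ k * \<mu> (int k)" for k
    by (simp_all add: \<mu>_def \<nu>_def moment_swap)
  have H: "\<nu> (int k + 1) - (c + d) * \<nu> (int k) + c * d * \<nu> (int k - 1) + (\<nu> (- int k + 1) - (c + d) * \<nu> (- int k) + c * d * \<nu> (- int k - 1)) = 0"
    unfolding \<nu>_def by (rule moment_refl)
  have e: "- int k - 1 = - int (Suc k)" "int k + 1 = int (Suc k)" for k by simp_all
  show ?thesis
  proof (cases k)
    case 0
    then show ?thesis using moment_swap_refl_0[of a b c d] by (simp add: \<mu>_def C_def D_def)
  next
    case (Suc m)
    define p :: "'a fps" where "p = fps_X ^ m"
    have p: "fps_X ^ k = fps_X * p" "(fps_X\<^sup>2) ^ k = fps_X * fps_X * p * p"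
      by (simp_all add: Suc p_def power2_eq_square power_mult_distrib mult_ac)
    have i: "int k - 1 = int m" "- int k + 1 = - int m" "- int k - 1 = - int (Suc k)" "int k + 1 = int (Suc k)" using Suc by simp_all
    have n: "\<mu> (- int m) = p * \<nu> (int m)" "\<nu> (- int m) = p * \<mu> (int m)"
      "\<mu> (- int k) = fps_X * p * \<nu> (int k)" "\<nu> (- int k) = fps_X * p * \<mu> (int k)"
      "\<mu> (- int (Suc k)) = fps_X * (fps_X * p) * \<nu> (int (Suc k))" "\<nu> (- int (Suc k)) = fps_X * (fps_X * p) * \<mu> (int (Suc k))"
      unfolding neg neg' power_Suc p by (simp_all add: p_def)
    have eq: "x * (x * p) * n2 - (c * x + d * x) * (x * p * n1) + c * x * (d * x) * (p * n0) +
        x * x * p * p * (m0 - (c * x + d * x) * m1 + c * x * (d * x) * m2) =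
      x * (x * p) * (n2 - (c + d) * n1 + c * d * n0 + (p * m0 - (c + d) * (x * p * m1) + c * d * (x * (x * p) * m2)))"
      for x n0 n1 n2 m0 m1 m2 :: "'a fps"
      by (simp add: algebra_simps)
    show ?thesis
      by (simp only: i n C_def D_def p eq H[unfolded i n] mult_zero_right)
  qed
qed

subsection \<open>The constant term\<close>

lemma aw_weight_shift:
  "aw_weight (a * fps_X\<^sup>2) b c d = (1 - diag a * zz) * (1 - diag a * (zz * ww) * ww) * aw_weight a b c d"
proof (rule aw_den_cancel)
  let ?q = "(zz * ww :: 'a fps fps)\<^sup>2"
  have "qpoch_inf (diag a * zz) ?q = (1 - diag a * zz) * qpoch_inf (diag (a * fps_X\<^sup>2) * zz) ?q"
    by (subst qpoch_inf_rec2) (auto simp: power2_eq_square diag_mult diag_X mult_ac)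
  moreover have "qpoch_inf (diag a * (zz * ww) * ww) ?q = (1 - diag a * (zz * ww) * ww) * qpoch_inf (diag (a * fps_X\<^sup>2) * (zz * ww) * ww) ?q"
    by (subst qpoch_inf_rec2) (auto simp: power2_eq_square diag_mult diag_X mult_ac)
  ultimately have D: "aw_den a b c d = (1 - diag a * zz) * (1 - diag a * (zz * ww) * ww) * aw_den (a * fps_X\<^sup>2) b c d"
    by (simp add: aw_den_def qpochs_inf_def)
  have "(1 - diag a * zz) * (1 - diag a * (zz * ww) * ww) * aw_weight a b c d * aw_den (a * fps_X\<^sup>2) b c d =
      aw_weight a b c d * aw_den a b c d"
    by (simp only: D mult_ac)
  then show "aw_weight (a * fps_X\<^sup>2) b c d * aw_den (a * fps_X\<^sup>2) b c d =
      (1 - diag a * zz) * (1 - diag a * (zz * ww) * ww) * aw_weight a b c d * aw_den (a * fps_X\<^sup>2) b c d"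
    by (simp only: aw_weight_den)
qed

lemma moment_0_shift:
  fixes a b c d :: "'a::comm_ring_1 fps"
  defines "C \<equiv> c * fps_X" and "D \<equiv> d * fps_X" and "q \<equiv> fps_X\<^sup>2"
  shows "(1 - a * b * C * D) * moment 0 (a * q) b c d =
    (1 - a * b * q) * (1 - a * C) * (1 - a * D) * moment 0 a b c d"
proof -
  define \<mu> where "\<mu> k = moment k a b c d" for k
  have "(1 - diag a * zz) * (1 - diag a * (zz * ww) * ww) * aw_weight a b c d =
     aw_weight a b c d + diag (a\<^sup>2 * q) * aw_weight a b c d - diag a * (zz * aw_weight a b c d) - diag (a * fps_X) * (ww * aw_weight a b c d)"
    by (simp add: diag_mult diag_X q_def power2_eq_square algebra_simps)
  then have "moment 0 (a * q) b c d = zcoeff 0 (aw_weight a b c d + diag (a\<^sup>2 * q) * aw_weight a b c d - diag a * (zz * aw_weight a b c d) - diag (a * fps_X) * (ww * aw_weight a b c d))"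
    by (simp only: moment_def q_def aw_weight_shift)
  then have 1: "moment 0 (a * q) b c d = \<mu> 0 + a\<^sup>2 * q * \<mu> 0 - a * \<mu> (- 1) - a * q * \<mu> 1"
    by (simp only: moment_def \<mu>_def zcoeff_add zcoeff_diff zcoeff_diag zcoeff_zz zcoeff_ww)
      (simp add: q_def power2_eq_square mult_ac)
  have "\<mu> (- 1) - (C + D) * \<mu> 0 + C * D * \<mu> 1 = 0" "\<mu> 1 - (a + b) * \<mu> 0 + a * b * \<mu> (- 1) = 0"
    unfolding \<mu>_def C_def D_def by (rule moment_swap_refl_0 moment_refl_0)+
  \<comment> \<open>The multipliers are chosen so that the moments of degree -1 and 1 acquire the
    coefficients -a (1 - abCD) and -a q (1 - abCD), as in the shifted constant term times 1 -
    abCD.\<close>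
  then have "0 = - a * (1 - a * b * q) * (\<mu> (- 1) - (C + D) * \<mu> 0 + C * D * \<mu> 1) - a * (q - C * D) * (\<mu> 1 - (a + b) * \<mu> 0 + a * b * \<mu> (- 1))"
    by simp
  also have "\<dots> = (1 - a * b * C * D) * (\<mu> 0 + a\<^sup>2 * q * \<mu> 0 - a * \<mu> (- 1) - a * q * \<mu> 1) - (1 - a * b * q) * (1 - a * C) * (1 - a * D) * \<mu> 0"
    by (simp add: algebra_simps power2_eq_square)
  finally show ?thesis unfolding 1 by (simp add: \<mu>_def)
qed

definition askey_product :: "'a::comm_ring_1 fps \<Rightarrow> 'a fps \<Rightarrow> 'a fps \<Rightarrow> 'a fps \<Rightarrow> 'a fps" where
  "askey_product a b c d = (let C = c * fps_X; D = d * fps_X; q = fps_X\<^sup>2 in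
     qpochs_inf [a * b * q, a * C, a * D, b * C, b * D, C * D] q)"

text \<open>The constant term divided by its expected value, except for the factor (q; q), which
  involves no parameter. The goal is that this quotient does not depend on the parameters.\<close>

definition askey_const :: "'a::comm_ring_1 fps \<Rightarrow> 'a fps \<Rightarrow> 'a fps \<Rightarrow> 'a fps \<Rightarrow> 'a fps" where
  "askey_const a b c d = moment 0 a b c d * askey_product a b c d * fps_inv1 (qpoch_inf (a * b * (c * fps_X) * (d * fps_X)) (fps_X\<^sup>2))"

lemma askey_denominator_inv:
  "qpoch_inf (a * b * (c * fps_X) * (d * fps_X)) (fps_X\<^sup>2) * fps_inv1 (qpoch_inf (a * b * (c * fps_X) * (d * fps_X)) (fps_X\<^sup>2)) = 1"
  by (intro fps_inv1, subst qpoch_inf_nth_0) (auto simp: power2_eq_square)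

text \<open>Since C D = c d q, the factors for \<open>a * b * q\<close> and \<open>C * D\<close>
  trade places, and abCD is unchanged.\<close>

lemma askey_const_swap: "askey_const a b c d = askey_const c d a b"
proof -
  have "askey_product a b c d = askey_product c d a b"
    by (simp add: askey_product_def qpochs_inf_def Let_def power2_eq_square mult_ac)
  then show ?thesis by (simp add: askey_const_def moment_swap_0[of a b] mult_ac)
qed

lemma askey_const_commute: "askey_const a b c d = askey_const b a c d"
proof -
  have "askey_product a b c d = askey_product b a c d"
    by (simp add: askey_product_def qpochs_inf_def Let_def mult_ac)
  moreover have "aw_den a b c d = aw_den b a c d"
    by (simp add: aw_den_def qpochs_inf_def)
  then have "moment 0 a b c d = moment 0 b a c d" by (simp add: moment_def aw_weight_def)
  ultimately show ?thesis by (simp add: askey_const_def mult_ac)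
qed

lemma askey_const_shift: "askey_const (a * fps_X\<^sup>2) b c d = askey_const a b c d"
proof -
  define C where "C = c * fps_X"
  define D where "D = d * fps_X"
  define q where "q = (fps_X\<^sup>2 :: 'a fps)"
  let ?Q = "\<lambda>a. qpoch_inf (a * b * C * D) q"
  have r: "qpoch_inf (a * x) q = (1 - a * x) * qpoch_inf (a * q * x) q" if "fps_nth x 0 = 0" for x
    using qpoch_inf_rec[of q "a * x"] that by (simp add: q_def power2_eq_square mult_ac)
  have P: "askey_product a b c d = (1 - a * b * q) * (1 - a * C) * (1 - a * D) * askey_product (a * q) b c d"
    using r[of "b * q"] r[of C] r[of D]
    by (simp add: askey_product_def Let_def qpochs_inf_def C_def D_def q_def power2_eq_square flip: mult.assoc)
  have Q: "?Q a = (1 - a * b * C * D) * ?Q (a * q)"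
    using r[of "b * C * D"] by (simp add: C_def mult_ac)
  have inv: "?Q a * fps_inv1 (?Q a) = 1" "?Q (a * q) * fps_inv1 (?Q (a * q)) = 1"
    unfolding C_def D_def q_def by (rule askey_denominator_inv)+
  have "fps_inv1 (?Q (a * q)) = fps_inv1 (?Q (a * q)) * (?Q a * fps_inv1 (?Q a))" by (simp add: inv)
  also have "\<dots> = (1 - a * b * C * D) * fps_inv1 (?Q a) * (?Q (a * q) * fps_inv1 (?Q (a * q)))"
    unfolding Q by (simp only: mult_ac)
  finally have I: "fps_inv1 (?Q (a * q)) = (1 - a * b * C * D) * fps_inv1 (?Q a)" by (simp add: inv)
  have "askey_const (a * q) b c d = ((1 - a * b * C * D) * moment 0 (a * q) b c d) * askey_product (a * q) b c d * fps_inv1 (?Q a)"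
    unfolding askey_const_def C_def[symmetric] D_def[symmetric] q_def[symmetric] I by (simp only: mult_ac)
  also have "(1 - a * b * C * D) * moment 0 (a * q) b c d = (1 - a * b * q) * (1 - a * C) * (1 - a * D) * moment 0 a b c d"
    unfolding C_def D_def q_def by (rule moment_0_shift)
  also have "(1 - a * b * q) * (1 - a * C) * (1 - a * D) * moment 0 a b c d * askey_product (a * q) b c d * fps_inv1 (?Q a) = askey_const a b c d"
    unfolding askey_const_def C_def[symmetric] D_def[symmetric] q_def[symmetric] P by (simp only: mult_ac)
  finally show ?thesis by (simp only: q_def)
qed

lemma agree_askey_const:
  assumes "agree N a a'" shows "agree N (askey_const a b c d) (askey_const a' b c d)"
proof -
  have dz: "agree N (diag a) (diag a')" by (rule agree_diag[OF assms])
  have "agree N (aw_den a b c d) (aw_den a' b c d)"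
    unfolding aw_den_def qpochs_inf_def list.map prod_list.Cons prod_list.Nil
    by (intro agree_mult agree_refl agree_qpoch_inf dz) (auto simp: one_minus_nth_0 power2_eq_square)
  then have "agree N (aw_weight a b c d) (aw_weight a' b c d)"
    unfolding aw_weight_def by (intro agree_mult agree_refl agree_inverse[OF aw_den_inv aw_den_inv])
  then have 1: "agree N (moment 0 a b c d) (moment 0 a' b c d)" unfolding moment_def by (rule agree_zcoeff)
  have 2: "agree N (askey_product a b c d) (askey_product a' b c d)"
    unfolding askey_product_def Let_def qpochs_inf_def list.map prod_list.Cons prod_list.Nil
    by (intro agree_mult agree_refl agree_qpoch_inf assms) (auto simp: power2_eq_square)
  have "agree N (qpoch_inf (a * b * (c * fps_X) * (d * fps_X)) (fps_X\<^sup>2)) (qpoch_inf (a' * b * (c * fps_X) * (d * fps_X)) (fps_X\<^sup>2))"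
    by (intro agree_mult agree_refl agree_qpoch_inf assms) (auto simp: power2_eq_square)
  then show ?thesis unfolding askey_const_def
    by (intro agree_mult 1 2 agree_inverse[OF askey_denominator_inv askey_denominator_inv])
qed

text \<open>Invariance under a -> a q can be iterated, and a q^N tends to 0 in the adic
  topology.\<close>

lemma askey_const_0: "askey_const a b c d = askey_const 0 b c d"
proof (rule agree_eqI)
  fix N
  have "askey_const (a * (fps_X\<^sup>2) ^ n) b c d = askey_const a b c d" for n
    by (induction n) (simp_all add: askey_const_shift mult.assoc[symmetric] mult.commute[of "fps_X\<^sup>2"])
  moreover have "agree N (a * (fps_X\<^sup>2) ^ N) 0" by (rule agree_power_0) (simp add: power2_eq_square)
  then have "agree N (askey_const (a * (fps_X\<^sup>2) ^ N) b c d) (askey_const 0 b c d)"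
    by (rule agree_askey_const)
  ultimately show "agree N (askey_const a b c d) (askey_const 0 b c d)" by simp
qed

lemma askey_const_eq: "askey_const a b c d = askey_const a' b' c' d'"
proof -
  have "askey_const a b c d = askey_const 0 0 0 0" for a b c d :: "'a fps"
    by (metis askey_const_0 askey_const_swap askey_const_commute)
  then show ?thesis by metis
qed

text \<open>Opposite parameters combine: (z, -z; q) = (z^2; q^2) and (s z, -s z; q) = (q z^2; q^2),
  whose product is (z^2; q). The same holds for w, so the denominator equals the numerator.\<close>

lemma aw_weight_special: "aw_weight 1 (- 1) 1 (- 1) = 1"
proof (rule aw_weight_unique[symmetric])
  let ?q = "(zz * ww :: 'a fps fps)\<^sup>2"
  define h where "h x = qpoch_inf x ?q * qpoch_inf (- x) ?q" for x
  have q0: "fps_nth ?q 0 = 0" by (simp add: power2_eq_square)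
  have h: "h x = qpoch_inf (x\<^sup>2) (?q\<^sup>2)" if "fps_nth (fps_nth x 0) 0 = 0" for x
    unfolding h_def
    by (rule qpoch_inf_neg[symmetric, OF q0])
      (use that one_minus_nth_0[of x] one_minus_nth_0[of "- x"] one_minus_nth_0[of "x\<^sup>2"] in \<open>simp_all add: power2_eq_square\<close>)
  have e: "qpoch_inf x ?q = qpoch_inf x (?q\<^sup>2) * qpoch_inf (x * ?q) (?q\<^sup>2)" if "fps_nth (fps_nth x 0) 0 = 0" for x
    by (rule qpoch_inf_even_odd[OF q0 one_minus_nth_0[OF that]])
  have n0: "fps_nth (fps_nth (zz\<^sup>2) 0) 0 = (0::'a)" "fps_nth (fps_nth (ww\<^sup>2) 0) 0 = (0::'a)"
    by (simp_all add: power2_eq_square)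
  have "aw_den 1 (- 1) 1 (- 1) = h zz * h (zz * ww * zz) * h (zz * ww * ww) * h ww"
    by (simp add: aw_den_def qpochs_inf_def h_def diag_uminus)
  also have "\<dots> = qpoch_inf (zz\<^sup>2) ?q * qpoch_inf (ww\<^sup>2) ?q"
  proof -
    have "h zz = qpoch_inf (zz\<^sup>2) (?q\<^sup>2)" "h ww = qpoch_inf (ww\<^sup>2) (?q\<^sup>2)"
      "h (zz * ww * zz) = qpoch_inf ((zz * ww * zz)\<^sup>2) (?q\<^sup>2)" "h (zz * ww * ww) = qpoch_inf ((zz * ww * ww)\<^sup>2) (?q\<^sup>2)"
      by (rule h, simp)+
    then show ?thesis unfolding e[OF n0(1)] e[OF n0(2)] by (simp only: power_mult_distrib mult_ac)
  qed
  finally show "1 * aw_den 1 (- 1) 1 (- 1) = (aw_num :: 'a fps fps)"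
    by (simp add: aw_num_def qpochs_inf_def)
qed

lemma askey_const_special: "askey_const 1 (- 1) 1 (- 1) * qpoch_inf (fps_X\<^sup>2) (fps_X\<^sup>2) = (1 :: 'a::comm_ring_1 fps)"
proof -
  define q :: "'a fps" where "q = fps_X\<^sup>2"
  define s :: "'a fps" where "s = fps_X"
  define Qi where "Qi = fps_inv1 (qpoch_inf q q)"
  have q0: "fps_nth q 0 = 0" and s0: "fps_nth s 0 = 0" and sq: "s * s = q" by (simp_all add: q_def s_def power2_eq_square)
  have Qi: "qpoch_inf q q * Qi = 1"
    unfolding Qi_def by (intro fps_inv1, subst qpoch_inf_nth_0) (simp_all add: q0)
  have 1: "qpoch_inf s q * qpoch_inf (- s) q = qpoch_inf q (q\<^sup>2)"
    using qpoch_inf_neg[of q s] by (simp add: q0 s0 sq power2_eq_square)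
  have 2: "qpoch_inf (- q) q * qpoch_inf q q = qpoch_inf (q * q) (q\<^sup>2)"
    using qpoch_inf_neg[of q q] by (simp add: q0 power2_eq_square mult_ac)
  have 3: "qpoch_inf q q = qpoch_inf q (q\<^sup>2) * qpoch_inf (q * q) (q\<^sup>2)"
    by (rule qpoch_inf_even_odd) (simp_all add: q0)
  \<comment> \<open>Euler's identity (-q; q) (q; q^2) = 1, with (q; q^2) = (s, -s; q).\<close>
  have 4: "qpoch_inf (- q) q * qpoch_inf s q * qpoch_inf (- s) q = 1"
  proof -
    have "qpoch_inf (- q) q * qpoch_inf s q * qpoch_inf (- s) q * qpoch_inf q q =
       (qpoch_inf s q * qpoch_inf (- s) q) * (qpoch_inf (- q) q * qpoch_inf q q)" by (simp only: mult_ac)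
    also have "\<dots> = qpoch_inf q q" unfolding 1 2 by (rule 3[symmetric])
    finally have "qpoch_inf (- q) q * qpoch_inf s q * qpoch_inf (- s) q * (qpoch_inf q q * Qi) = qpoch_inf q q * Qi"
      by (simp only: mult.assoc[symmetric])
    then show ?thesis by (simp add: Qi)
  qed
  have "askey_product 1 (- 1) 1 (- 1) = (qpoch_inf (- q) q * qpoch_inf s q * qpoch_inf (- s) q) * (qpoch_inf (- q) q * qpoch_inf s q * qpoch_inf (- s) q)"
    unfolding askey_product_def Let_def qpochs_inf_def q_def[symmetric] by (simp add: sq flip: s_def)
  moreover have "moment 0 1 (- 1) 1 (- 1) = (1 :: 'a fps)"
    by (simp add: moment_def aw_weight_special zcoeff_1)
  ultimately have "askey_const 1 (- 1) 1 (- 1) = Qi"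
    unfolding askey_const_def 4 Qi_def q_def[symmetric] by (simp add: sq flip: s_def)
  then show ?thesis using Qi by (simp add: q_def mult_ac)
qed

theorem askey_constant_term:
  fixes a b c d :: "'a::comm_ring_1 fps"
  defines "C \<equiv> c * fps_X" and "D \<equiv> d * fps_X" and "q \<equiv> fps_X\<^sup>2"
  shows "moment 0 a b c d * qpochs_inf [q, a * b * q, a * C, a * D, b * C, b * D, C * D] q = qpoch_inf (a * b * C * D) q"
proof -
  let ?Q = "qpoch_inf (a * b * C * D) q"
  have inv: "?Q * fps_inv1 ?Q = 1" unfolding C_def D_def q_def by (rule askey_denominator_inv)
  have "askey_const a b c d * qpoch_inf q q = 1"
    using askey_const_special unfolding askey_const_eq[of a b c d 1 "- 1" 1 "- 1"] by (simp add: q_def)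
  then have "moment 0 a b c d * askey_product a b c d * fps_inv1 ?Q * qpoch_inf q q * ?Q = ?Q"
    by (simp add: askey_const_def C_def D_def q_def)
  then have "moment 0 a b c d * (qpoch_inf q q * askey_product a b c d) * (?Q * fps_inv1 ?Q) = ?Q"
    by (simp only: mult_ac)
  then show ?thesis unfolding inv
    by (simp add: askey_product_def Let_def qpochs_inf_def C_def D_def q_def)
qed

section \<open>Additive extension from monomials\<close>

definition pm_lift :: "('i \<Rightarrow> 'a::comm_monoid_add \<Rightarrow> 'b::comm_monoid_add) \<Rightarrow> ('i \<Rightarrow>\<^sub>0 'a) \<Rightarrow> 'b" where
  "pm_lift H f = (\<Sum>n\<in>Poly_Mapping.keys f. H n (Poly_Mapping.lookup f n))"

text \<open>Additivity in the coefficient rather than linearity, because conjugation is only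
  semilinear and formal sums of pairs have integer coefficients.\<close>

locale additive_family =
  fixes H :: "'i \<Rightarrow> 'a::comm_monoid_add \<Rightarrow> 'b::comm_monoid_add"
  assumes zero [simp]: "H n 0 = 0" and add: "H n (x + y) = H n x + H n y"
begin

lemma lift_superset:
  "finite A \<Longrightarrow> Poly_Mapping.keys f \<subseteq> A \<Longrightarrow> pm_lift H f = (\<Sum>n\<in>A. H n (Poly_Mapping.lookup f n))"
  unfolding pm_lift_def by (rule sum.mono_neutral_left) (auto simp: in_keys_iff)

lemma lift_add: "pm_lift H (f + g) = pm_lift H f + pm_lift H g"
proof -
  let ?A = "Poly_Mapping.keys f \<union> Poly_Mapping.keys g"
  have "Poly_Mapping.keys (f + g) \<subseteq> ?A" by (rule keys_add)
  then show ?thesis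
    by (simp add: lift_superset[of ?A] lookup_add add sum.distrib)
qed

lemma lift_single [simp]: "pm_lift H (Poly_Mapping.single n x) = H n x"
  by (cases "x = 0") (auto simp: pm_lift_def)

lemma lift_0 [simp]: "pm_lift H 0 = 0"
  by (simp add: pm_lift_def)

end

text \<open>Zero needs no case of its own, being a monomial with coefficient 0.\<close>

lemma pm_induct [case_names single add]:
  assumes "\<And>k x. P (Poly_Mapping.single k x)" "\<And>f g. P f \<Longrightarrow> P g \<Longrightarrow> P (f + g)"
  shows "P f"
proof (induction "card (Poly_Mapping.keys f)" arbitrary: f rule: less_induct)
  case less
  show ?case
  proof (cases "Poly_Mapping.keys f = {}")
    case True
    then have "f = Poly_Mapping.single undefined 0" by simp
    then show ?thesis using assms(1) by metis
  next
    case False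
    then obtain k where k: "k \<in> Poly_Mapping.keys f" by blast
    define g where "g = Poly_Mapping.update k 0 f"
    have "Poly_Mapping.keys g = Poly_Mapping.keys f - {k}" by (simp add: g_def keys_update)
    then have "P g" using card_Diff1_less[OF finite_keys k] by (intro less) simp
    moreover have "f = g + Poly_Mapping.single k (Poly_Mapping.lookup f k)"
      by (rule poly_mapping_eqI) (auto simp: g_def lookup_add lookup_update lookup_single when_def)
    ultimately show ?thesis using assms by metis
  qed
qed

lemma (in additive_family) lift_linear:
  assumes "\<And>f g. F (f + g) = F f + F g" "\<And>k x. F (Poly_Mapping.single k x) = H k x"
  shows "F = pm_lift H"
proof
  fix f show "F f = pm_lift H f" by (induction f rule: pm_induct) (simp_all add: assms lift_add)
qed

lemma lift_mult:
  fixes H :: "'i::comm_monoid_add \<Rightarrow> 'a::comm_semiring_0 \<Rightarrow> 'b::comm_semiring_0"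
  assumes "additive_family H" "\<And>m n x y. H (m + n) (x * y) = H m x * H n y"
  shows "pm_lift H (f * g) = pm_lift H f * pm_lift H g"
proof -
  interpret additive_family H by fact
  show ?thesis
  proof (induction f rule: pm_induct)
    case (single k x)
    show ?case
      by (induction g rule: pm_induct) (simp_all add: mult_single assms(2) lift_add distrib_left)
  qed (simp add: lift_add distrib_right)
qed

lemma additive_uminus: "F (- f) = - F f" if "\<And>f g. F (f + g) = F f + F g" for F :: "'a::group_add \<Rightarrow> 'b::group_add"
proof -
  have "F 0 + F 0 = F 0 + 0" using that[of 0 0] by simp
  then have "F 0 = 0" by (simp only: add_left_cancel)
  then have "F f + F (- f) = 0" using that[of f "- f"] by simp
  then show ?thesis by (simp add: minus_unique)
qed

lemma additive_diff: "F (f - g) = F f - F g" if "\<And>f g. F (f + g) = F f + F g" for F :: "'a::group_add \<Rightarrow> 'b::group_add"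
  using that[of f "- g"] additive_uminus[of F g] that by simp

section \<open>Laurent polynomials\<close>

abbreviation lcoeff :: "'a::zero laurent \<Rightarrow> int \<Rightarrow> 'a" where "lcoeff \<equiv> Poly_Mapping.lookup"
abbreviation lmono :: "int \<Rightarrow> 'a::zero \<Rightarrow> 'a laurent" where "lmono \<equiv> Poly_Mapping.single"

lemma lcoeff_mono_mult: "lcoeff (lmono j x * f) k = x * lcoeff f (k - j)"
  for f :: "'a::comm_ring_1 laurent"
  by (induction f rule: pm_induct)
    (auto simp: mult_single lookup_single when_def distrib_left lookup_add)

text \<open>The map \<open>\<Sum> f\<^sub>n z\<^sup>n \<mapsto> \<Sum> \<phi> f\<^sub>n (u / z)\<^sup>n\<close>.\<close>

definition lflip :: "('a \<Rightarrow> 'a) \<Rightarrow> 'a \<Rightarrow> 'a::field laurent \<Rightarrow> 'a laurent" where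
  "lflip \<phi> u = pm_lift (\<lambda>n x. lmono (- n) (\<phi> x * u powi n))"

locale field_endo =
  fixes \<phi> :: "'a::field \<Rightarrow> 'a"
  assumes add: "\<phi> (x + y) = \<phi> x + \<phi> y" and mult: "\<phi> (x * y) = \<phi> x * \<phi> y" and one: "\<phi> 1 = 1"
begin

lemma zero [simp]: "\<phi> 0 = 0" using add[of 0 0] by (metis add_0 add_right_cancel)
lemma uminus: "\<phi> (- x) = - \<phi> x" using additive_uminus[of \<phi> x] add by blast
lemma diff: "\<phi> (x - y) = \<phi> x - \<phi> y" using additive_diff[of \<phi> x y] add by blast
lemma inverse: "\<phi> (inverse x) = inverse (\<phi> x)"
proof (cases "x = 0")
  case False
  then have "\<phi> x * \<phi> (inverse x) = 1" by (simp add: one flip: mult)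
  then show ?thesis by (simp add: inverse_unique)
qed simp
lemma divide: "\<phi> (x / y) = \<phi> x / \<phi> y" by (simp add: divide_inverse mult inverse)
lemma power: "\<phi> (x ^ n) = \<phi> x ^ n" by (induction n) (simp_all add: one mult)
lemma powi: "\<phi> (x powi n) = \<phi> x powi n" by (simp add: power_int_def power inverse)
lemma eq_0: "\<phi> x = 0 \<longleftrightarrow> x = 0"
  by (metis inverse mult one right_inverse zero mult_zero_left zero_neq_one)

lemma flip_family: "additive_family (\<lambda>n x. lmono (- n) (\<phi> x * u powi n))"
  by unfold_locales (simp_all add: add distrib_right single_add)

lemma lflip_add: "lflip \<phi> u (f + g) = lflip \<phi> u f + lflip \<phi> u g"
  unfolding lflip_def by (rule additive_family.lift_add[OF flip_family])

lemma lflip_mono [simp]: "lflip \<phi> u (lmono n x) = lmono (- n) (\<phi> x * u powi n)"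
  unfolding lflip_def by (rule additive_family.lift_single[OF flip_family])

lemma lflip_mult: "u \<noteq> 0 \<Longrightarrow> lflip \<phi> u (f * g) = lflip \<phi> u f * lflip \<phi> u g"
  unfolding lflip_def
  by (intro lift_mult flip_family) (simp add: mult_single mult power_int_add mult_ac)

lemma lflip_diff: "lflip \<phi> u (f - g) = lflip \<phi> u f - lflip \<phi> u g"
  by (rule additive_diff) (rule lflip_add)

lemma lflip_uminus: "lflip \<phi> u (- f) = - lflip \<phi> u f"
  by (rule additive_uminus) (rule lflip_add)

lemma lcoeff_lflip: "u \<noteq> 0 \<Longrightarrow> lcoeff (lflip \<phi> u f) k = \<phi> (lcoeff f (- k)) / u powi k"
  by (induction f rule: pm_induct)
    (auto simp: lflip_add lookup_add add distrib_right lookup_single when_def power_int_minus divide_inverse)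

end

lemma field_endo_id: "field_endo (\<lambda>x. x)" by unfold_locales auto

text \<open>The other use of \<open>lflip\<close> is the conjugation \<open>cj\<close>, with the
  field involution and \<open>u = 1\<close>.\<close>

abbreviation lrefl :: "'a::field \<Rightarrow> 'a laurent \<Rightarrow> 'a laurent" where "lrefl \<equiv> lflip (\<lambda>x. x)"

lemmas lrefl_simps = field_endo.lflip_add[OF field_endo_id] field_endo.lflip_diff[OF field_endo_id]
  field_endo.lflip_uminus[OF field_endo_id] field_endo.lflip_mono[OF field_endo_id]
lemmas lrefl_mult = field_endo.lflip_mult[OF field_endo_id]
lemmas lcoeff_lrefl = field_endo.lcoeff_lflip[OF field_endo_id]

lemma lrefl_lrefl: "u \<noteq> 0 \<Longrightarrow> lrefl u (lrefl u f) = f"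
  by (rule poly_mapping_eqI) (simp add: lcoeff_lrefl power_int_minus)

text \<open>The divided difference \<open>(f (u / z) - f z) / (u / z - z)\<close>, given by its values on monomials.\<close>

definition ddiff_nat :: "'a::field \<Rightarrow> nat \<Rightarrow> 'a laurent" where
  "ddiff_nat u n = (\<Sum>i<n. lmono (int n - 1 - 2 * int i) (u ^ i))"

text \<open>For n = -N < 0 one has (u/z)^n - z^n = -u^n ((u/z)^N - z^N), which reduces to positive
  exponents.\<close>

definition ddiff_mono :: "'a::field \<Rightarrow> int \<Rightarrow> 'a laurent" where
  "ddiff_mono u n = (if 0 \<le> n then ddiff_nat u (nat n) else lmono 0 (- (u powi n)) * ddiff_nat u (nat (- n)))"

definition ddiff :: "'a::field \<Rightarrow> 'a laurent \<Rightarrow> 'a laurent" where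
  "ddiff u = pm_lift (\<lambda>n x. lmono 0 x * ddiff_mono u n)"

lemma ddiff_family: "additive_family (\<lambda>n x. lmono 0 x * ddiff_mono u n)"
  by unfold_locales (simp_all add: single_add distrib_right)

lemma ddiff_add: "ddiff u (f + g) = ddiff u f + ddiff u g"
  unfolding ddiff_def by (rule additive_family.lift_add[OF ddiff_family])

lemma ddiff_single [simp]: "ddiff u (lmono n x) = lmono 0 x * ddiff_mono u n"
  unfolding ddiff_def by (rule additive_family.lift_single[OF ddiff_family])

lemma ddiff_nat_eq: "(lmono (- 1) u - lmono 1 1) * ddiff_nat u n = lmono (- int n) (u ^ n) - lmono (int n) 1"
proof -
  define g where "g i = lmono (int n - 2 * int i) (u ^ i)" for i
  have "(lmono (- 1) u - lmono 1 1) * ddiff_nat u n = (\<Sum>i<n. g (Suc i) - g i)"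
    unfolding ddiff_nat_def sum_distrib_left
    by (rule sum.cong) (simp_all add: g_def left_diff_distrib mult_single algebra_simps)
  also have "\<dots> = g n - g 0" by (rule sum_lessThan_telescope)
  finally show ?thesis by (simp add: g_def)
qed

lemma ddiff_mono_eq:
  assumes "u \<noteq> 0" shows "(lmono (- 1) u - lmono 1 1) * ddiff_mono u n = lmono (- n) (u powi n) - lmono n 1"
proof (cases "0 \<le> n")
  case True
  then show ?thesis by (simp add: ddiff_mono_def ddiff_nat_eq power_int_def)
next
  case False
  have "(lmono (- 1) u - lmono 1 1) * ddiff_mono u n = lmono 0 (- (u powi n)) * ((lmono (- 1) u - lmono 1 1) * ddiff_nat u (nat (- n)))"
    using False by (simp add: ddiff_mono_def mult.left_commute)
  also have "\<dots> = lmono (- n) (u powi n) - lmono n 1"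
    unfolding ddiff_nat_eq using False assms by (simp add: right_diff_distrib mult_single single_uminus power_int_def field_simps)
  finally show ?thesis .
qed

lemma ddiff_eq:
  assumes "u \<noteq> 0" shows "(lmono (- 1) u - lmono 1 1) * ddiff u f = lrefl u f - f"
proof (induction f rule: pm_induct)
  case (single k x)
  have "(lmono (- 1) u - lmono 1 1) * ddiff u (lmono k x) = lmono 0 x * ((lmono (- 1) u - lmono 1 1) * ddiff_mono u k)"
    by (simp add: mult_ac)
  then show ?case by (simp add: ddiff_mono_eq[OF assms] right_diff_distrib mult_single lrefl_simps)
qed (simp add: ddiff_add distrib_left lrefl_simps)

lemma mono_diff_nonzero: "lmono (- 1) u - lmono 1 (1::'a::field) \<noteq> 0"
proof
  assume "lmono (- 1) u - lmono 1 (1::'a) = 0"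
  then have "lcoeff (lmono (- 1) u - lmono 1 (1::'a)) 1 = 0" by simp
  then show False by (simp add: lookup_minus lookup_single)
qed

text \<open>Numerator and denominator of the quotient both change sign under the reflection.\<close>

lemma lrefl_ddiff:
  assumes "u \<noteq> 0" shows "lrefl u (ddiff u f) = ddiff u f"
proof -
  let ?d = "lmono (- 1) u - lmono 1 (1::'a)"
  have d: "lrefl u ?d = - ?d" using assms by (simp add: lrefl_simps)
  have "?d * lrefl u (ddiff u f) = - lrefl u (?d * ddiff u f)"
    by (simp only: lrefl_mult[OF assms] d mult_minus_left minus_minus)
  also have "\<dots> = ?d * ddiff u f"
    by (simp add: ddiff_eq[OF assms] lrefl_simps lrefl_lrefl[OF assms])
  finally show ?thesis using mono_diff_nonzero[of u] by simp
qed

text \<open>The exponents descend from n - 1 to 1 - n in steps of 2. The gap at n - 2 is what later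
  isolates \<gamma> as the coefficient next to the leading one in \<open>T\<close>.\<close>

lemma lcoeff_ddiff_nat:
  assumes "0 < n"
  shows "\<bar>k\<bar> \<ge> int n \<Longrightarrow> lcoeff (ddiff_nat u n) k = 0"
    and "lcoeff (ddiff_nat u n) (int n - 1) = 1"
    and "lcoeff (ddiff_nat u n) (1 - int n) = u ^ (n - 1)"
    and "lcoeff (ddiff_nat u n) (int n - 2) = 0"
proof -
  have c: "lcoeff (ddiff_nat u n) k = (\<Sum>i<n. if int n - 1 - 2 * int i = k then u ^ i else 0)" for k
    by (simp add: ddiff_nat_def lookup_sum lookup_single when_def)
  show "\<bar>k\<bar> \<ge> int n \<Longrightarrow> lcoeff (ddiff_nat u n) k = 0"
    unfolding c by (rule sum.neutral) auto
  have "lcoeff (ddiff_nat u n) (int n - 1) = (\<Sum>i<n. if i = 0 then u ^ i else 0)"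
    unfolding c by (rule sum.cong) auto
  then show "lcoeff (ddiff_nat u n) (int n - 1) = 1" using assms by simp
  have "lcoeff (ddiff_nat u n) (1 - int n) = (\<Sum>i<n. if i = n - 1 then u ^ i else 0)"
    unfolding c using assms by (intro sum.cong) (auto simp: of_nat_diff)
  then show "lcoeff (ddiff_nat u n) (1 - int n) = u ^ (n - 1)" using assms by simp
  show "lcoeff (ddiff_nat u n) (int n - 2) = 0"
    unfolding c by (rule sum.neutral) (auto, presburger)
qed

section \<open>Sesquilinear forms given by moments\<close>

text \<open>Intervals suffice because the initial segments of the monomial ordering are intervals of
  exponents: those below z^-n are 1 - n, ..., n, and those below z^(n+1) are -n, ..., n.\<close>

definition lsupp :: "int \<Rightarrow> int \<Rightarrow> 'a::zero laurent set" where
  "lsupp l h = {f. \<forall>k. lcoeff f k \<noteq> 0 \<longrightarrow> l \<le> k \<and> k \<le> h}"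

lemma lsuppD: "f \<in> lsupp l h \<Longrightarrow> \<not> (l \<le> k \<and> k \<le> h) \<Longrightarrow> lcoeff f k = 0"
  by (auto simp: lsupp_def)

lemma lsuppI: "(\<And>k. \<not> (l \<le> k \<and> k \<le> h) \<Longrightarrow> lcoeff f k = 0) \<Longrightarrow> f \<in> lsupp l h"
  by (auto simp: lsupp_def)

lemma lsupp_mono: "f \<in> lsupp l h \<Longrightarrow> l' \<le> l \<Longrightarrow> h \<le> h' \<Longrightarrow> f \<in> lsupp l' h'"
  by (fastforce simp: lsupp_def)

lemma lsupp_add: "f \<in> lsupp l h \<Longrightarrow> g \<in> lsupp l h \<Longrightarrow> f + g \<in> lsupp l h" for f :: "'a::comm_ring_1 laurent"
  by (rule lsuppI) (frule (1) lsuppD[of f], frule (1) lsuppD[of g], simp add: lookup_add)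

lemma lsupp_diff: "f \<in> lsupp l h \<Longrightarrow> g \<in> lsupp l h \<Longrightarrow> f - g \<in> lsupp l h" for f :: "'a::comm_ring_1 laurent"
  by (rule lsuppI) (frule (1) lsuppD[of f], frule (1) lsuppD[of g], simp add: lookup_minus)

lemma lsupp_mono_mult: "f \<in> lsupp l h \<Longrightarrow> lmono j x * f \<in> lsupp (l + j) (h + j)" for f :: "'a::comm_ring_1 laurent"
  by (rule lsuppI, unfold lcoeff_mono_mult, subst lsuppD[of f l h]) auto

lemma lsupp_scale: "f \<in> lsupp l h \<Longrightarrow> lmono 0 x * f \<in> lsupp l h" for f :: "'a::comm_ring_1 laurent"
  using lsupp_mono_mult[of f l h 0 x] by simp

lemma lsupp_single: "l \<le> k \<Longrightarrow> k \<le> h \<Longrightarrow> lmono k x \<in> lsupp l h"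
  by (auto simp: lsupp_def lookup_single when_def)

lemma lsupp_shrink_top: "f \<in> lsupp l h \<Longrightarrow> lcoeff f h = 0 \<Longrightarrow> f \<in> lsupp l (h - 1)"
proof (rule lsuppI)
  fix k assume "f \<in> lsupp l h" "lcoeff f h = 0" "\<not> (l \<le> k \<and> k \<le> h - 1)"
  then show "lcoeff f k = 0" using lsuppD[of f l h k] by (cases "k = h") auto
qed

lemma lsupp_shrink_bot: "f \<in> lsupp l h \<Longrightarrow> lcoeff f l = 0 \<Longrightarrow> f \<in> lsupp (l + 1) h"
proof (rule lsuppI)
  fix k assume "f \<in> lsupp l h" "lcoeff f l = 0" "\<not> (l + 1 \<le> k \<and> k \<le> h)"
  then show "lcoeff f k = 0" using lsuppD[of f l h k] by (cases "k = l") auto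
qed

lemma lcoeff_scale: "lcoeff (lmono 0 x * f) k = x * lcoeff f k" for f :: "'a::comm_ring_1 laurent"
  by (simp add: lcoeff_mono_mult)

text \<open>\<open>m n\<close> stands for the constant term of z^n times the weight, divided by that
  of the weight. \<open>star_m\<close> is what makes the form Hermitian.\<close>

locale laurent_form = star: field_endo star for star :: "'k::field \<Rightarrow> 'k" +
  fixes m :: "int \<Rightarrow> 'k"
  assumes star_star [simp]: "star (star x) = x"
    and star_m: "star (m k) = m (- k)"
    and two: "(2::'k) \<noteq> 0"
begin

definition L :: "'k laurent \<Rightarrow> 'k" where "L = pm_lift (\<lambda>n x. x * m n)"

definition cj :: "'k laurent \<Rightarrow> 'k laurent" where "cj = lflip star 1"

definition ip :: "'k laurent \<Rightarrow> 'k laurent \<Rightarrow> 'k" where "ip f g = L (f * cj g)"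

lemma L_family: "additive_family (\<lambda>n x. x * m n)"
  by unfold_locales (simp_all add: distrib_right)

lemma L_add: "L (f + g) = L f + L g"
  unfolding L_def by (rule additive_family.lift_add[OF L_family])

lemma L_single [simp]: "L (lmono n x) = x * m n"
  unfolding L_def by (rule additive_family.lift_single[OF L_family])

lemma L_diff: "L (f - g) = L f - L g" by (rule additive_diff) (rule L_add)

lemma L_scale: "L (lmono 0 x * f) = x * L f"
  by (induction f rule: pm_induct) (simp_all add: mult_single L_add distrib_left)

lemma cj_add: "cj (f + g) = cj f + cj g"
  and cj_diff: "cj (f - g) = cj f - cj g"
  and cj_mult: "cj (f * g) = cj f * cj g"
  and cj_single [simp]: "cj (lmono n x) = lmono (- n) (star x)"
  and lcoeff_cj: "lcoeff (cj f) k = star (lcoeff f (- k))"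
  by (simp_all add: cj_def star.lflip_add star.lflip_diff star.lflip_mult star.lcoeff_lflip)

lemma cj_cj [simp]: "cj (cj f) = f"
  by (rule poly_mapping_eqI) (simp add: lcoeff_cj)

lemma star_L: "star (L f) = L (cj f)"
  by (induction f rule: pm_induct) (simp_all add: L_add cj_add star.add star.mult star_m)

lemma ip_commute: "star (ip f g) = ip g f"
  by (simp add: ip_def star_L cj_mult mult.commute)

lemma ip_add_left: "ip (f + g) h = ip f h + ip g h"
  and ip_diff_left: "ip (f - g) h = ip f h - ip g h"
  and ip_add_right: "ip h (f + g) = ip h f + ip h g"
  and ip_diff_right: "ip h (f - g) = ip h f - ip h g"
  by (simp_all add: ip_def L_add L_diff cj_add cj_diff algebra_simps)

lemma ip_scale_left: "ip (lmono 0 x * f) g = x * ip f g"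
  by (simp add: ip_def mult.assoc L_scale)

lemma ip_scale_right: "ip f (lmono 0 x * g) = star x * ip f g"
  by (simp add: ip_def cj_mult mult.left_commute[of f] L_scale)

lemma ip_shift: "ip (lmono j 1 * f) g = ip f (lmono (- j) 1 * g)"
  by (simp add: ip_def cj_mult star.one mult_ac)

lemma ip_shift_shift: "ip (lmono j 1 * f) (lmono j 1 * g) = ip f g"
  by (simp add: ip_shift mult_single flip: mult.assoc)

lemma ip_0_iff: "ip f g = 0 \<longleftrightarrow> ip g f = 0"
  by (metis ip_commute star.zero)

text \<open>\<open>U\<close> and \<open>V\<close> play the role of two factors of Cherednik's operator \<open>U\<^sup>-\<^sup>1 V\<close>, for which
  \<open>E\<close> and \<open>E'\<close> are eigenvectors, modulo \<open>S\<close>, with eigenvalues \<open>\<eta>\<close> and \<open>\<eta>'\<close>.\<close>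

lemma ip_eigenvectors:
  assumes U: "ip UE' UE = ip E' E" and V: "ip VE' VE = ip E' E"
    and UE': "\<And>s. s \<in> S \<Longrightarrow> ip UE' s = 0" and VE: "\<And>s. s \<in> S \<Longrightarrow> ip VE s = 0"
    and E: "VE - lmono 0 \<eta> * UE \<in> S" and E': "VE' - lmono 0 \<eta>' * UE' \<in> S"
    and ne: "\<eta>' * star \<eta> \<noteq> 1"
  shows "ip E' E = 0"
proof -
  \<comment> \<open>Errors in \<open>S\<close> are invisible in these products, so <VE', VE> =
    \<eta>' <UE', VE> = \<eta>' star \<eta> <UE', UE>, and by unitarity both ends equal <E',
    E>.\<close>
  have "ip (VE' - lmono 0 \<eta>' * UE') VE = 0"
    using VE[OF E'] ip_0_iff by blast
  then have "ip VE' VE = \<eta>' * ip UE' VE" by (simp add: ip_diff_left ip_scale_left)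
  moreover have "ip UE' (VE - lmono 0 \<eta> * UE) = 0" by (rule UE'[OF E])
  then have "ip UE' VE = star \<eta> * ip UE' UE" by (simp add: ip_diff_right ip_scale_right)
  ultimately have "(1 - \<eta>' * star \<eta>) * ip E' E = 0" using U V by (simp add: algebra_simps)
  with ne show ?thesis by simp
qed

text \<open>Pythagoras: UE is the sum of the orthogonal vectors E'/\<kappa> and v E, and it has the
  norm of E.\<close>

lemma norm_step:
  assumes U: "ip UE UE = ip E E" and E': "E' = lmono 0 \<kappa> * (UE - lmono 0 v * E)" and orth: "ip E' E = 0" and \<kappa>: "\<kappa> \<noteq> 0"
  shows "ip E' E' = \<kappa> * star \<kappa> * (1 - v * star v) * ip E E"
proof -
  have "\<kappa> * (ip UE E - v * ip E E) = 0"
    using orth unfolding E' by (simp add: ip_scale_left ip_diff_left)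
  then have 1: "ip UE E = v * ip E E" using \<kappa> by simp
  then have 2: "ip E UE = star v * ip E E" by (metis ip_commute star.mult)
  have "ip E' E' = \<kappa> * star \<kappa> * (ip UE UE - star v * ip UE E - v * (ip E UE - star v * ip E E))"
    unfolding E' by (simp only: ip_scale_left ip_scale_right ip_diff_left ip_diff_right) (simp add: algebra_simps)
  also have "\<dots> = \<kappa> * star \<kappa> * (1 - v * star v) * ip E E"
    unfolding U 1 2 by (simp add: algebra_simps)
  finally show ?thesis .
qed

end

section \<open>Demazure--Lusztig operators\<close>

text \<open>The reflection is z -> u/z. It will be used with \<alpha> z + \<gamma> + \<beta>/z equal
  to (1 - a z)(1 - b z)/z for u = 1 and to z (1 - c/z)(1 - d/z) for u = q; \<open>rel\<close> says
  that this factor makes the weight antisymmetric.\<close>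

locale reflection = laurent_form star m for star :: "'k::field \<Rightarrow> 'k" and m +
  fixes u \<alpha> \<gamma> \<beta> :: 'k
  assumes nz [simp]: "u \<noteq> 0" "\<alpha> \<noteq> 0" "\<beta> \<noteq> 0"
    and star_par: "star u = 1 / u" "star \<alpha> = 1 / \<alpha>" "star \<beta> = 1 / \<beta>"
    and lam: "\<alpha> * u \<noteq> \<beta>"
    and rel: "L ((lmono 1 \<alpha> + lmono 0 \<gamma> + lmono (- 1) \<beta>) * (lmono k 1 + lmono (- k) (u powi k))) = 0"
begin

definition kap :: "'k laurent" where "kap = lmono 1 \<alpha> + lmono 0 \<gamma> + lmono (- 1) \<beta>"

definition T :: "'k laurent \<Rightarrow> 'k laurent" where "T f = kap * ddiff u f"

text \<open>\<open>T\<close> vanishes on symmetric polynomials and acts as \<alpha> - \<beta>/u on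
  its image. Subtracting \<alpha> turns these eigenvalues into -\<alpha> and -\<beta>/u, whose
  products with their conjugates are 1.\<close>

definition R :: "'k laurent \<Rightarrow> 'k laurent" where "R f = T f - lmono 0 \<alpha> * f"

lemma T_add: "T (f + g) = T f + T g"
  by (simp add: T_def ddiff_add distrib_left)

lemma L_kap_sym:
  assumes "lrefl u p = p" shows "L (kap * p) = 0"
proof -
  have "L (kap * (f + lrefl u f)) = 0" for f
  proof (induction f rule: pm_induct)
    case (single k x)
    have "kap * (lmono k x + lrefl u (lmono k x)) = lmono 0 x * (kap * (lmono k 1 + lmono (- k) (u powi k)))"
      by (simp add: lrefl_simps mult_single distrib_left mult.left_commute[of _ kap])
    then show ?case by (simp only: L_scale rel[folded kap_def] mult_zero_right)
  next
    case (add f g)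
    have "kap * (f + g + lrefl u (f + g)) = kap * (f + lrefl u f) + kap * (g + lrefl u g)"
      by (simp add: lrefl_simps algebra_simps)
    then show ?case using add by (simp add: L_add)
  qed
  \<comment> \<open>For symmetric \<open>p\<close> the two summands coincide, whence the need to
    divide by 2.\<close>
  from this[of p] have "2 * L (kap * p) = 0"
    by (simp only: assms distrib_left L_add mult_2)
  then show ?thesis using two by simp
qed

text \<open>Inverting z turns the reflection z -> u/z into z -> 1/(u z), and conjugating
  \<open>u\<close> turns it back.\<close>

lemma cj_sym: assumes "lrefl u p = p" shows "lrefl u (cj p) = cj p"
proof (rule poly_mapping_eqI)
  fix k
  have "lcoeff p k = lcoeff p (- k) / u powi k" using assms lcoeff_lrefl[of u p k] by simp
  then have "star (lcoeff p k) = star (lcoeff p (- k)) * u powi k"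
    by (simp add: star.divide star.powi star_par power_int_one_over)
  then show "lcoeff (lrefl u (cj p)) k = lcoeff (cj p) k"
    by (simp add: lcoeff_lrefl lcoeff_cj)
qed

lemma ip_kap_sym:
  assumes "lrefl u p = p" "lrefl u r = r" shows "ip (kap * p) r = 0" and "ip r (kap * p) = 0"
proof -
  have "lrefl u (p * cj r) = p * cj r" by (simp add: lrefl_mult assms cj_sym)
  from L_kap_sym[OF this] show "ip (kap * p) r = 0" by (simp add: ip_def mult.assoc)
  then show "ip r (kap * p) = 0" by (simp add: ip_0_iff)
qed

text \<open>The reflection changes \<open>kap\<close> by (\<alpha> - \<beta>/u)(u/z - z), and the
  second factor cancels the denominator of the divided difference.\<close>

lemma T_complement_sym: "lrefl u (lmono 0 (\<alpha> - \<beta> / u) * f - T f) = lmono 0 (\<alpha> - \<beta> / u) * f - T f"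
proof -
  let ?d = "lmono (- 1) u - lmono 1 (1::'k)"
  have k: "lrefl u kap = kap + lmono 0 (\<alpha> - \<beta> / u) * ?d"
    by (rule poly_mapping_eqI)
      (auto simp: kap_def lrefl_simps lookup_add lookup_minus lcoeff_mono_mult lookup_single when_def right_diff_distrib mult_single field_simps)
  have "lrefl u (T f) = T f + lmono 0 (\<alpha> - \<beta> / u) * (?d * ddiff u f)"
    by (simp add: T_def lrefl_mult lrefl_ddiff k distrib_right mult.assoc)
  also have "?d * ddiff u f = lrefl u f - f" by (simp add: ddiff_eq)
  finally have "lrefl u (T f) = T f + lmono 0 (\<alpha> - \<beta> / u) * (lrefl u f - f)" .
  then show ?thesis by (simp add: lrefl_simps lrefl_mult algebra_simps)
qed

text \<open>The image of \<open>T\<close> consists of \<open>kap\<close> times symmetric polynomials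
  and is thus orthogonal to symmetric ones, in particular to the complement in
  \<open>T_complement_sym\<close>.\<close>

lemma ip_T_T: "ip (T f) (T g) = star (\<alpha> - \<beta> / u) * ip (T f) g" "ip (T f) (T g) = (\<alpha> - \<beta> / u) * ip f (T g)"
proof -
  have d: "lrefl u (ddiff u f) = ddiff u f" for f by (simp add: lrefl_ddiff)
  have "ip (T f) (lmono 0 (\<alpha> - \<beta> / u) * g - T g) = 0"
    unfolding T_def[of f] by (rule ip_kap_sym(1)[OF d T_complement_sym])
  then show "ip (T f) (T g) = star (\<alpha> - \<beta> / u) * ip (T f) g"
    by (simp add: ip_diff_right ip_scale_right)
  have "ip (lmono 0 (\<alpha> - \<beta> / u) * f - T f) (T g) = 0"
    unfolding T_def[of g] by (rule ip_kap_sym(2)[OF d T_complement_sym])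
  then show "ip (T f) (T g) = (\<alpha> - \<beta> / u) * ip f (T g)"
    by (simp add: ip_diff_left ip_scale_left)
qed

text \<open>Compare the two expressions in \<open>ip_T_T\<close>: the conjugate of \<alpha> -
  \<beta>/u is -u/(\<alpha> \<beta>) times itself, and \<open>lam\<close> allows cancelling
  it.\<close>

lemma ip_T_left: "ip (T f) g = - (\<alpha> * \<beta> / u) * ip f (T g)"
proof -
  let ?l = "\<alpha> - \<beta> / u"
  have l: "?l \<noteq> 0" using lam by (simp add: field_simps)
  have "star ?l = - (u / (\<alpha> * \<beta>)) * ?l"
    unfolding star.diff star.divide star_par by (simp add: field_simps)
  then have "- (u / (\<alpha> * \<beta>)) * ?l * ip (T f) g = ?l * ip f (T g)"
    using ip_T_T[of f g] by simp
  then have "?l * (- (u / (\<alpha> * \<beta>)) * ip (T f) g - ip f (T g)) = 0"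
    by (simp add: algebra_simps)
  then have eq: "- (u / (\<alpha> * \<beta>)) * ip (T f) g = ip f (T g)" using l by simp
  have "ip (T f) g = - (\<alpha> * \<beta> / u) * (- (u / (\<alpha> * \<beta>)) * ip (T f) g)" by simp
  then show ?thesis unfolding eq .
qed

lemma R_unitary: "ip (R f) (R g) = ip f g"
proof -
  have "ip (R f) (R g) = ip (T f) (T g) - star \<alpha> * ip (T f) g - \<alpha> * (ip f (T g) - star \<alpha> * ip f g)"
    by (simp only: R_def ip_diff_left ip_diff_right ip_scale_left ip_scale_right) (simp add: algebra_simps)
  also have "\<dots> = (\<alpha> - \<beta> / u) * ip f (T g) + \<beta> / u * ip f (T g) - \<alpha> * ip f (T g) + ip f g"
    unfolding ip_T_T(2) ip_T_left[of f g] star_par by (simp add: right_diff_distrib)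
  also have "\<dots> = ip f g" by (simp add: algebra_simps)
  finally show ?thesis .
qed

section \<open>Action of the operators on the extreme monomials of an interval\<close>

definition tc :: "int \<Rightarrow> int \<Rightarrow> 'k" where "tc n k = lcoeff (kap * ddiff_mono u n) k"

lemma tc_eq: "tc n k = \<alpha> * lcoeff (ddiff_mono u n) (k - 1) + \<gamma> * lcoeff (ddiff_mono u n) k + \<beta> * lcoeff (ddiff_mono u n) (k + 1)"
  by (simp add: tc_def kap_def distrib_right lookup_add lcoeff_mono_mult)

lemma lcoeff_ddiff_mono:
  "lcoeff (ddiff_mono u n) k = (if 0 \<le> n then lcoeff (ddiff_nat u (nat n)) k else - (u powi n) * lcoeff (ddiff_nat u (nat (- n))) k)"
  by (simp add: ddiff_mono_def lcoeff_scale)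

lemma ddiff_nat_0 [simp]: "ddiff_nat u 0 = 0"
  by (simp add: ddiff_nat_def)

lemma tc_0 [simp]: "tc 0 k = 0" by (simp add: tc_eq lcoeff_ddiff_mono)

lemma tc_outside: "\<bar>k\<bar> > \<bar>n\<bar> \<Longrightarrow> tc n k = 0"
  by (cases n "0 :: int" rule: linorder_cases) (auto simp: tc_eq lcoeff_ddiff_mono lcoeff_ddiff_nat(1))

lemma tc_pos:
  assumes "0 < N"
  shows "tc (int N) (int N) = \<alpha>" "tc (int N) (- int N) = \<beta> * u ^ (N - 1)" "tc (int N) (int N - 1) = \<gamma>"
proof -
  let ?g = "lcoeff (ddiff_nat u N)"
  have z: "\<bar>k\<bar> \<ge> int N \<Longrightarrow> ?g k = 0" for k by (rule lcoeff_ddiff_nat(1)[OF assms])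
  have e: "- int N + 1 = 1 - int N" "int N - 1 - 1 = int N - 2" "int N - 1 + 1 = int N" by simp_all
  have tc: "tc (int N) k = \<alpha> * ?g (k - 1) + \<gamma> * ?g k + \<beta> * ?g (k + 1)" for k
    by (simp add: tc_eq lcoeff_ddiff_mono)
  show "tc (int N) (int N) = \<alpha>" "tc (int N) (- int N) = \<beta> * u ^ (N - 1)" "tc (int N) (int N - 1) = \<gamma>"
    unfolding tc e lcoeff_ddiff_nat[OF assms] by (simp_all add: z)
qed

lemma tc_neg:
  assumes "0 < N"
  shows "tc (- int N) (int N) = - \<alpha> / u ^ N" "tc (- int N) (- int N) = - \<beta> / u"
proof -
  have *: "tc (- int N) k = - (1 / u ^ N) * tc (int N) k" for k
    using assms by (simp add: tc_eq lcoeff_ddiff_mono power_int_minus divide_inverse algebra_simps)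
  show "tc (- int N) (int N) = - \<alpha> / u ^ N" unfolding * by (simp add: tc_pos assms)
  show "tc (- int N) (- int N) = - \<beta> / u"
    unfolding * tc_pos[OF assms] using assms by (cases N) simp_all
qed

lemma lcoeff_T: "lcoeff (T f) k = (\<Sum>n\<in>Poly_Mapping.keys f. lcoeff f n * tc n k)"
proof -
  have "lcoeff (kap * (lmono 0 x * ddiff_mono u n)) k = x * tc n k" for x n
    unfolding mult.left_commute[of kap] lcoeff_scale tc_def ..
  then show ?thesis
    by (simp add: T_def ddiff_def pm_lift_def sum_distrib_left lookup_sum)
qed

lemma lcoeff_T_supp:
  assumes "f \<in> lsupp l h" shows "lcoeff (T f) k = (\<Sum>n\<in>{l..h}. lcoeff f n * tc n k)"
  unfolding lcoeff_T using assms
  by (intro sum.mono_neutral_left) (auto simp: lsupp_def in_keys_iff)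

lemma T_supp:
  assumes "f \<in> lsupp (- N) N" shows "T f \<in> lsupp (- N) N"
proof -
  have "lcoeff (T f) k = 0" if "\<bar>k\<bar> > N" for k
    unfolding lcoeff_T_supp[OF assms]
  proof (rule sum.neutral, rule ballI)
    fix n assume "n \<in> {- N..N}"
    then have "\<bar>n\<bar> < \<bar>k\<bar>" using that by auto
    then show "lcoeff f n * tc n k = 0" by (simp add: tc_outside)
  qed
  then show ?thesis by (intro lsuppI) auto
qed

lemma R_supp: "f \<in> lsupp (- N) N \<Longrightarrow> R f \<in> lsupp (- N) N"
  unfolding R_def by (intro lsupp_diff T_supp lsupp_scale)

lemma T_ends:
  assumes f: "f \<in> lsupp (- int N) (int N)" and N: "0 < N"
  shows "lcoeff (T f) (int N) = \<alpha> * lcoeff f (int N) - \<alpha> / u ^ N * lcoeff f (- int N)"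
    and "lcoeff (T f) (- int N) = \<beta> * u ^ (N - 1) * lcoeff f (int N) - \<beta> / u * lcoeff f (- int N)"
proof -
  have "(\<Sum>n\<in>{- int N..int N}. lcoeff f n * tc n k) = (\<Sum>n\<in>{- int N, int N}. lcoeff f n * tc n k)" if "\<bar>k\<bar> = int N" for k
    by (rule sum.mono_neutral_right) (use that in \<open>auto intro!: tc_outside\<close>)
  then have *: "lcoeff (T f) k = lcoeff f (- int N) * tc (- int N) k + lcoeff f (int N) * tc (int N) k" if "\<bar>k\<bar> = int N" for k
    unfolding lcoeff_T_supp[OF f] using that N by simp
  show "lcoeff (T f) (int N) = \<alpha> * lcoeff f (int N) - \<alpha> / u ^ N * lcoeff f (- int N)"
    and "lcoeff (T f) (- int N) = \<beta> * u ^ (N - 1) * lcoeff f (int N) - \<beta> / u * lcoeff f (- int N)"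
    by (simp_all add: * tc_pos tc_neg N algebra_simps)
qed

text \<open>Subtracting \<alpha> cancels the contribution of z^N to itself, so \<open>R\<close>
  sends a polynomial without z^-N to one without z^N.\<close>

lemma R_ends:
  assumes f: "f \<in> lsupp (- int N) (int N)" and N: "0 < N"
  shows "lcoeff (R f) (int N) = - (\<alpha> / u ^ N) * lcoeff f (- int N)"
    and "lcoeff (R f) (- int N) = \<beta> * u ^ (N - 1) * lcoeff f (int N) - (\<alpha> + \<beta> / u) * lcoeff f (- int N)"
  by (simp_all only: R_def lookup_minus lcoeff_scale T_ends[OF assms]) (simp_all add: algebra_simps)

text \<open>\<open>R\<close> moves the interval from -n to n + 1 into the one from -n - 1 to n, and
  multiplication by z shifts it back.\<close>

lemma zR_ends:
  assumes f: "f \<in> lsupp (- int n) (int n + 1)"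
  shows "lmono 1 1 * R f \<in> lsupp (- int n) (int n + 1)"
    and "lcoeff (lmono 1 1 * R f) (int n + 1) = \<gamma> * lcoeff f (int n + 1) - \<alpha> / u ^ n * lcoeff f (- int n)"
    and "lcoeff (lmono 1 1 * R f) (- int n) = \<beta> * u ^ n * lcoeff f (int n + 1)"
proof -
  have f1: "f \<in> lsupp (- int (Suc n)) (int (Suc n))" using f by (rule lsupp_mono) auto
  have fz: "lcoeff f (- int (Suc n)) = 0" by (rule lsuppD[OF f]) auto
  have "R f \<in> lsupp (- int (Suc n)) (int (Suc n) - 1)"
    by (rule lsupp_shrink_top[OF R_supp[OF f1]]) (simp only: R_ends[OF f1] fz, simp)
  from lsupp_mono_mult[OF this, of 1 1] show "lmono 1 1 * R f \<in> lsupp (- int n) (int n + 1)"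
    by (simp add: algebra_simps)
  have "lcoeff (R f) (- int (Suc n)) = \<beta> * u ^ n * lcoeff f (int (Suc n))"
    by (simp only: R_ends[OF f1] fz) simp
  moreover have e: "- int n - 1 = - int (Suc n)" by simp
  ultimately show "lcoeff (lmono 1 1 * R f) (- int n) = \<beta> * u ^ n * lcoeff f (int n + 1)"
    by (simp only: lcoeff_mono_mult e mult_1_left) (simp add: add.commute)
  \<comment> \<open>The coefficient of z^n in \<open>R f\<close> lies one below the top of
    \<open>f\<close>. The monomial z^(n+1) contributes \<gamma> to it; the remainder
    \<open>g\<close> is supported from -n to n, so the end coefficients apply.\<close>
  define t where "t = lcoeff f (int n + 1)"
  define g where "g = f - lmono (int n + 1) t"
  have g: "g \<in> lsupp (- int n) (int n)"
    using f by (auto simp: g_def lsupp_def lookup_minus lookup_single when_def t_def split: if_splits)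
  have c: "lcoeff g (int n) = lcoeff f (int n)" "lcoeff g (- int n) = lcoeff f (- int n)"
    by (simp_all add: g_def lookup_minus lookup_single)
  have "T f = T (lmono (int n + 1) t) + T g" by (simp add: g_def flip: T_add)
  moreover have "lcoeff (T (lmono (int n + 1) t)) (int n) = t * \<gamma>"
    using tc_pos(3)[of "Suc n"] by (cases "t = 0") (simp_all add: lcoeff_T add.commute)
  moreover have "lcoeff (T g) (int n) - \<alpha> * lcoeff g (int n) = - \<alpha> / u ^ n * lcoeff g (- int n)"
  proof (cases n)
    case 0
    then show ?thesis using lcoeff_T_supp[OF g, of 0] by simp
  next
    case (Suc k)
    then show ?thesis using T_ends(1)[OF g] by simp
  qed
  ultimately show "lcoeff (lmono 1 1 * R f) (int n + 1) = \<gamma> * lcoeff f (int n + 1) - \<alpha> / u ^ n * lcoeff f (- int n)"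
    by (simp only: lcoeff_mono_mult R_def lookup_minus lcoeff_scale) (simp add: lookup_add c t_def algebra_simps)
qed

lemma R_orth:
  assumes f: "\<And>s. s \<in> lsupp (- N) N \<Longrightarrow> ip f s = 0" and s: "s \<in> lsupp (- N) N"
  shows "ip (R f) s = 0"
  using f[OF s] f[OF T_supp[OF s]] by (simp add: R_def ip_diff_left ip_scale_left ip_T_left)

lemma zR_orth:
  assumes f: "\<And>s. s \<in> lsupp (1 - int n) (int n) \<Longrightarrow> ip f s = 0" and s: "s \<in> lsupp (1 - int n) (int n)"
  shows "ip (lmono 1 1 * R f) s = 0"
proof (cases "n = 0")
  case True
  then have "s = 0" using s by (intro poly_mapping_eqI) (auto simp: lsupp_def)
  then show ?thesis by (simp add: ip_def cj_def star.lflip_add lflip_def pm_lift_def L_def)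
next
  case False
  define t where "t = lmono (- 1) 1 * s"
  have t: "t \<in> lsupp (- int n) (int n - 1)"
    using lsupp_mono_mult[OF s, of "- 1" 1] by (simp add: t_def)
  then have t': "t \<in> lsupp (- int n) (int n)" by (rule lsupp_mono) auto
  \<comment> \<open>\<open>T\<close> multiplies the coefficient of z^-n by -\<beta>/u here, so
    adding \<beta>/u times \<open>t\<close> clears the bottom and leaves a vector orthogonal to
    \<open>f\<close>.\<close>
  have "T t + lmono 0 (\<beta> / u) * t \<in> lsupp (- int n + 1) (int n)"
    using False lsuppD[OF t, of "int n"]
    by (intro lsupp_shrink_bot lsupp_add T_supp lsupp_scale t')
      (simp add: lookup_add lcoeff_scale T_ends[OF t'])
  then have "ip f (T t + lmono 0 (\<beta> / u) * t) = 0" by (intro f) simp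
  then have "ip f (T t) = - (u / \<beta>) * ip f t"
    by (simp add: ip_add_right ip_scale_right star.divide star_par add_eq_0_iff)
  moreover have "ip (lmono 1 1 * R f) s = ip (R f) t" by (simp add: ip_shift t_def)
  ultimately show ?thesis by (simp add: R_def ip_diff_left ip_scale_left ip_T_left)
qed

end

section \<open>Non-symmetric Askey--Wilson polynomials\<close>

text \<open>Since \<open>m n\<close> corresponds to the coefficient of z^-n in the weight, the
  coefficients in \<open>rel_1\<close> and \<open>rel_0\<close> appear in the reverse order to those
  of \<open>moment_refl\<close> and \<open>moment_swap_refl\<close>.\<close>

locale askey_wilson = laurent_form star m for star :: "'k::field \<Rightarrow> 'k" and m +
  fixes a b c d q :: 'k
  assumes nz [simp]: "a \<noteq> 0" "b \<noteq> 0" "c \<noteq> 0" "d \<noteq> 0" "q \<noteq> 0"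
    and star_par: "star a = 1 / a" "star b = 1 / b" "star c = 1 / c" "star d = 1 / d" "star q = 1 / q"
    and ab: "a * b \<noteq> 1" and cd: "c * d \<noteq> q" and abcd: "a * b * c * d * q ^ n \<noteq> 1"
    and m_0: "m 0 = 1"
    and rel_1: "a * b * m (k + 1) - (a + b) * m k + m (k - 1) + (a * b * m (- k + 1) - (a + b) * m (- k) + m (- k - 1)) = 0"
    and rel_0: "m (k + 1) - (c + d) * m k + c * d * m (k - 1) + q powi k * (m (- k + 1) - (c + d) * m (- k) + c * d * m (- k - 1)) = 0"
begin

definition gam_A :: 'k where "gam_A = - (a + b)"
definition gam_B :: 'k where "gam_B = - (c + d)"

sublocale A: reflection star m 1 "a * b" gam_A 1
proof
  fix k
  have e: "m (- 1 - k) = m (- k - 1)" by (rule arg_cong[of _ _ m]) simp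
  have "L ((lmono 1 (a * b) + lmono 0 gam_A + lmono (- 1) 1) * (lmono k 1 + lmono (- k) (1 powi k))) =
     a * b * m (k + 1) - (a + b) * m k + m (k - 1) + (a * b * m (- k + 1) - (a + b) * m (- k) + m (- k - 1))"
    by (simp add: distrib_left distrib_right mult_single L_add gam_A_def gam_B_def)
      (simp add: algebra_simps e)
  then show "L ((lmono 1 (a * b) + lmono 0 gam_A + lmono (- 1) 1) * (lmono k 1 + lmono (- k) (1 powi k))) = 0"
    by (simp only: rel_1)
qed (use ab in \<open>simp_all add: gam_A_def gam_B_def star_par star.one star.mult star.uminus star.add star.diff field_simps\<close>)

sublocale B: reflection star m q 1 gam_B "c * d"
proof
  fix k
  have e: "m (- 1 - k) = m (- k - 1)" by (rule arg_cong[of _ _ m]) simp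
  have "L ((lmono 1 1 + lmono 0 gam_B + lmono (- 1) (c * d)) * (lmono k 1 + lmono (- k) (q powi k))) =
     m (k + 1) - (c + d) * m k + c * d * m (k - 1) + q powi k * (m (- k + 1) - (c + d) * m (- k) + c * d * m (- k - 1))"
    by (simp add: distrib_left distrib_right mult_single L_add gam_A_def gam_B_def)
      (simp add: algebra_simps e)
  then show "L ((lmono 1 1 + lmono 0 gam_B + lmono (- 1) (c * d)) * (lmono k 1 + lmono (- k) (q powi k))) = 0"
    by (simp only: rel_0)
qed (use cd in \<open>simp_all add: gam_A_def gam_B_def star_par star.one star.mult star.uminus star.add star.diff field_simps\<close>)

text \<open>\<open>is_neg n\<close> describes E_(-n) and \<open>is_pos n\<close> describes E_(n+1),
  with orthogonality to the whole span of the smaller monomials.\<close>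

definition is_neg :: "nat \<Rightarrow> 'k laurent \<Rightarrow> bool" where
  "is_neg n E \<longleftrightarrow> E \<in> lsupp (- int n) (int n) \<and> lcoeff E (- int n) = 1 \<and> (\<forall>s\<in>lsupp (1 - int n) (int n). ip E s = 0)"

definition is_pos :: "nat \<Rightarrow> 'k laurent \<Rightarrow> bool" where
  "is_pos n E \<longleftrightarrow> E \<in> lsupp (- int n) (int n + 1) \<and> lcoeff E (int n + 1) = 1 \<and> (\<forall>s\<in>lsupp (- int n) (int n). ip E s = 0)"

text \<open>The ratio of the norms of E_(n+1) and E_(-n); \<open>neg_factor\<close> is that of
  E_(-n-1) and E_(n+1).\<close>

definition pos_factor :: "nat \<Rightarrow> 'k" where
  "pos_factor n = (1 - a * c * q ^ n) * (1 - a * d * q ^ n) * (1 - b * c * q ^ n) * (1 - b * d * q ^ n) / (1 - a * b * c * d * q ^ (2 * n))\<^sup>2"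

definition neg_factor :: "nat \<Rightarrow> 'k" where
  "neg_factor n = (1 - q ^ Suc n) * (1 - c * d * q ^ n) * (1 - a * b * q ^ Suc n) * (1 - a * b * c * d * q ^ n) / (1 - a * b * c * d * q ^ (2 * n + 1))\<^sup>2"

lemma is_neg_0: "is_neg 0 1" "ip 1 1 = 1"
proof -
  have "s = 0" if "s \<in> lsupp 1 0" for s :: "'k laurent"
    using that by (intro poly_mapping_eqI) (auto simp: lsupp_def)
  moreover have "ip 1 0 = 0" using ip_scale_right[of 1 0 1] by simp
  ultimately show "is_neg 0 1" using lsupp_single[of 0 0 0 "1::'k"]
    by (auto simp: is_neg_def lookup_single lookup_one)
  have "cj 1 = 1" using cj_single[of 0 1] by (simp add: star.one)
  then have "ip 1 1 = L (lmono 0 1)" by (simp add: ip_def)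
  then show "ip 1 1 = 1" by (simp only: L_single m_0 mult_1)
qed

lemma pos_step:
  assumes E: "is_neg n E"
  obtains E' where "is_pos n E'" "ip E' E' = pos_factor n * ip E E"
proof -
  define z where "z = lmono 1 (1::'k)"
  define D where "D = 1 - a * b * c * d * q ^ (2 * n)"
  \<comment> \<open>\<rho> will be the coefficient of z^-n in E'. Comparing z^-n in z R_B E' and z
    R_A E' forces the eigenvalue c d q^n, and z^(n+1) then gives a linear equation for
    \<rho>.\<close>
  define \<rho> where "\<rho> = - (q ^ n * ((c + d) - c * d * q ^ n * (a + b))) / D"
  define E' where "E' = lmono 0 (- 1 / (a * b)) * (z * A.R E - lmono 0 (a * b * \<rho>) * E)"
  let ?S = "lsupp (1 - int n) (int n)"
  have D: "D \<noteq> 0" using abcd[of "2 * n"] by (simp add: D_def)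
  have Es: "E \<in> lsupp (- int n) (int n)" and E1: "lcoeff E (- int n) = 1" and Eo: "\<And>s. s \<in> ?S \<Longrightarrow> ip E s = 0"
    using E by (auto simp: is_neg_def)
  have Es': "E \<in> lsupp (- int n) (int n + 1)" using Es by (rule lsupp_mono) auto
  have E0: "lcoeff E (int n + 1) = 0" by (rule lsuppD[OF Es]) auto
  note UE = A.zR_ends[OF Es', folded z_def, unfolded E1 E0] and VE = B.zR_ends[OF Es', folded z_def, unfolded E1 E0]
  have E's: "E' \<in> lsupp (- int n) (int n + 1)" unfolding E'_def by (intro lsupp_scale lsupp_diff UE Es')
  have E'1: "lcoeff E' (int n + 1) = 1" "lcoeff E' (- int n) = \<rho>"
    unfolding E'_def lcoeff_scale lookup_minus UE E1 E0 by simp_all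
  note UE' = A.zR_ends[OF E's, folded z_def, unfolded E'1] and VE' = B.zR_ends[OF E's, folded z_def, unfolded E'1]
  have UEo: "ip (z * A.R E) s = 0" if "s \<in> ?S" for s
    using A.zR_orth[OF Eo that] by (simp add: z_def)
  have VEo: "ip (z * B.R E) s = 0" if "s \<in> ?S" for s
    using B.zR_orth[OF Eo that] by (simp add: z_def)
  have E'o: "ip E' s = 0" if "s \<in> ?S" for s
    unfolding E'_def by (simp add: ip_scale_left ip_diff_left UEo Eo that)
  have UE'o: "ip (z * A.R E') s = 0" if "s \<in> ?S" for s
    using A.zR_orth[OF E'o that] by (simp add: z_def)
  have S: "f \<in> ?S" if "f \<in> lsupp (- int n) (int n + 1)" "lcoeff f (int n + 1) = 0" "lcoeff f (- int n) = 0" for f :: "'k laurent"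
    using lsupp_shrink_bot[OF lsupp_shrink_top[OF that(1,2)] that(3)] by simp
  have orth: "ip E' E = 0"
  proof (rule ip_eigenvectors[where UE = "z * A.R E" and UE' = "z * A.R E'" and VE = "z * B.R E" and VE' = "z * B.R E'" and S = ?S])
    show "ip (z * A.R E') (z * A.R E) = ip E' E" "ip (z * B.R E') (z * B.R E) = ip E' E"
      by (simp_all add: z_def ip_shift_shift A.R_unitary B.R_unitary)
    show "z * B.R E - lmono 0 (1 / (a * b * q ^ n)) * (z * A.R E) \<in> ?S"
      by (intro S lsupp_diff lsupp_scale UE VE) (simp_all add: lookup_minus lcoeff_scale UE VE)
    have "\<rho> * (1 / q ^ n - a * b * c * d * q ^ n) = - ((c + d) - c * d * q ^ n * (a + b))"
    proof -
      have "1 / q ^ n - a * b * c * d * q ^ n = D / q ^ n"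
        by (simp add: D_def field_simps power_mult power2_eq_square flip: power_mult_distrib)
      then show ?thesis using D by (simp add: \<rho>_def)
    qed
    then have "gam_B - 1 / q ^ n * \<rho> = c * d * q ^ n * (gam_A - a * b * \<rho>)"
      by (simp add: gam_A_def gam_B_def algebra_simps)
    then show "z * B.R E' - lmono 0 (c * d * q ^ n) * (z * A.R E') \<in> ?S"
      by (intro S lsupp_diff lsupp_scale UE' VE') (simp_all add: lookup_minus lcoeff_scale UE' VE')
    have eq: "c * d * q ^ n * star (1 / (a * b * q ^ n)) = a * b * c * d * q ^ (2 * n)"
      by (simp add: star.divide star.mult star.power star_par star.one mult_2 power_add power_one_over)
    show "c * d * q ^ n * star (1 / (a * b * q ^ n)) \<noteq> 1" unfolding eq by (rule abcd)
  qed (use UE'o VEo in auto)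
  have "is_pos n E'"
    unfolding is_pos_def
  proof (intro conjI ballI E's E'1)
    fix s :: "'k laurent" assume s: "s \<in> lsupp (- int n) (int n)"
    let ?t = "lcoeff s (- int n)"
    have "s - lmono 0 ?t * E \<in> lsupp (- int n + 1) (int n)"
      by (intro lsupp_shrink_bot lsupp_diff lsupp_scale s Es) (simp add: lookup_minus lcoeff_scale E1)
    then have "ip E' (s - lmono 0 ?t * E) = 0" by (intro E'o) simp
    then show "ip E' s = 0" by (simp add: ip_diff_right ip_scale_right orth)
  qed
  moreover have "ip E' E' = pos_factor n * ip E E"
  proof -
    let ?v = "a * b * \<rho>"
    have "ip E' E' = (- 1 / (a * b)) * star (- 1 / (a * b)) * (1 - ?v * star ?v) * ip E E"
      by (rule norm_step[OF _ E'_def orth]) (simp_all add: z_def ip_shift_shift A.R_unitary)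
    also have "(- 1 / (a * b)) * star (- 1 / (a * b)) = 1"
      by (simp add: star.divide star.uminus star.one star.mult star_par)
    also have "1 * (1 - ?v * star ?v) = pos_factor n"
    proof -
      define Q where "Q = q ^ n"
      have Q: "Q \<noteq> 0" "star Q = 1 / Q" "q ^ (2 * n) = Q * Q"
        by (simp_all add: Q_def star.power star_par power_one_over mult_2 power_add)
      define P where "P = 1 - a * b * c * d * (Q * Q)"
      \<comment> \<open>The conjugate of the bracket in \<rho>, cleared of its denominator a b c d
        Q.\<close>
      define W where "W = a * b * Q * (c + d) - (a + b)"
      have P: "P \<noteq> 0" using D by (simp add: D_def Q P_def)
      have v: "?v = - (a * b * Q * ((c + d) - c * d * Q * (a + b))) / P"
        by (simp add: \<rho>_def D_def P_def Q flip: Q_def)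
      have W: "star ((c + d) - c * d * Q * (a + b)) = W / (a * b * c * d * Q)"
        using Q(1) by (simp add: star.diff star.add star.mult star_par Q W_def field_simps)
      have sP: "star P = - P / (a * b * c * d * (Q * Q))"
        using Q(1) by (simp add: P_def star.diff star.one star.mult star_par Q field_simps)
      have sv: "star ?v = W / (a * b * P)"
        unfolding v star.divide star.uminus star.mult W sP star_par Q using P Q(1) by simp
      have "1 - ?v * star ?v = (P\<^sup>2 + Q * ((c + d) - c * d * Q * (a + b)) * W) / P\<^sup>2"
        unfolding sv unfolding v using P Q(1) by (simp add: field_simps power2_eq_square)
      also have "P\<^sup>2 + Q * ((c + d) - c * d * Q * (a + b)) * W = (1 - a * c * Q) * (1 - a * d * Q) * (1 - b * c * Q) * (1 - b * d * Q)"
        by (simp add: P_def W_def algebra_simps power2_eq_square)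
      finally show ?thesis by (simp add: pos_factor_def P_def Q flip: Q_def)
    qed
    finally show ?thesis by simp
  qed
  ultimately show ?thesis by (rule that)
qed

lemma neg_step:
  assumes E: "is_pos n E"
  obtains E' where "is_neg (Suc n) E'" "ip E' E' = neg_factor n * ip E E"
proof -
  define Q where "Q = q ^ n"
  define D where "D = 1 - a * b * c * d * q * (Q * Q)"
  \<comment> \<open>In E' the coefficient of z^-(n+1) is 1, so comparing z^(n+1) in R_B E' and R_A
    E' forces the eigenvalue 1/(a b q^(n+1)); comparing z^-(n+1) then gives \<rho> D = W, where
    \<rho> is the coefficient of z^(n+1).\<close>
  define W where "W = (1 + a * b) - Q * a * b * (q + c * d)"
  define \<rho> where "\<rho> = W / D"
  define E' where "E' = lmono 0 1 * (A.R E - lmono 0 (- \<rho>) * E)"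
  let ?S = "lsupp (- int n) (int n)" and ?N = "int (Suc n)"
  have Q: "Q \<noteq> 0" "star Q = 1 / Q" "q ^ (2 * n + 1) = q * (Q * Q)"
    by (simp_all add: Q_def star.power star_par power_one_over mult_2 power_add)
  have D: "D \<noteq> 0" using abcd[of "2 * n + 1"] unfolding Q(3) by (simp add: D_def mult.assoc)
  have E0: "E \<in> lsupp (- int n) (int n + 1)" and E1: "lcoeff E ?N = 1" and Eo: "\<And>s. s \<in> ?S \<Longrightarrow> ip E s = 0"
    using E by (auto simp: is_pos_def add.commute)
  have Es: "E \<in> lsupp (- ?N) ?N" using E0 by (rule lsupp_mono) auto
  have E2: "lcoeff E (- ?N) = 0" by (rule lsuppD[OF E0]) auto
  note UE = A.R_supp[OF Es] A.R_ends[OF Es, unfolded E1 E2] and VE = B.R_supp[OF Es] B.R_ends[OF Es, unfolded E1 E2]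
  have E's: "E' \<in> lsupp (- ?N) ?N" unfolding E'_def by (intro lsupp_scale lsupp_diff UE Es)
  have E'1: "lcoeff E' (- ?N) = 1" "lcoeff E' ?N = \<rho>"
    unfolding E'_def lcoeff_scale lookup_minus by (simp_all only: UE E1 E2 zero_less_Suc) simp_all
  note UE' = A.R_supp[OF E's] A.R_ends[OF E's, unfolded E'1] and VE' = B.R_supp[OF E's] B.R_ends[OF E's, unfolded E'1]
  have UEo: "ip (A.R E) s = 0" if "s \<in> ?S" for s by (rule A.R_orth[OF Eo that])
  have VEo: "ip (B.R E) s = 0" if "s \<in> ?S" for s by (rule B.R_orth[OF Eo that])
  have E'o: "ip E' s = 0" if "s \<in> ?S" for s
    unfolding E'_def by (simp only: ip_scale_left ip_diff_left UEo Eo that) simp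
  have UE'o: "ip (A.R E') s = 0" if "s \<in> ?S" for s by (rule A.R_orth[OF E'o that])
  have S: "f \<in> ?S" if "f \<in> lsupp (- ?N) ?N" "lcoeff f ?N = 0" "lcoeff f (- ?N) = 0" for f :: "'k laurent"
    using lsupp_shrink_bot[OF lsupp_shrink_top[OF that(1,2)] that(3)] by simp
  have orth: "ip E' E = 0"
  proof (rule ip_eigenvectors[where UE = "A.R E" and UE' = "A.R E'" and VE = "B.R E" and VE' = "B.R E'" and S = ?S])
    show "ip (A.R E') (A.R E) = ip E' E" "ip (B.R E') (B.R E) = ip E' E"
      by (rule A.R_unitary B.R_unitary)+
    show "B.R E - lmono 0 (c * d * Q) * A.R E \<in> ?S"
      by (intro S lsupp_diff lsupp_scale UE VE; simp only: lookup_minus lcoeff_scale UE VE zero_less_Suc; simp add: Q_def)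
    have "c * d * Q * \<rho> - (1 + c * d / q) - 1 / (a * b * q * Q) * (\<rho> - (a * b + 1)) = (W - \<rho> * D) / (a * b * q * Q)"
      using Q(1) by (simp add: field_simps D_def W_def)
    moreover have "\<rho> * D = W" using D by (simp add: \<rho>_def)
    ultimately have "c * d * Q * \<rho> - (1 + c * d / q) = 1 / (a * b * q * Q) * (\<rho> - (a * b + 1))"
      by simp
    then show "B.R E' - lmono 0 (1 / (a * b * q * Q)) * A.R E' \<in> ?S"
      by (intro S lsupp_diff lsupp_scale UE' VE'; simp only: lookup_minus lcoeff_scale UE' VE' zero_less_Suc; simp add: Q_def)
    have "1 / (a * b * q * Q) * star (c * d * Q) = 1 / (a * b * c * d * q ^ (2 * n + 1))"
      unfolding Q(3) by (simp add: star.mult star_par Q(2))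
    then show "1 / (a * b * q * Q) * star (c * d * Q) \<noteq> 1" using abcd[of "2 * n + 1"] by simp
  qed (use UE'o VEo in auto)
  have "is_neg (Suc n) E'"
    unfolding is_neg_def
  proof (intro conjI ballI E's E'1)
    fix s :: "'k laurent" assume s: "s \<in> lsupp (1 - ?N) ?N"
    let ?t = "lcoeff s ?N"
    have E3: "E \<in> lsupp (1 - ?N) ?N" using E0 by (rule lsupp_mono) auto
    have t: "lcoeff (s - lmono 0 ?t * E) ?N = 0" by (simp only: lookup_minus lcoeff_scale E1) simp
    have "s - lmono 0 ?t * E \<in> lsupp (1 - ?N) (?N - 1)"
      by (intro lsupp_shrink_top[OF _ t] lsupp_diff lsupp_scale s E3)
    then have "ip E' (s - lmono 0 ?t * E) = 0" by (intro E'o) simp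
    then show "ip E' s = 0" by (simp add: ip_diff_right ip_scale_right orth)
  qed
  moreover have "ip E' E' = neg_factor n * ip E E"
  proof -
    define W' where "W' = c * d * q * Q * (1 + a * b) - (c * d + q)"
    have "ip E' E' = 1 * star 1 * (1 - (- \<rho>) * star (- \<rho>)) * ip E E"
      by (rule norm_step[OF _ E'_def orth]) (simp_all add: A.R_unitary)
    also have "1 * star 1 * (1 - (- \<rho>) * star (- \<rho>)) = 1 - \<rho> * star \<rho>"
      by (simp add: star.one star.uminus)
    also have "\<dots> = neg_factor n"
    proof -
      have W: "star W = W' / (a * b * c * d * q * Q)"
        using Q(1) by (simp add: star.diff star.add star.one star.mult star_par Q W_def W'_def field_simps)
      have sD: "star D = - D / (a * b * c * d * q * (Q * Q))"
        using Q(1) by (simp add: D_def star.diff star.one star.mult star_par Q field_simps)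
      have r: "star \<rho> = - (W' * Q) / D"
        unfolding \<rho>_def star.divide W sD using D Q(1) by simp
      have "1 - \<rho> * star \<rho> = (D\<^sup>2 + Q * W * W') / D\<^sup>2"
        unfolding r unfolding \<rho>_def using D by (simp add: field_simps power2_eq_square)
      also have "D\<^sup>2 + Q * W * W' = (1 - q * Q) * (1 - c * d * Q) * (1 - a * b * (q * Q)) * (1 - a * b * c * d * Q)"
        by (simp add: D_def W_def W'_def algebra_simps power2_eq_square)
      finally show ?thesis
        unfolding neg_factor_def Q(3) unfolding D_def Q_def power_Suc by (simp only: mult_ac)
    qed
    finally show ?thesis by simp
  qed
  ultimately show ?thesis by (rule that)
qed

fun neg_norm :: "nat \<Rightarrow> 'k" where
  "neg_norm 0 = 1"
| "neg_norm (Suc n) = neg_factor n * (pos_factor n * neg_norm n)"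

theorem is_neg_exists: "\<exists>E. is_neg n E \<and> ip E E = neg_norm n"
proof (induction n)
  case 0
  then show ?case using is_neg_0 by auto
next
  case (Suc n)
  then obtain E where "is_neg n E" "ip E E = neg_norm n" by blast
  moreover from this obtain E1 where "is_pos n E1" "ip E1 E1 = pos_factor n * ip E E" by (blast elim: pos_step)
  moreover from this obtain E2 where "is_neg (Suc n) E2" "ip E2 E2 = neg_factor n * ip E1 E1" by (blast elim: neg_step)
  ultimately show ?case by auto
qed

theorem is_pos_exists: "\<exists>E. is_pos n E \<and> ip E E = pos_factor n * neg_norm n"
proof -
  obtain E where "is_neg n E" "ip E E = neg_norm n" using is_neg_exists by blast
  moreover from this obtain E1 where "is_pos n E1" "ip E1 E1 = pos_factor n * ip E E" by (blast elim: pos_step)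
  ultimately show ?thesis by auto
qed

end

section \<open>The involution of K\<close>

locale embedding =
  fixes e :: "'a::idom \<Rightarrow> 'k::field"
  assumes add: "e (x + y) = e x + e y" and mult: "e (x * y) = e x * e y" and one: "e 1 = 1"
    and eq_0: "e x = 0 \<longleftrightarrow> x = 0"
begin

lemma zero [simp]: "e 0 = 0" by (simp add: eq_0)

lemma sum: "e (\<Sum>i\<in>I. h i) = (\<Sum>i\<in>I. e (h i))"
  by (induction I rule: infinite_finite_induct) (simp_all add: add)

lemma fract_extension:
  "\<exists>\<sigma>. (\<forall>x y. \<sigma> (x + y) = \<sigma> x + \<sigma> y) \<and> (\<forall>x y. \<sigma> (x * y) = \<sigma> x * \<sigma> y) \<and>
     \<sigma> 1 = 1 \<and> (\<forall>p r. r \<noteq> 0 \<longrightarrow> \<sigma> (Fract p r) = e p / e r)"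
proof -
  define \<sigma> where "\<sigma> x = (SOME y. \<exists>p r. r \<noteq> 0 \<and> x = Fract p r \<and> y = e p / e r)" for x
  have \<sigma>: "\<sigma> (Fract p r) = e p / e r" if r: "r \<noteq> 0" for p r
  proof -
    have "\<exists>p' r'. r' \<noteq> 0 \<and> Fract p r = Fract p' r' \<and> \<sigma> (Fract p r) = e p' / e r'"
      unfolding \<sigma>_def by (rule someI_ex) (use r in blast)
    then obtain p' r' where *: "r' \<noteq> 0" "Fract p r = Fract p' r'" "\<sigma> (Fract p r) = e p' / e r'" by blast
    then have "p * r' = p' * r" using r by (simp add: eq_fract)
    then have "e p * e r' = e p' * e r" by (simp flip: mult)
    then show ?thesis using * r by (simp add: eq_0 frac_eq_eq)
  qed
  have "\<sigma> (x + y) = \<sigma> x + \<sigma> y" for x y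
  proof (cases x; cases y)
    fix p r p' r' assume "x = Fract p r" "r \<noteq> 0" "y = Fract p' r'" "r' \<noteq> 0"
    then show ?thesis by (simp add: \<sigma> add mult add_frac_eq eq_0)
  qed
  moreover have "\<sigma> (x * y) = \<sigma> x * \<sigma> y" for x y
  proof (cases x; cases y)
    fix p r p' r' assume "x = Fract p r" "r \<noteq> 0" "y = Fract p' r'" "r' \<noteq> 0"
    then show ?thesis by (simp add: \<sigma> mult)
  qed
  moreover have "\<sigma> 1 = 1" using \<sigma>[of 1 1] by (simp add: One_fract_def one)
  ultimately show ?thesis using \<sigma> by blast
qed

end

text \<open>\<open>h\<close> sends polynomials to Laurent polynomials: the denominators are powers of \<open>M\<close>.\<close>

locale inverting = e: embedding e + h: embedding h for e h :: "'a::idom \<Rightarrow> 'k::field" +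
  fixes M :: 'k
  assumes M [simp]: "M \<noteq> 0" and bounded: "\<exists>N0. \<forall>N\<ge>N0. \<exists>u. h p * M ^ N = e u"

text \<open>Adjoins one indeterminate, sent to 1/x. The point is injectivity: multiplied by (M x)^N,
  the image of \<open>p\<close> is a genuine polynomial whose coefficients are those of
  \<open>p\<close> in reverse order, mapped by \<open>h\<close> and cleared of denominators.\<close>

lemma poly_extension:
  fixes e h :: "'a::idom \<Rightarrow> 'k::field" and ep :: "'a poly \<Rightarrow> 'k"
  assumes "inverting e h M" and ep: "embedding ep" and c: "\<And>c. ep [:c:] = e c" and x: "ep [:0, 1:] = x"
  obtains hp where "inverting ep hp (M * x)" "\<And>c. hp [:c:] = h c" "hp [:0, 1:] = 1 / x"
proof -
  interpret inverting e h M by fact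
  interpret ep: embedding ep by fact
  have x0 [simp]: "x \<noteq> 0" using ep.eq_0[of "[:0, 1:]"] x by simp
  have epm: "ep (monom u k) = e u * x ^ k" for u k
  proof (induction k)
    case (Suc k)
    have "monom u (Suc k) = [:0, 1:] * monom u k" by (simp add: monom_Suc)
    then have "ep (monom u (Suc k)) = x * ep (monom u k)" by (simp only: ep.mult x)
    then show ?case by (simp add: Suc)
  qed (simp add: monom_0 c)
  define hp where "hp p = (\<Sum>i\<le>degree p. h (coeff p i) / x ^ i)" for p
  have hp: "hp p = (\<Sum>i\<le>n. h (coeff p i) / x ^ i)" if "degree p \<le> n" for p n
    unfolding hp_def using that by (intro sum.mono_neutral_left) (auto simp: coeff_eq_0)
  have hp_pCons: "hp (pCons a p) = h a + hp p / x" for a p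
  proof -
    have "hp (pCons a p) = (\<Sum>i\<le>Suc (degree p). h (coeff (pCons a p) i) / x ^ i)"
      by (rule hp) (simp add: degree_pCons_le)
    also have "\<dots> = h a + (\<Sum>i\<le>degree p. h (coeff p i) / x ^ Suc i)"
      by (simp add: sum.atMost_Suc_shift del: sum.atMost_Suc)
    finally show ?thesis by (simp add: hp_def sum_divide_distrib mult.commute)
  qed
  have hp0: "hp 0 = 0" by (simp add: hp_def)
  have hpc: "hp [:a:] = h a" for a by (simp add: hp_pCons hp0)
  have hp_add: "hp (p + r) = hp p + hp r" for p r
  proof -
    let ?n = "max (degree p) (degree r)"
    show ?thesis
      by (simp add: hp[of p ?n] hp[of r ?n] hp[of "p + r" ?n] degree_add_le h.add add_divide_distrib sum.distrib)
  qed
  have hp_smult: "hp (smult a p) = h a * hp p" for a p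
    by (induction p) (simp_all add: hp_pCons hp0 h.mult algebra_simps)
  have hp_mult: "hp (p * r) = hp p * hp r" for p r
    by (induction p) (simp_all add: hp_pCons hp0 hp_add hp_smult algebra_simps)
  \<comment> \<open>\<open>bounded\<close> speaks of all large exponents precisely so that one N
    serves every coefficient and also exceeds the degree.\<close>
  have bnd: "\<exists>N0. \<forall>N\<ge>N0. \<exists>u. (\<forall>i\<le>degree p. h (coeff p i) * M ^ N = e (u i)) \<and> degree p \<le> N" for p
  proof -
    have "\<forall>i. \<exists>N0. \<forall>N\<ge>N0. \<exists>u. h (coeff p i) * M ^ N = e u" using bounded by blast
    then obtain N0 where N0: "\<And>i N. N \<ge> N0 i \<Longrightarrow> \<exists>u. h (coeff p i) * M ^ N = e u" by metis
    define N1 where "N1 = max (degree p) (Max (N0 ` {..degree p}))"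
    have "\<exists>u. (\<forall>i\<le>degree p. h (coeff p i) * M ^ N = e (u i)) \<and> degree p \<le> N" if "N \<ge> N1" for N
    proof -
      have "N0 i \<le> N" if "i \<le> degree p" for i
      proof -
        have "N0 i \<le> Max (N0 ` {..degree p})" using that by (intro Max_ge) auto
        also have "\<dots> \<le> N1" by (simp only: N1_def max.cobounded2)
        finally show ?thesis using \<open>N \<ge> N1\<close> by simp
      qed
      then have "\<forall>i\<in>{..degree p}. \<exists>u. h (coeff p i) * M ^ N = e u" using N0 by auto
      then have "\<exists>u. \<forall>i\<in>{..degree p}. h (coeff p i) * M ^ N = e (u i)" by (rule bchoice)
      moreover have "degree p \<le> N" using \<open>N \<ge> N1\<close> by (simp add: N1_def)
      ultimately show ?thesis by auto
    qed
    then show ?thesis by blast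
  qed
  have key: "hp p * (M * x) ^ N = ep (\<Sum>i\<le>degree p. monom (u i) (N - i))"
    if "\<forall>i\<le>degree p. h (coeff p i) * M ^ N = e (u i)" "degree p \<le> N" for p N u
  proof -
    have "hp p * (M * x) ^ N = (\<Sum>i\<le>degree p. (h (coeff p i) * M ^ N) * (x ^ N / x ^ i))"
      unfolding hp_def power_mult_distrib sum_distrib_right by (rule sum.cong) (simp_all add: mult_ac)
    also have "\<dots> = (\<Sum>i\<le>degree p. e (u i) * x ^ (N - i))"
      using that by (intro sum.cong) (auto simp: power_diff)
    finally show ?thesis by (simp add: ep.sum epm)
  qed
  have hp_eq_0: "hp p = 0 \<longleftrightarrow> p = 0" for p
  proof
    assume p: "hp p = 0"
    obtain N u where Nu: "\<forall>i\<le>degree p. h (coeff p i) * M ^ N = e (u i)" "degree p \<le> N" using bnd[of p] by blast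
    have S0: "(\<Sum>i\<le>degree p. monom (u i) (N - i)) = 0" using key[OF Nu] p by (simp add: ep.eq_0)
    have "coeff p i = 0" for i
    proof (cases "i \<le> degree p")
      case True
      have "0 = coeff (\<Sum>i\<le>degree p. monom (u i) (N - i)) (N - i)"
        by (simp add: S0)
      also have "\<dots> = (\<Sum>j\<le>degree p. if j = i then u j else 0)"
        unfolding coeff_sum using Nu True by (intro sum.cong) (auto simp: coeff_monom)
      also have "\<dots> = u i" using True by simp
      finally have "h (coeff p i) * M ^ N = 0" using Nu True by simp
      then show ?thesis by (simp add: h.eq_0)
    qed (simp add: coeff_eq_0)
    then show "p = 0" by (simp add: poly_eq_iff)
  qed (simp add: hp0)
  show ?thesis
  proof
    show "inverting ep hp (M * x)"
    proof
      show "hp 1 = 1" using hpc[of 1] by (simp add: h.one flip: one_pCons)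
      show "\<exists>N0. \<forall>N\<ge>N0. \<exists>u. hp p * (M * x) ^ N = ep u" for p
        using bnd[of p] key[of p] by meson
    qed (simp_all add: hp_add hp_mult hp_eq_0)
  qed (simp_all add: hpc hp_pCons hp0 h.one)
qed

definition K_emb :: "rat poly poly poly poly poly \<Rightarrow> K" where "K_emb p = Fract p 1"

lemma K_emb: "embedding K_emb"
  by unfold_locales (simp_all add: K_emb_def One_fract_def Zero_fract_def eq_fract)

lemma embedding_const:
  assumes "embedding e" shows "embedding (\<lambda>c. e [:c:])"
proof -
  interpret embedding e by fact
  show ?thesis
  proof
    show "e [:x + y:] = e [:x:] + e [:y:]" for x y by (simp flip: add)
    show "e [:x * y:] = e [:x:] * e [:y:]" for x y by (simp add: mult.commute flip: mult)
    show "e [:1:] = 1" by (simp add: one flip: one_pCons)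
    show "e [:x:] = 0 \<longleftrightarrow> x = 0" for x by (simp add: eq_0)
  qed
qed

lemmas K_emb4 = embedding_const[OF K_emb] 
lemmas K_emb3 = embedding_const[OF K_emb4]
lemmas K_emb2 = embedding_const[OF K_emb3]
lemmas K_emb1 = embedding_const[OF K_emb2]
lemmas K_emb0 = embedding_const[OF K_emb1]

definition K_generators :: "K set" where "K_generators = {K_sqrt_mab, K_b, K_sqrt_mcd, K_d, K_s}"

lemma K_inverting: obtains h M where "inverting K_emb h M" "\<And>x p. x \<in> K_generators \<Longrightarrow> x = K_emb p \<Longrightarrow> h p = 1 / x"
proof -
  let ?x1 = "K_emb [:[:[:[:[:0, 1:]:]:]:]:]" and ?x2 = "K_emb [:[:[:[:0, 1:]:]:]:]" and ?x3 = "K_emb [:[:[:0, 1:]:]:]"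
    and ?x4 = "K_emb [:[:0, 1:]:]" and ?x5 = "K_emb [:0, 1:]"
  have 0: "inverting (\<lambda>r. K_emb [:[:[:[:[:r:]:]:]:]:]) (\<lambda>r. K_emb [:[:[:[:[:r:]:]:]:]:]) 1"
    unfolding inverting_def inverting_axioms_def using K_emb0 by auto
  obtain h1 where 1: "inverting (\<lambda>c. K_emb [:[:[:[:c:]:]:]:]) h1 (1 * ?x1)" "h1 [:0, 1:] = 1 / ?x1"
    by (rule poly_extension[OF 0 K_emb1 refl refl]) (rule that)
  obtain h2 where 2: "inverting (\<lambda>c. K_emb [:[:[:c:]:]:]) h2 (1 * ?x1 * ?x2)" "\<And>c. h2 [:c:] = h1 c" "h2 [:0, 1:] = 1 / ?x2"
    by (rule poly_extension[OF 1(1) K_emb2 refl refl]) (rule that)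
  obtain h3 where 3: "inverting (\<lambda>c. K_emb [:[:c:]:]) h3 (1 * ?x1 * ?x2 * ?x3)" "\<And>c. h3 [:c:] = h2 c" "h3 [:0, 1:] = 1 / ?x3"
    by (rule poly_extension[OF 2(1) K_emb3 refl refl]) (rule that)
  obtain h4 where 4: "inverting (\<lambda>c. K_emb [:c:]) h4 (1 * ?x1 * ?x2 * ?x3 * ?x4)" "\<And>c. h4 [:c:] = h3 c" "h4 [:0, 1:] = 1 / ?x4"
    by (rule poly_extension[OF 3(1) K_emb4 refl refl]) (rule that)
  obtain h5 where 5: "inverting K_emb h5 (1 * ?x1 * ?x2 * ?x3 * ?x4 * ?x5)" "\<And>c. h5 [:c:] = h4 c" "h5 [:0, 1:] = 1 / ?x5"
    by (rule poly_extension[OF 4(1) K_emb refl refl]) (rule that)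
  note f2 = 2(2) and f3 = 3(2) and f4 = 4(2) and f5 = 5(2)
  have inj: "K_emb p = K_emb p' \<Longrightarrow> p = p'" for p p' by (simp add: K_emb_def eq_fract)
  have "h5 p = 1 / x" if "x \<in> K_generators" and p: "x = K_emb p" for x p
  proof -
    from \<open>x \<in> K_generators\<close> consider "x = ?x1" | "x = ?x2" | "x = ?x3" | "x = ?x4" | "x = ?x5"
      unfolding K_generators_def K_sqrt_mab_def K_b_def K_sqrt_mcd_def K_d_def K_s_def K_emb_def[symmetric] by blast
    then show ?thesis
    proof cases
      case 1 then have "p = [:[:[:[:[:0, 1:]:]:]:]:]" by (intro inj) (simp only: p)
      then show ?thesis unfolding p by (simp only: f5 f4 f3 f2 \<open>h1 [:0, 1:] = 1 / ?x1\<close>)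
    next
      case 2 then have "p = [:[:[:[:0, 1:]:]:]:]" by (intro inj) (simp only: p)
      then show ?thesis unfolding p by (simp only: f5 f4 f3 \<open>h2 [:0, 1:] = 1 / ?x2\<close>)
    next
      case 3 then have "p = [:[:[:0, 1:]:]:]" by (intro inj) (simp only: p)
      then show ?thesis unfolding p by (simp only: f5 f4 \<open>h3 [:0, 1:] = 1 / ?x3\<close>)
    next
      case 4 then have "p = [:[:0, 1:]:]" by (intro inj) (simp only: p)
      then show ?thesis unfolding p by (simp only: f5 \<open>h4 [:0, 1:] = 1 / ?x4\<close>)
    next
      case 5 then have "p = [:0, 1:]" by (intro inj) (simp only: p)
      then show ?thesis unfolding p by (simp only: \<open>h5 [:0, 1:] = 1 / ?x5\<close>)
    qed
  qed
  with 5(1) show ?thesis by (rule that)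
qed

lemma embedding_agree:
  assumes "\<And>c. f (ep [:c:]) = g (ep [:c:])" "f (ep [:0, 1:]) = g (ep [:0, 1:])" "embedding ep" "field_endo f" "field_endo g"
  shows "f (ep p) = g (ep p)"
proof (induction p)
  case 0
  then show ?case using assms(3-5) by (simp add: embedding.zero field_endo.zero)
next
  case (pCons a p)
  have "pCons a p = [:a:] + [:0, 1:] * p" by simp
  then have "ep (pCons a p) = ep [:a:] + ep [:0, 1:] * ep p"
    using assms(3) by (metis embedding.add embedding.mult)
  then show ?case using pCons assms by (simp add: field_endo.add field_endo.mult)
qed

lemma rat_hom_unique:
  fixes h :: "rat \<Rightarrow> 'k::field"
  assumes "embedding h" shows "h (Rat.Fract x y) = of_int x / of_int y"
proof -
  interpret embedding h by fact
  have nat: "h (of_nat n) = of_nat n" for n by (induction n) (simp_all add: add one)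
  have neg: "h (- x) = - h x" for x by (metis add add.right_inverse add_eq_0_iff zero)
  have int: "h (of_int i) = of_int i" for i
    by (cases i rule: int_cases2) (simp_all add: nat neg)
  show ?thesis
  proof (cases "y = 0")
    case False
    have "h (Rat.Fract x y) * h (of_int y) = h (of_int x)"
      using False by (simp add: Fract_of_int_quotient flip: mult)
    moreover have "h (of_int y) \<noteq> 0" using False by (simp add: eq_0)
    ultimately show ?thesis by (simp add: int field_simps)
  qed (simp add: Fract_of_int_quotient)
qed

text \<open>Rational constants are determined by the ring laws; then the indeterminates are added
  one at a time, and quotients follow.\<close>

lemma K_endo_eqI:
  assumes f: "field_endo f" and g: "field_endo g" and "\<And>x. x \<in> K_generators \<Longrightarrow> f x = g x"
  shows "f = (g :: K \<Rightarrow> K)"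
proof
  have gen: "f x = g x" if "x \<in> {K_emb [:[:[:[:[:0, 1:]:]:]:]:], K_emb [:[:[:[:0, 1:]:]:]:], K_emb [:[:[:0, 1:]:]:], K_emb [:[:0, 1:]:], K_emb [:0, 1:]}" for x
    using that assms(3) unfolding K_generators_def K_sqrt_mab_def K_b_def K_sqrt_mcd_def K_d_def K_s_def K_emb_def by blast
  have rat: "embedding (\<lambda>r. f' (K_emb [:[:[:[:[:r:]:]:]:]:]))" if "field_endo f'" for f'
  proof -
    interpret field_endo f' by fact
    interpret r: embedding "\<lambda>r. K_emb [:[:[:[:[:r:]:]:]:]:]" by (rule K_emb0)
    show ?thesis by unfold_locales (simp_all only: r.add r.mult r.one r.eq_0 add mult one eq_0)
  qed
  have 0: "f (K_emb [:[:[:[:[:r:]:]:]:]:]) = g (K_emb [:[:[:[:[:r:]:]:]:]:])" for r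
    by (cases r) (simp only: rat_hom_unique[OF rat[OF f]] rat_hom_unique[OF rat[OF g]])
  have 1: "f (K_emb [:[:[:[:r:]:]:]:]) = g (K_emb [:[:[:[:r:]:]:]:])" for r
    by (rule embedding_agree[OF 0 gen K_emb1 f g]) simp
  have 2: "f (K_emb [:[:[:r:]:]:]) = g (K_emb [:[:[:r:]:]:])" for r
    by (rule embedding_agree[OF 1 gen K_emb2 f g]) simp
  have 3: "f (K_emb [:[:r:]:]) = g (K_emb [:[:r:]:])" for r
    by (rule embedding_agree[OF 2 gen K_emb3 f g]) simp
  have 4: "f (K_emb [:r:]) = g (K_emb [:r:])" for r
    by (rule embedding_agree[OF 3 gen K_emb4 f g]) simp
  have 5: "f (K_emb r) = g (K_emb r)" for r
    by (rule embedding_agree[OF 4 gen K_emb f g]) simp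
  fix x :: K
  obtain p r where "x = Fract p r" "r \<noteq> 0" by (cases x)
  then have "x = K_emb p / K_emb r" by (simp add: K_emb_def)
  then show "f x = g x" by (simp add: field_endo.divide[OF f] field_endo.divide[OF g] 5)
qed

text \<open>\<open>K_endo_eqI\<close> is used twice: the square of the constructed map fixes the
  generators, hence is the identity, and the definite description has no other candidate.\<close>

theorem K_star: "field_endo K_star" "K_star (K_star x) = x" "g \<in> K_generators \<Longrightarrow> K_star g = 1 / g"
proof -
  obtain h M where h: "inverting K_emb h M" "\<And>x p. x \<in> K_generators \<Longrightarrow> x = K_emb p \<Longrightarrow> h p = 1 / x"
    by (rule K_inverting) (rule that)
  interpret h: embedding h using h(1) by (simp add: inverting_def)
  obtain \<sigma> where \<sigma>: "\<forall>x y. \<sigma> (x + y) = \<sigma> x + \<sigma> y" "\<forall>x y. \<sigma> (x * y) = \<sigma> x * \<sigma> y" "\<sigma> 1 = 1"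
    "\<And>p r. r \<noteq> 0 \<Longrightarrow> \<sigma> (Fract p r) = h p / h r"
    using h.fract_extension by blast
  interpret \<sigma>: field_endo \<sigma> using \<sigma> by unfold_locales auto
  have gen: "\<sigma> x = 1 / x" if x: "x \<in> K_generators" for x
  proof -
    obtain p where p: "x = K_emb p"
      using x by (auto simp: K_generators_def K_sqrt_mab_def K_b_def K_sqrt_mcd_def K_d_def K_s_def K_emb_def)
    have "\<sigma> (K_emb p) = h p" unfolding K_emb_def by (simp add: \<sigma>(4) h.one)
    then show ?thesis using h(2)[OF x p] p by simp
  qed
  have inv: "\<sigma> (\<sigma> x) = x" for x
  proof -
    have "(\<lambda>x. \<sigma> (\<sigma> x)) = (\<lambda>x. x)"
    proof (rule K_endo_eqI[OF _ field_endo_id])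
      show "field_endo (\<lambda>x. \<sigma> (\<sigma> x))" by unfold_locales (simp_all add: \<sigma>.add \<sigma>.mult \<sigma>.one)
    qed (simp add: gen \<sigma>.divide \<sigma>.one)
    then show ?thesis by (rule fun_cong)
  qed
  have eq: "K_star = \<sigma>"
    unfolding K_star_def
  proof (rule the_equality)
    show "(\<forall>x y. \<sigma> (x + y) = \<sigma> x + \<sigma> y) \<and> (\<forall>x y. \<sigma> (x * y) = \<sigma> x * \<sigma> y) \<and> \<sigma> 1 = 1 \<and>
     (\<forall>x. \<sigma> (\<sigma> x) = x) \<and> (\<forall>x \<in> {K_sqrt_mab, K_b, K_sqrt_mcd, K_d, K_s}. \<sigma> x = inverse x)"
      using \<sigma> inv gen by (simp add: K_generators_def inverse_eq_divide)
    fix \<tau> :: "K \<Rightarrow> K"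
    assume \<tau>: "(\<forall>x y. \<tau> (x + y) = \<tau> x + \<tau> y) \<and> (\<forall>x y. \<tau> (x * y) = \<tau> x * \<tau> y) \<and> \<tau> 1 = 1 \<and>
     (\<forall>x. \<tau> (\<tau> x) = x) \<and> (\<forall>x \<in> {K_sqrt_mab, K_b, K_sqrt_mcd, K_d, K_s}. \<tau> x = inverse x)"
    show "\<tau> = \<sigma>"
    proof (rule K_endo_eqI[OF _ \<sigma>.field_endo_axioms])
      show "field_endo \<tau>" using \<tau> by unfold_locales auto
      fix x assume x: "x \<in> K_generators"
      have "\<forall>x\<in>K_generators. \<tau> x = inverse x" unfolding K_generators_def using \<tau> by (elim conjE)
      then have "\<tau> x = inverse x" using x by (rule bspec)
      then show "\<tau> x = \<sigma> x" by (simp only: gen[OF x] inverse_eq_divide)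
    qed
  qed
  show "field_endo K_star" "K_star (K_star x) = x" "g \<in> K_generators \<Longrightarrow> K_star g = 1 / g"
    unfolding eq by (rule \<sigma>.field_endo_axioms, rule inv, rule gen)
qed

section \<open>The tensor product as a vector space over K\<close>

lemma tensor_add_left: "(k + k') \<otimes>\<^sub>S x = k \<otimes>\<^sub>S x + k' \<otimes>\<^sub>S x"
  unfolding tensor_of_def plus_tensor.abs_eq tensor.abs_eq_iff diff_diff_eq[symmetric] by (rule tensor_rel.add_left)

lemma tensor_add_right: "k \<otimes>\<^sub>S (x + x') = k \<otimes>\<^sub>S x + k \<otimes>\<^sub>S x'"
  unfolding tensor_of_def plus_tensor.abs_eq tensor.abs_eq_iff diff_diff_eq[symmetric] by (rule tensor_rel.add_right)

lemma tensor_balanced: "(k * S_to_K p) \<otimes>\<^sub>S x = k \<otimes>\<^sub>S (S_to_fls p * x)"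
  unfolding tensor_of_def tensor.abs_eq_iff by (rule tensor_rel.balanced)

lemma tensor_diff_left: "(k - k') \<otimes>\<^sub>S x = k \<otimes>\<^sub>S x - k' \<otimes>\<^sub>S x"
  by (rule additive_diff[where F = "\<lambda>k. k \<otimes>\<^sub>S x"]) (rule tensor_add_left)

lemma tensor_diff_right: "k \<otimes>\<^sub>S (x - x') = k \<otimes>\<^sub>S x - k \<otimes>\<^sub>S x'"
  by (rule additive_diff[where F = "\<lambda>x. k \<otimes>\<^sub>S x"]) (rule tensor_add_right)

lemma tensor_0_left [simp]: "0 \<otimes>\<^sub>S x = 0"
  using tensor_diff_left[of 0 0 x] by simp

lemma tensor_0_right [simp]: "k \<otimes>\<^sub>S 0 = 0"
  using tensor_diff_right[of k 0 0] by simp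

lemma tensor_sum_left: "(\<Sum>i\<in>I. h i) \<otimes>\<^sub>S x = (\<Sum>i\<in>I. h i \<otimes>\<^sub>S x)"
  by (induction I rule: infinite_finite_induct) (simp_all add: tensor_add_left)

text \<open>Scaling of the left factors in the free group. Scaling on the quotient, which so far is
  only a group, is needed to pass from orthogonality to z^m to orthogonality to x z^m.\<close>

definition tensor_push :: "K \<Rightarrow> ((K \<times> R fls) \<Rightarrow>\<^sub>0 int) \<Rightarrow> ((K \<times> R fls) \<Rightarrow>\<^sub>0 int)" where
  "tensor_push \<kappa> = pm_lift (\<lambda>p n. Poly_Mapping.single (\<kappa> * fst p, snd p) n)"

lemma tensor_push_family: "additive_family (\<lambda>p n. Poly_Mapping.single (\<kappa> * fst p, snd p) (n :: int))"
  by unfold_locales (simp_all only: single_zero single_add)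

lemma tensor_push_add: "tensor_push \<kappa> (u + v) = tensor_push \<kappa> u + tensor_push \<kappa> v"
  unfolding tensor_push_def by (rule additive_family.lift_add[OF tensor_push_family])

lemma tensor_push_single: "tensor_push \<kappa> (Poly_Mapping.single (k, x) n) = Poly_Mapping.single (\<kappa> * k, x) n"
  unfolding tensor_push_def additive_family.lift_single[OF tensor_push_family] fst_conv snd_conv ..

lemma tensor_push_diff: "tensor_push \<kappa> (u - v) = tensor_push \<kappa> u - tensor_push \<kappa> v"
  by (rule additive_diff) (rule tensor_push_add)

lemma tensor_push_rel: "u \<in> tensor_rel \<Longrightarrow> tensor_push \<kappa> u \<in> tensor_rel"
proof (induction rule: tensor_rel.induct)
  case (add_left k k' x)
  show ?case unfolding tensor_push_diff tensor_push_single distrib_left by (rule tensor_rel.add_left)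
next
  case (add_right k x x')
  show ?case unfolding tensor_push_diff tensor_push_single by (rule tensor_rel.add_right)
next
  case (balanced k p x)
  show ?case unfolding tensor_push_diff tensor_push_single mult.assoc[symmetric, of \<kappa>] by (rule tensor_rel.balanced)
next
  case zero
  have "tensor_push \<kappa> 0 = 0" using tensor_push_diff[of \<kappa> 0 0] by (simp only: diff_self)
  then show ?case by (simp only: tensor_rel.zero)
next
  case (diff u v)
  then show ?case unfolding tensor_push_diff by (intro tensor_rel.diff)
qed

lift_definition tensor_scale :: "K \<Rightarrow> tensor \<Rightarrow> tensor" is tensor_push
  unfolding tensor_push_diff[symmetric] by (rule tensor_push_rel)

lemma tensor_scale_of: "tensor_scale \<kappa> (k \<otimes>\<^sub>S x) = (\<kappa> * k) \<otimes>\<^sub>S x"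
  unfolding tensor_of_def tensor_scale.abs_eq tensor_push_single ..

lemma tensor_scale_0 [simp]: "tensor_scale \<kappa> 0 = 0"
  using tensor_scale_of[of \<kappa> 0 0] by (simp only: tensor_0_left mult_zero_right)

subsection \<open>Scalars that may be moved across the tensor sign\<close>

text \<open>\<open>\<kappa>\<close> and \<open>\<xi>\<close> represent the same scalar on the two
  sides. Recording only this consequence makes the notion stable under ring operations without
  naming an element of the base ring.\<close>

definition movable :: "K \<Rightarrow> R fps \<Rightarrow> bool" where
  "movable \<kappa> \<xi> \<longleftrightarrow> (\<forall>k x. (k * \<kappa>) \<otimes>\<^sub>S x = k \<otimes>\<^sub>S (fps_to_fls \<xi> * x))"

lemma movableD: "movable \<kappa> \<xi> \<Longrightarrow> k \<otimes>\<^sub>S (fps_to_fls (\<xi> * x)) = (k * \<kappa>) \<otimes>\<^sub>S fps_to_fls x"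
  by (simp add: movable_def fls_times_fps_to_fls)

lemma movable_1: "movable 1 1"
  by (simp add: movable_def)

lemma movable_add: "movable \<kappa> \<xi> \<Longrightarrow> movable \<kappa>' \<xi>' \<Longrightarrow> movable (\<kappa> + \<kappa>') (\<xi> + \<xi>')"
  by (simp add: movable_def fps_to_fls_plus distrib_left distrib_right tensor_add_left tensor_add_right)

lemma movable_diff: "movable \<kappa> \<xi> \<Longrightarrow> movable \<kappa>' \<xi>' \<Longrightarrow> movable (\<kappa> - \<kappa>') (\<xi> - \<xi>')"
  by (simp add: movable_def fps_to_fls_minus right_diff_distrib left_diff_distrib tensor_diff_left tensor_diff_right)

lemma movable_mult: "movable \<kappa> \<xi> \<Longrightarrow> movable \<kappa>' \<xi>' \<Longrightarrow> movable (\<kappa> * \<kappa>') (\<xi> * \<xi>')"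
  unfolding movable_def by (intro allI) (simp only: fls_times_fps_to_fls mult.assoc[symmetric])

lemma movable_power: "movable \<kappa> \<xi> \<Longrightarrow> movable (\<kappa> ^ n) (\<xi> ^ n)"
  by (induction n) (simp_all only: power_0 power_Suc movable_1 movable_mult)

lemma K_rat_1: "K_rat 1 = 1"
  by (simp add: K_rat_def One_fract_def flip: one_pCons)

lemma movable_single:
  assumes "S_to_K p = \<kappa>" "S_to_fls p = fps_to_fls \<xi>" shows "movable \<kappa> \<xi>"
  unfolding movable_def assms[symmetric] by (intro allI tensor_balanced)

lemma single_1_nonzero: "Poly_Mapping.single k (1::'b::zero_neq_one) \<noteq> 0"
  by (metis lookup_single_eq lookup_zero zero_neq_one)

lemma movable_monomial:
  "movable (K_a powi i * K_b powi j * (K_c / K_s) powi k * (K_d / K_s) powi l) (fps_const (Poly_Mapping.single (i, j, k, l) 1))"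
  by (rule movable_single[where p = "Poly_Mapping.single 0 (Poly_Mapping.single (i, j, k, l) 1)"])
    (simp_all add: S_to_K_def S_to_fls_def R_to_K_def K_rat_1 single_1_nonzero)

lemma movable_a: "movable K_a P_a"
  using movable_monomial[of 1 0 0 0] by (simp add: R_a_def P_a_def)

lemma movable_b: "movable K_b P_b"
  using movable_monomial[of 0 1 0 0] by (simp add: R_b_def P_b_def)

lemma movable_c': "movable (K_c / K_s) (fps_const R_c')"
  using movable_monomial[of 0 0 1 0] by (simp add: R_c'_def)

lemma movable_d': "movable (K_d / K_s) (fps_const R_d')"
  using movable_monomial[of 0 0 0 1] by (simp add: R_d'_def)

lemma movable_s: "movable K_s fps_X"
proof (rule movable_single)
  let ?p = "Poly_Mapping.single 1 (Poly_Mapping.single (0, 0, 0, 0) 1) :: R laurent"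
  have one: "Poly_Mapping.single (0, 0, 0, 0) 1 = (1 :: R)" by (simp add: zero_prod_def flip: single_one)
  show "S_to_K ?p = K_s" by (simp add: S_to_K_def R_to_K_def K_rat_1 single_1_nonzero)
  show "S_to_fls ?p = fps_to_fls fps_X" unfolding one by (simp add: S_to_fls_def fls_X_conv_shift_1)
qed

lemma K_generator_nonzero: "x \<in> K_generators \<Longrightarrow> x \<noteq> 0"
  by (auto simp: K_generators_def K_sqrt_mab_def K_b_def K_sqrt_mcd_def K_d_def K_s_def Zero_fract_def eq_fract)

definition K_q :: K where "K_q = K_s ^ 2"

lemma movable_q: "movable K_q P_q"
  unfolding K_q_def P_q_def by (intro movable_power movable_s)

lemma K_s_nonzero [simp]: "K_s \<noteq> 0"
  by (rule K_generator_nonzero) (simp add: K_generators_def)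

lemma movable_c: "movable K_c P_c"
  using movable_mult[OF movable_c' movable_s] by (simp add: P_c_def)

lemma movable_d: "movable K_d P_d"
  using movable_mult[OF movable_d' movable_s] by (simp add: P_d_def)

lemmas movable_intros = movable_1 movable_add movable_diff movable_mult movable_power movable_a movable_b movable_c movable_d movable_q

section \<open>The moments of the weight function\<close>

definition aw_moment :: "int \<Rightarrow> R fps" where
  "aw_moment k = moment k (fps_const R_a) (fps_const R_b) (fps_const R_c') (fps_const R_d')"

lemma Delta_eq: "Delta = aw_weight (fps_const R_a) (fps_const R_b) (fps_const R_c') (fps_const R_d')"
  by (simp only: Delta_def aw_weight_def aw_num_def aw_den_def Let_def zz_def diag_const)

lemma Delta_coeff_eq: "Delta_coeff k = fps_to_fls (aw_moment k)"
  by (simp only: Delta_coeff_def aw_moment_def moment_def zcoeff_def Delta_eq)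

lemma aw_moment_refl:
  "aw_moment (k + 1) - (P_a + P_b) * aw_moment k + P_a * P_b * aw_moment (k - 1) +
   (aw_moment (- k + 1) - (P_a + P_b) * aw_moment (- k) + P_a * P_b * aw_moment (- k - 1)) = 0"
  unfolding aw_moment_def P_a_def P_b_def by (rule moment_refl)

lemma aw_moment_refl_0: "aw_moment 1 - (P_a + P_b) * aw_moment 0 + P_a * P_b * aw_moment (- 1) = 0"
  unfolding aw_moment_def P_a_def P_b_def by (rule moment_refl_0)

lemma aw_moment_swap_refl:
  "aw_moment (- int k - 1) - (P_c + P_d) * aw_moment (- int k) + P_c * P_d * aw_moment (- int k + 1) +
    P_q ^ k * (aw_moment (int k - 1) - (P_c + P_d) * aw_moment (int k) + P_c * P_d * aw_moment (int k + 1)) = 0"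
  unfolding aw_moment_def P_c_def P_d_def P_q_def by (rule moment_swap_refl)

lemma aw_moment_swap_refl_0: "aw_moment (- 1) - (P_c + P_d) * aw_moment 0 + P_c * P_d * aw_moment 1 = 0"
  unfolding aw_moment_def P_c_def P_d_def by (rule moment_swap_refl_0)

lemma aw_moment_0:
  "aw_moment 0 * qpochs_inf [P_q, P_a * P_b * P_q, P_a * P_c, P_a * P_d, P_b * P_c, P_b * P_d, P_c * P_d] P_q =
    qpoch_inf (P_a * P_b * P_c * P_d) P_q"
  unfolding aw_moment_def P_a_def P_b_def P_c_def P_d_def P_q_def by (rule askey_constant_term)

section \<open>Normalised moments\<close>

text \<open>Here the moments are constructed from the recursions instead of being assumed, because
  those of the weight are not elements of the field.\<close>

locale askey_parameters = star: field_endo star for star :: "'k::field \<Rightarrow> 'k" +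
  fixes a b c d q :: 'k
  assumes star_invol: "star (star x) = x"
    and char_not_2: "(2::'k) \<noteq> 0"
    and params_nz [simp]: "a \<noteq> 0" "b \<noteq> 0" "c \<noteq> 0" "d \<noteq> 0" "q \<noteq> 0"
    and star_params: "star a = 1 / a" "star b = 1 / b" "star c = 1 / c" "star d = 1 / d" "star q = 1 / q"
    and ab_neq: "a * b \<noteq> 1" and cd_neq: "c * d \<noteq> q" and abcd_neq: "a * b * c * d * q ^ n \<noteq> 1"
begin

definition det :: "nat \<Rightarrow> 'k" where "det k = a * b * c * d * q ^ k - 1"

text \<open>\<open>(solve1 k F G, solve2 k F G)\<close> is the solution \<open>(x, y)\<close> of \<open>a b x + y = F\<close>, \<open>x + q\<^sup>k c d y = G\<close>.\<close>

definition solve1 :: "nat \<Rightarrow> 'k \<Rightarrow> 'k \<Rightarrow> 'k" where "solve1 k F G = (q ^ k * c * d * F - G) / det k"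
definition solve2 :: "nat \<Rightarrow> 'k \<Rightarrow> 'k \<Rightarrow> 'k" where "solve2 k F G = (a * b * G - F) / det k"

text \<open>The known terms of the two recursions at degree k, moved to the right: \<open>x\<close>,
  \<open>y\<close> are the moments of degrees k and -k, and \<open>x'\<close>, \<open>y'\<close>
  those of k - 1 and 1 - k.\<close>

definition rhs1 :: "'k \<Rightarrow> 'k \<Rightarrow> 'k \<Rightarrow> 'k \<Rightarrow> 'k" where
  "rhs1 x y x' y' = (a + b) * x - x' - (a * b * y' - (a + b) * y)"
definition rhs2 :: "nat \<Rightarrow> 'k \<Rightarrow> 'k \<Rightarrow> 'k \<Rightarrow> 'k \<Rightarrow> 'k" where
  "rhs2 k x y x' y' = (c + d) * x - c * d * x' - q ^ k * (y' - (c + d) * y)"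

text \<open>The pair of the moments of \<open>z\<^sup>n\<close> and \<open>z\<^sup>-\<^sup>n\<close>.\<close>

fun moment_pair :: "nat \<Rightarrow> 'k \<times> 'k" where
  "moment_pair 0 = (1, 1)"
| "moment_pair (Suc 0) = (solve1 0 (a + b) (c + d), solve2 0 (a + b) (c + d))"
| "moment_pair (Suc (Suc k)) = (let (x, y) = moment_pair (Suc k); (x', y') = moment_pair k;
     F = rhs1 x y x' y'; G = rhs2 (Suc k) x y x' y' in (solve1 (Suc k) F G, solve2 (Suc k) F G))"

definition nmoment :: "int \<Rightarrow> 'k" where
  "nmoment j = (if 0 \<le> j then fst (moment_pair (nat j)) else snd (moment_pair (nat (- j))))"

lemma det_nz [simp]: "det k \<noteq> 0"
  using abcd_neq[of k] by (simp add: det_def)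

lemma solve: "a * b * solve1 k F G + solve2 k F G = F" "solve1 k F G + q ^ k * c * d * solve2 k F G = G"
proof -
  have "a * b * (q ^ k * c * d * F - G) + (a * b * G - F) = F * det k"
    by (simp add: det_def algebra_simps)
  then have "a * b * solve1 k F G + solve2 k F G = F * det k / det k"
    by (simp only: solve1_def solve2_def times_divide_eq_right flip: add_divide_distrib)
  moreover have "(q ^ k * c * d * F - G) + q ^ k * c * d * (a * b * G - F) = G * det k"
    by (simp add: det_def algebra_simps)
  then have "solve1 k F G + q ^ k * c * d * solve2 k F G = G * det k / det k"
    by (simp only: solve1_def solve2_def times_divide_eq_right flip: add_divide_distrib)
  ultimately show "a * b * solve1 k F G + solve2 k F G = F" "solve1 k F G + q ^ k * c * d * solve2 k F G = G"
    by simp_all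
qed

lemma nmoment_0: "nmoment 0 = 1" by (simp add: nmoment_def)

lemma nmoment_nat: "nmoment (int n) = fst (moment_pair n)" "nmoment (- int n) = snd (moment_pair n)"
  by (cases "n = 0"; simp add: nmoment_def)+

lemma nmoment_1: "nmoment 1 = solve1 0 (a + b) (c + d)" "nmoment (- 1) = solve2 0 (a + b) (c + d)"
  using nmoment_nat[of 1] by simp_all

lemma nmoment_Suc:
  fixes k :: nat
  defines "K \<equiv> int (Suc k)"
  defines "F \<equiv> rhs1 (nmoment K) (nmoment (- K)) (nmoment (K - 1)) (nmoment (1 - K))"
    and "G \<equiv> rhs2 (Suc k) (nmoment K) (nmoment (- K)) (nmoment (K - 1)) (nmoment (1 - K))"
  shows "nmoment (K + 1) = solve1 (Suc k) F G" "nmoment (- K - 1) = solve2 (Suc k) F G"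
proof -
  have e: "K + 1 = int (Suc (Suc k))" "- K - 1 = - int (Suc (Suc k))" "K - 1 = int k" "1 - K = - int k"
    by (simp_all add: K_def)
  show "nmoment (K + 1) = solve1 (Suc k) F G" "nmoment (- K - 1) = solve2 (Suc k) F G"
    unfolding F_def G_def e unfolding K_def nmoment_nat by (simp_all add: Let_def case_prod_beta)
qed

lemma star_det: "star (det k) = - det k / (a * b * c * d * q ^ k)"
  by (simp add: det_def star.diff star.mult star.power star.one star_params field_simps)

text \<open>Applying the involution to both equations and clearing denominators gives the same
  system with the two unknowns exchanged.\<close>

lemma star_solve:
  assumes "star F = F' / (a * b)" "star G = G' / (c * d * q ^ k)"
  shows "star (solve1 k F G) = solve2 k F' G'" "star (solve2 k F G) = solve1 k F' G'"
proof -
  have q: "star (q ^ k) = 1 / q ^ k" by (simp add: star.power star_params power_one_over)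
  show "star (solve1 k F G) = solve2 k F' G'"
    unfolding solve1_def solve2_def star.divide star_det star.diff star.mult star_params q assms by (simp add: field_simps)
  show "star (solve2 k F G) = solve1 k F' G'"
    unfolding solve1_def solve2_def star.divide star_det star.diff star.mult star_params q assms by (simp add: field_simps)
qed

lemma star_moment_pair: "star (fst (moment_pair n)) = snd (moment_pair n) \<and> star (snd (moment_pair n)) = fst (moment_pair n)"
proof (induction n rule: moment_pair.induct)
  case 2
  have "star (a + b) = (a + b) / (a * b)" "star (c + d) = (c + d) / (c * d * q ^ 0)"
    by (simp_all add: star.add star_params field_simps)
  from star_solve[OF this] show ?case by simp
next
  case (3 k)
  obtain x y x' y' where p: "moment_pair (Suc k) = (x, y)" "moment_pair k = (x', y')" by fastforce
  have s: "star x = y" "star y = x" "star x' = y'" "star y' = x'"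
    using 3(1) 3(2)[OF p(1)[symmetric]] p by simp_all
  have "star (rhs1 x y x' y') = rhs1 x y x' y' / (a * b)"
    unfolding rhs1_def by (simp only: star.diff star.add star.mult star_params s) (simp add: field_simps)
  moreover have "star (rhs2 (Suc k) x y x' y') = rhs2 (Suc k) x y x' y' / (c * d * q ^ Suc k)"
    unfolding rhs2_def by (simp only: star.diff star.add star.mult star.power star_params s) (simp add: field_simps)
  ultimately show ?case using star_solve by (simp add: p Let_def)
qed (simp add: star.one)

lemma star_nmoment: "star (nmoment k) = nmoment (- k)"
  using star_moment_pair by (cases k rule: int_cases2) (simp_all add: nmoment_nat)

sublocale askey_wilson star nmoment a b c d q
proof
  define R1 where "R1 k \<longleftrightarrow> a * b * nmoment (k + 1) - (a + b) * nmoment k + nmoment (k - 1) +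
      (a * b * nmoment (- k + 1) - (a + b) * nmoment (- k) + nmoment (- k - 1)) = 0" for k
  define R0 where "R0 k \<longleftrightarrow> nmoment (k + 1) - (c + d) * nmoment k + c * d * nmoment (k - 1) +
      q powi k * (nmoment (- k + 1) - (c + d) * nmoment (- k) + c * d * nmoment (- k - 1)) = 0" for k
  have nat: "R1 (int n) \<and> R0 (int n)" for n
  proof (cases n)
    case 0
    define X Y where "X = nmoment 1" and "Y = nmoment (- 1)"
    have "a * b * X + Y = a + b" "X + c * d * Y = c + d"
      using solve[of 0 "a + b" "c + d"] by (simp_all add: X_def Y_def nmoment_1)
    moreover have "a * b * X - (a + b) + Y = (a * b * X + Y) - (a + b)" "X - (c + d) + c * d * Y = (X + c * d * Y) - (c + d)"
      by simp_all
    ultimately have "a * b * X - (a + b) + Y = 0" "X - (c + d) + c * d * Y = 0" by (simp_all only: diff_self)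
    then show ?thesis using 0 by (simp add: R1_def R0_def nmoment_0 flip: X_def Y_def)
  next
    case (Suc k)
    let ?K = "int (Suc k)"
    let ?x = "nmoment ?K" and ?y = "nmoment (- ?K)" and ?x' = "nmoment (?K - 1)" and ?y' = "nmoment (1 - ?K)"
    have "a * b * nmoment (?K + 1) + nmoment (- ?K - 1) = rhs1 ?x ?y ?x' ?y'"
      "nmoment (?K + 1) + q ^ Suc k * c * d * nmoment (- ?K - 1) = rhs2 (Suc k) ?x ?y ?x' ?y'"
      unfolding nmoment_Suc by (rule solve)+
    moreover have "- ?K + 1 = 1 - ?K" by simp
    ultimately show ?thesis
      unfolding R1_def R0_def Suc rhs1_def rhs2_def power_int_of_nat
      by (simp only:) (simp only: algebra_simps add_0 simp_thms)
  qed
  \<comment> \<open>The first relation is even in k, and the second at -k is q^(-k) times the second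
    at k.\<close>
  have neg: "R1 k \<Longrightarrow> R1 (- k)" "R0 k \<Longrightarrow> R0 (- k)" for k
  proof -
    show "R1 k \<Longrightarrow> R1 (- k)" unfolding R1_def by (simp add: algebra_simps)
    define A B where "A = nmoment (k + 1) - (c + d) * nmoment k + c * d * nmoment (k - 1)"
      and "B = nmoment (- k + 1) - (c + d) * nmoment (- k) + c * d * nmoment (- k - 1)"
    assume "R0 k"
    then have "A + q powi k * B = 0" by (simp only: R0_def A_def B_def)
    then have "q powi (- k) * (A + q powi k * B) = 0" by simp
    moreover have "q powi (- k) * q powi k = 1" by (simp add: power_int_minus)
    then have "q powi (- k) * (A + q powi k * B) = B + q powi (- k) * A"
      by (simp only: distrib_left mult.assoc[symmetric] mult_1 add.commute)
    ultimately have "B + q powi (- k) * A = 0" by (simp only:)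
    then show "R0 (- k)" by (simp only: R0_def A_def B_def minus_minus)
  qed
  show "a * b * nmoment (k + 1) - (a + b) * nmoment k + nmoment (k - 1) +
      (a * b * nmoment (- k + 1) - (a + b) * nmoment (- k) + nmoment (- k - 1)) = 0" for k
    unfolding R1_def[symmetric] using nat neg by (cases k rule: int_cases2) auto
  show "nmoment (k + 1) - (c + d) * nmoment k + c * d * nmoment (k - 1) +
      q powi k * (nmoment (- k + 1) - (c + d) * nmoment (- k) + c * d * nmoment (- k - 1)) = 0" for k
    unfolding R0_def[symmetric] using nat neg by (cases k rule: int_cases2) auto
qed (simp_all add: star_invol char_not_2 star_nmoment nmoment_0 star_params ab_neq cd_neq abcd_neq)

text \<open>\<open>h\<close> is the image of the moment of degree 0, \<open>f\<close> and \<open>g\<close> are those of two opposite degrees.\<close>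

lemma solve_additive:
  fixes f g h :: "'k \<Rightarrow> 't::ab_group_add"
  assumes add: "\<And>x y. f (x + y) = f x + f y" "\<And>x y. g (x + y) = g x + g y" "\<And>x y. h (x + y) = h x + h y"
    and 1: "\<And>x. f x + g (x * (a * b)) = h (x * F)" and 2: "\<And>x. g x + f (x * (q ^ k * c * d)) = h (x * G)"
  shows "g x = h (x * solve1 k F G)" "f x = h (x * solve2 k F G)"
proof -
  have dg: "g (x - y) = g x - g y" and df: "f (x - y) = f x - f y" and dh: "h (x - y) = h x - h y" for x y
    by (rule additive_diff; rule add)+
  let ?r = "q ^ k * c * d" and ?D = "a * b * c * d * q ^ k - 1"
  \<comment> \<open>Cramer's rule has to be run on the arguments: the target is only a group, so the
    determinant is divided out of \<open>x\<close> beforehand.\<close>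
  define t where "t = x / ?D"
  have t: "t * ?D = x" using det_nz[of k] by (simp add: t_def det_def)
  have D: "t * ?r * (a * b) - t = t * ?D" "t * (a * b) * ?r - t = t * ?D" by (simp_all add: algebra_simps)
  have "g (t * ?r * (a * b) - t) = (f (t * ?r) + g (t * ?r * (a * b))) - (g t + f (t * ?r))"
    by (simp add: dg)
  also have "\<dots> = h (t * ?r * F - t * G)" unfolding 1 2 dh ..
  also have "t * ?r * F - t * G = x * solve1 k F G"
    by (simp add: solve1_def det_def t_def algebra_simps diff_divide_distrib)
  finally show "g x = h (x * solve1 k F G)" by (simp only: D t)
  have "f (t * (a * b) * ?r - t) = (g (t * (a * b)) + f (t * (a * b) * ?r)) - (f t + g (t * (a * b)))"
    by (simp add: df)
  also have "\<dots> = h (t * (a * b) * G - t * F)" unfolding 1 2 dh ..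
  also have "t * (a * b) * G - t * F = x * solve2 k F G"
    by (simp add: solve2_def det_def t_def algebra_simps diff_divide_distrib)
  finally show "f x = h (x * solve2 k F G)" by (simp only: D t)
qed

end

section \<open>The pairing in terms of normalised moments\<close>

lemma K_numeral_2: "(2 :: K) \<noteq> 0"
proof -
  have "K_emb 2 = 2" using embedding.add[OF K_emb, of 1 1] by (simp add: embedding.one[OF K_emb])
  moreover have "K_emb 2 \<noteq> 0" by (simp add: embedding.eq_0[OF K_emb])
  ultimately show ?thesis by simp
qed

lemma K_sqrt_emb:
  "K_sqrt_mab = K_emb [:[:[:[:[:0, 1:]:]:]:]:]" "K_sqrt_mcd = K_emb [:[:[:0, 1:]:]:]" "K_s = K_emb [:0, 1:]"
  by (simp_all add: K_sqrt_mab_def K_sqrt_mcd_def K_s_def K_emb_def)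

lemma K_emb_power: "K_emb (p ^ n) = K_emb p ^ n"
  by (induction n) (simp_all only: power_0 power_Suc embedding.one[OF K_emb] embedding.mult[OF K_emb])

lemma K_emb_eq: "K_emb p = K_emb p' \<longleftrightarrow> p = p'"
  by (simp add: K_emb_def eq_fract)

lemma K_emb_uminus: "K_emb (- p) = - K_emb p"
  by (rule additive_uminus) (rule embedding.add[OF K_emb])

lemma K_generators_nz [simp]: "K_sqrt_mab \<noteq> 0" "K_b \<noteq> 0" "K_sqrt_mcd \<noteq> 0" "K_d \<noteq> 0"
  by (rule K_generator_nonzero, simp add: K_generators_def)+

lemma K_ab: "K_a * K_b = - (K_sqrt_mab\<^sup>2)" and K_cd: "K_c * K_d = - (K_sqrt_mcd\<^sup>2)"
  by (simp_all add: K_a_def K_c_def)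

lemma K_ab_neq: "K_a * K_b \<noteq> 1"
proof
  let ?x = "[:[:[:[:[:0, 1:]:]:]:]:] :: rat poly poly poly poly poly"
  assume "K_a * K_b = 1"
  then have "K_emb (- (?x\<^sup>2)) = K_emb 1"
    by (simp only: K_ab K_sqrt_emb K_emb_uminus K_emb_power embedding.one[OF K_emb])
  then have "- (?x\<^sup>2) = 1" by (simp only: K_emb_eq)
  then have "poly (poly (poly (poly (poly (- (?x\<^sup>2)) 0) 0) 0) 0) 0 = poly (poly (poly (poly (poly (1 :: rat poly poly poly poly poly) 0) 0) 0) 0) 0" by (simp only:)
  then show False by (simp add: power2_eq_square)
qed

lemma K_cd_neq: "K_c * K_d \<noteq> K_q"
proof
  let ?x = "[:[:[:0, 1:]:]:] :: rat poly poly poly poly poly"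
  assume "K_c * K_d = K_q"
  then have "K_emb (- (?x\<^sup>2)) = K_emb ([:0, 1:]\<^sup>2)"
    by (simp only: K_cd K_q_def K_sqrt_emb K_emb_uminus K_emb_power)
  then have "- (?x\<^sup>2) = [:0, 1:]\<^sup>2" by (simp only: K_emb_eq)
  \<comment> \<open>At q^(1/2) = 0, d = 0 and sqrt(-cd) = 1 the two sides become -1 and 0.\<close>
  then have "poly (poly (poly (- (?x\<^sup>2)) 0) 0) 1 = poly (poly (poly ([:0, 1:]\<^sup>2 :: rat poly poly poly poly poly) 0) 0) 1" by (simp only:)
  then show False by (simp add: power2_eq_square)
qed

lemma K_abcd_neq: "K_a * K_b * K_c * K_d * K_q ^ n \<noteq> 1"
proof
  let ?x = "[:[:[:[:[:0, 1:]:]:]:]:] :: rat poly poly poly poly poly" and ?y = "[:[:[:0, 1:]:]:] :: rat poly poly poly poly poly"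
  assume "K_a * K_b * K_c * K_d * K_q ^ n = 1"
  moreover have "K_a * K_b * K_c * K_d * K_q ^ n = K_sqrt_mab\<^sup>2 * K_sqrt_mcd\<^sup>2 * (K_s\<^sup>2) ^ n"
  proof -
    have "K_a * K_b * K_c * K_d = (K_a * K_b) * (K_c * K_d)" by (simp only: mult.assoc)
    then show ?thesis unfolding K_ab K_cd K_q_def by simp
  qed
  ultimately have "K_emb (?x\<^sup>2 * ?y\<^sup>2 * ([:0, 1:]\<^sup>2) ^ n) = K_emb 1"
    by (simp only: K_sqrt_emb K_emb_power embedding.mult[OF K_emb] embedding.one[OF K_emb])
  then have "?x\<^sup>2 * ?y\<^sup>2 * ([:0, 1:]\<^sup>2) ^ n = 1" by (simp only: K_emb_eq)
  then have "poly (poly (poly (?x\<^sup>2 * ?y\<^sup>2 * ([:0, 1:]\<^sup>2) ^ n) 0) 0) 0 = poly (poly (poly (1 :: rat poly poly poly poly poly) 0) 0) 0" by (simp only:)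
  then show False by (simp add: poly_mult poly_power power2_eq_square)
qed

interpretation KS: field_endo K_star by (rule K_star(1))

lemma K_star_generators:
  "K_star K_sqrt_mab = 1 / K_sqrt_mab" "K_star K_b = 1 / K_b" "K_star K_sqrt_mcd = 1 / K_sqrt_mcd"
  "K_star K_d = 1 / K_d" "K_star K_s = 1 / K_s"
  by (rule K_star(3), simp add: K_generators_def)+

interpretation AW: askey_parameters K_star K_a K_b K_c K_d K_q
proof
  show "K_a \<noteq> 0" "K_c \<noteq> 0" "K_q \<noteq> 0" by (simp_all add: K_a_def K_c_def K_q_def)
  show "K_star K_a = 1 / K_a" "K_star K_c = 1 / K_c" "K_star K_q = 1 / K_q"
    by (simp_all add: K_a_def K_c_def K_q_def KS.divide KS.uminus KS.power K_star_generators power_one_over)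
qed (simp_all add: K_star(2) K_numeral_2 K_star_generators K_ab_neq K_cd_neq K_abcd_neq)

section \<open>The moments of the weight inside the tensor product\<close>

abbreviation moment_fls :: "int \<Rightarrow> R fls" where "moment_fls k \<equiv> fps_to_fls (aw_moment k)"

lemma tensor_moment_refl:
  "x \<otimes>\<^sub>S moment_fls (k + 1) - (x * (K_a + K_b)) \<otimes>\<^sub>S moment_fls k + (x * (K_a * K_b)) \<otimes>\<^sub>S moment_fls (k - 1) +
   (x \<otimes>\<^sub>S moment_fls (- k + 1) - (x * (K_a + K_b)) \<otimes>\<^sub>S moment_fls (- k) + (x * (K_a * K_b)) \<otimes>\<^sub>S moment_fls (- k - 1)) = 0"
  (is "?E = 0")
proof -
  have m: "movable (K_a + K_b) (P_a + P_b)" "movable (K_a * K_b) (P_a * P_b)" by (intro movable_intros)+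
  have "?E = x \<otimes>\<^sub>S fps_to_fls (aw_moment (k + 1) - (P_a + P_b) * aw_moment k + P_a * P_b * aw_moment (k - 1) +
   (aw_moment (- k + 1) - (P_a + P_b) * aw_moment (- k) + P_a * P_b * aw_moment (- k - 1)))"
    unfolding fps_to_fls_plus fps_to_fls_minus tensor_add_right tensor_diff_right movableD[OF m(1)] movableD[OF m(2)] ..
  then show ?thesis unfolding aw_moment_refl by simp
qed

lemma tensor_moment_refl_0:
  "x \<otimes>\<^sub>S moment_fls 1 - (x * (K_a + K_b)) \<otimes>\<^sub>S moment_fls 0 + (x * (K_a * K_b)) \<otimes>\<^sub>S moment_fls (- 1) = 0"
  (is "?E = 0")
proof -
  have m: "movable (K_a + K_b) (P_a + P_b)" "movable (K_a * K_b) (P_a * P_b)" by (intro movable_intros)+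
  have "?E = x \<otimes>\<^sub>S fps_to_fls (aw_moment 1 - (P_a + P_b) * aw_moment 0 + P_a * P_b * aw_moment (- 1))"
    unfolding fps_to_fls_plus fps_to_fls_minus tensor_add_right tensor_diff_right movableD[OF m(1)] movableD[OF m(2)] ..
  then show ?thesis unfolding aw_moment_refl_0 by simp
qed

lemma tensor_moment_swap_refl:
  "x \<otimes>\<^sub>S moment_fls (- int k - 1) - (x * (K_c + K_d)) \<otimes>\<^sub>S moment_fls (- int k) + (x * (K_c * K_d)) \<otimes>\<^sub>S moment_fls (- int k + 1) +
   ((x * K_q ^ k) \<otimes>\<^sub>S moment_fls (int k - 1) - (x * K_q ^ k * (K_c + K_d)) \<otimes>\<^sub>S moment_fls (int k) + (x * K_q ^ k * (K_c * K_d)) \<otimes>\<^sub>S moment_fls (int k + 1)) = 0"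
  (is "?E = 0")
proof -
  have m: "movable (K_c + K_d) (P_c + P_d)" "movable (K_c * K_d) (P_c * P_d)" "movable (K_q ^ k) (P_q ^ k)" by (intro movable_intros)+
  have "?E = x \<otimes>\<^sub>S fps_to_fls (aw_moment (- int k - 1) - (P_c + P_d) * aw_moment (- int k) + P_c * P_d * aw_moment (- int k + 1) +
    P_q ^ k * (aw_moment (int k - 1) - (P_c + P_d) * aw_moment (int k) + P_c * P_d * aw_moment (int k + 1)))"
    unfolding fps_to_fls_plus fps_to_fls_minus tensor_add_right tensor_diff_right movableD[OF m(3)]
    unfolding fps_to_fls_plus fps_to_fls_minus tensor_add_right tensor_diff_right movableD[OF m(1)] movableD[OF m(2)] ..
  then show ?thesis unfolding aw_moment_swap_refl by simp
qed

lemma tensor_moment_swap_refl_0: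
  "x \<otimes>\<^sub>S moment_fls (- 1) - (x * (K_c + K_d)) \<otimes>\<^sub>S moment_fls 0 + (x * (K_c * K_d)) \<otimes>\<^sub>S moment_fls 1 = 0"
  (is "?E = 0")
proof -
  have m: "movable (K_c + K_d) (P_c + P_d)" "movable (K_c * K_d) (P_c * P_d)" by (intro movable_intros)+
  have "?E = x \<otimes>\<^sub>S fps_to_fls (aw_moment (- 1) - (P_c + P_d) * aw_moment 0 + P_c * P_d * aw_moment 1)"
    unfolding fps_to_fls_plus fps_to_fls_minus tensor_add_right tensor_diff_right movableD[OF m(1)] movableD[OF m(2)] ..
  then show ?thesis unfolding aw_moment_swap_refl_0 by simp
qed

lemma group_move: "A - B + C = 0 \<Longrightarrow> A + C = B" for A B C :: "'t::ab_group_add"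
  by (simp add: algebra_simps)

lemma group_move2: "A - B + C + (D - E + F) = 0 \<Longrightarrow> A + F = B - C - D + E" for A B C D E F :: "'t::ab_group_add"
proof -
  assume "A - B + C + (D - E + F) = 0"
  then have "A + F - (B - C - D + E) = 0" by (simp add: algebra_simps)
  then show ?thesis by (simp only: right_minus_eq)
qed

text \<open>The induction follows the recursion of \<open>moment_pair\<close>, solved by
  \<open>solve_additive\<close> in the tensor product. Signs are opposite because integrating z^n
  picks out the coefficient of z^-n.\<close>

lemma moment_transfer_nat:
  "(\<forall>x. x \<otimes>\<^sub>S moment_fls (- int n) = (x * AW.nmoment (int n)) \<otimes>\<^sub>S moment_fls 0) \<and>
   (\<forall>x. x \<otimes>\<^sub>S moment_fls (int n) = (x * AW.nmoment (- int n)) \<otimes>\<^sub>S moment_fls 0)"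
proof (induction n rule: induct_nat_012)
  case 0
  show ?case by (simp add: AW.nmoment_0)
next
  case 1
  have 1: "x \<otimes>\<^sub>S moment_fls 1 + (x * (K_a * K_b)) \<otimes>\<^sub>S moment_fls (- 1) = (x * (K_a + K_b)) \<otimes>\<^sub>S moment_fls 0" for x
    by (rule group_move[OF tensor_moment_refl_0])
  have 2: "x \<otimes>\<^sub>S moment_fls (- 1) + (x * (K_q ^ 0 * K_c * K_d)) \<otimes>\<^sub>S moment_fls 1 = (x * (K_c + K_d)) \<otimes>\<^sub>S moment_fls 0" for x
    unfolding power_0 mult_1 by (rule group_move[OF tensor_moment_swap_refl_0])
  note s = AW.solve_additive[where f = "\<lambda>x. x \<otimes>\<^sub>S moment_fls 1" and g = "\<lambda>x. x \<otimes>\<^sub>S moment_fls (- 1)" and h = "\<lambda>x. x \<otimes>\<^sub>S moment_fls 0",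
      OF tensor_add_left tensor_add_left tensor_add_left 1 2]
  show ?case using s by (simp add: AW.nmoment_1)
next
  case (ge2 k)
  let ?K = "int (Suc k)"
  define x y x' y' where "x = AW.nmoment ?K" and "y = AW.nmoment (- ?K)" and "x' = AW.nmoment (?K - 1)" and "y' = AW.nmoment (1 - ?K)"
  have e: "?K - 1 = int k" "1 - ?K = - int k" "- ?K + 1 = - int k" by simp_all
  have IH: "t \<otimes>\<^sub>S moment_fls (- ?K) = (t * x) \<otimes>\<^sub>S moment_fls 0" "t \<otimes>\<^sub>S moment_fls ?K = (t * y) \<otimes>\<^sub>S moment_fls 0"
    "t \<otimes>\<^sub>S moment_fls (- ?K + 1) = (t * x') \<otimes>\<^sub>S moment_fls 0" "t \<otimes>\<^sub>S moment_fls (?K - 1) = (t * y') \<otimes>\<^sub>S moment_fls 0" for t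
    unfolding x_def y_def x'_def y'_def e
    by (rule ge2(2)[THEN conjunct1, rule_format] ge2(2)[THEN conjunct2, rule_format]
        ge2(1)[THEN conjunct1, rule_format] ge2(1)[THEN conjunct2, rule_format])+
  let ?F = "AW.rhs1 x y x' y'" and ?G = "AW.rhs2 (Suc k) x y x' y'"
  have 1: "t \<otimes>\<^sub>S moment_fls (?K + 1) + (t * (K_a * K_b)) \<otimes>\<^sub>S moment_fls (- ?K - 1) = (t * ?F) \<otimes>\<^sub>S moment_fls 0" for t
  proof -
    have "t \<otimes>\<^sub>S moment_fls (?K + 1) + (t * (K_a * K_b)) \<otimes>\<^sub>S moment_fls (- ?K - 1) =
      (t * (K_a + K_b) * y - t * (K_a * K_b) * y' - t * x' + t * (K_a + K_b) * x) \<otimes>\<^sub>S moment_fls 0"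
      unfolding group_move2[OF tensor_moment_refl[of t ?K]] IH tensor_add_left tensor_diff_left ..
    also have "t * (K_a + K_b) * y - t * (K_a * K_b) * y' - t * x' + t * (K_a + K_b) * x = t * ?F"
      unfolding AW.rhs1_def by (simp only: algebra_simps)
    finally show ?thesis .
  qed
  have 2: "t \<otimes>\<^sub>S moment_fls (- ?K - 1) + (t * (K_q ^ Suc k * K_c * K_d)) \<otimes>\<^sub>S moment_fls (?K + 1) = (t * ?G) \<otimes>\<^sub>S moment_fls 0" for t
  proof -
    have "t \<otimes>\<^sub>S moment_fls (- ?K - 1) + (t * K_q ^ Suc k * (K_c * K_d)) \<otimes>\<^sub>S moment_fls (?K + 1) =
      (t * (K_c + K_d) * x - t * (K_c * K_d) * x' - t * K_q ^ Suc k * y' + t * K_q ^ Suc k * (K_c + K_d) * y) \<otimes>\<^sub>S moment_fls 0"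
      unfolding group_move2[OF tensor_moment_swap_refl[of t "Suc k"]] IH tensor_add_left tensor_diff_left ..
    also have "t * (K_c + K_d) * x - t * (K_c * K_d) * x' - t * K_q ^ Suc k * y' + t * K_q ^ Suc k * (K_c + K_d) * y = t * ?G"
      unfolding AW.rhs2_def by (simp only: algebra_simps)
    finally show ?thesis by (simp only: mult.assoc)
  qed
  note s = AW.solve_additive[where f = "\<lambda>x. x \<otimes>\<^sub>S moment_fls (?K + 1)" and g = "\<lambda>x. x \<otimes>\<^sub>S moment_fls (- ?K - 1)" and h = "\<lambda>x. x \<otimes>\<^sub>S moment_fls 0",
      OF tensor_add_left tensor_add_left tensor_add_left 1 2]
  have n: "AW.nmoment (?K + 1) = AW.solve1 (Suc k) ?F ?G" "AW.nmoment (- ?K - 1) = AW.solve2 (Suc k) ?F ?G"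
    unfolding x_def y_def x'_def y'_def by (rule AW.nmoment_Suc)+
  have e2: "int (Suc (Suc k)) = ?K + 1" "- (?K + 1) = - ?K - 1" by simp_all
  show ?case unfolding e2 n by (intro conjI allI s)
qed

lemma moment_transfer: "x \<otimes>\<^sub>S Delta_coeff (- n) = (x * AW.nmoment n) \<otimes>\<^sub>S moment_fls 0"
  unfolding Delta_coeff_eq using moment_transfer_nat by (cases n rule: int_cases2) (simp_all only: minus_minus)

lemma pairing_eq: "pairing f g = AW.ip f g \<otimes>\<^sub>S moment_fls 0"
proof -
  have "laurent_star g = AW.cj g"
    by (simp add: laurent_star_def AW.cj_def lflip_def pm_lift_def)
  then show ?thesis
    by (simp add: pairing_def Let_def moment_transfer AW.ip_def AW.L_def pm_lift_def tensor_sum_left)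
qed

text \<open>With g = f - E, the term <f, g> vanishes only after tensoring, by the hypothesis on
  \<open>f\<close>, while <g, E> vanishes already in \<open>K\<close>, by that on \<open>E\<close>.
  Both use that \<open>g\<close> involves smaller monomials only, the leading ones having
  cancelled.\<close>

lemma pairing_norm:
  assumes f: "is_nonsym_AW n f" and low: "\<And>m. mono_less m n \<longleftrightarrow> l \<le> m \<and> m \<le> h"
    and E1: "lcoeff E n = 1" and Es: "\<And>m. lcoeff E m \<noteq> 0 \<Longrightarrow> m = n \<or> l \<le> m \<and> m \<le> h"
    and Eo: "\<And>s. s \<in> lsupp l h \<Longrightarrow> AW.ip E s = 0"
  shows "pairing f f = AW.ip E E \<otimes>\<^sub>S moment_fls 0"
proof -
  have f1: "lcoeff f n = 1" and fs: "\<And>m. lcoeff f m \<noteq> 0 \<Longrightarrow> m = n \<or> l \<le> m \<and> m \<le> h"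
    and fo: "\<And>m. l \<le> m \<and> m \<le> h \<Longrightarrow> pairing f (zpow m) = 0"
    using f by (auto simp: is_nonsym_AW_def low)
  define g where "g = f - E"
  have g: "g \<in> lsupp l h"
  proof (rule lsuppI)
    fix k assume k: "\<not> (l \<le> k \<and> k \<le> h)"
    show "lcoeff g k = 0"
    proof (cases "k = n")
      case True
      then show ?thesis by (simp add: g_def lookup_minus f1 E1)
    next
      case False
      then have "lcoeff f k = 0" "lcoeff E k = 0" using fs[of k] Es[of k] k by blast+
      then show ?thesis by (simp add: g_def lookup_minus)
    qed
  qed
  have z: "AW.ip f (lmono m x) \<otimes>\<^sub>S moment_fls 0 = 0" if "l \<le> m \<and> m \<le> h" for m x
  proof -
    have "lmono m x = lmono 0 x * lmono m 1" by (simp add: mult_single)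
    then have "AW.ip f (lmono m x) \<otimes>\<^sub>S moment_fls 0 = tensor_scale (K_star x) (pairing f (zpow m))"
      by (simp only: AW.ip_scale_right pairing_eq tensor_scale_of)
    then show ?thesis by (simp only: fo[OF that] tensor_scale_0)
  qed
  interpret T: additive_family "\<lambda>m x. AW.ip f (lmono m x) \<otimes>\<^sub>S moment_fls 0"
    using AW.ip_diff_right[of f 0 0] by unfold_locales (simp_all add: single_add AW.ip_add_right tensor_add_left)
  have "AW.ip f s \<otimes>\<^sub>S moment_fls 0 = pm_lift (\<lambda>m x. AW.ip f (lmono m x) \<otimes>\<^sub>S moment_fls 0) s" for s
    by (rule fun_cong[OF T.lift_linear]) (simp_all add: AW.ip_add_right tensor_add_left)
  then have "AW.ip f g \<otimes>\<^sub>S moment_fls 0 = pm_lift (\<lambda>m x. AW.ip f (lmono m x) \<otimes>\<^sub>S moment_fls 0) g" .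
  also have "\<dots> = 0"
    unfolding pm_lift_def by (rule sum.neutral) (use g z in \<open>auto simp: lsupp_def in_keys_iff\<close>)
  finally have 1: "AW.ip f g \<otimes>\<^sub>S moment_fls 0 = 0" .
  have fE: "f = E + g" by (simp add: g_def)
  have "AW.ip f E = AW.ip E E + AW.ip g E" unfolding fE by (rule AW.ip_add_left)
  moreover have "AW.ip g E = 0" using Eo[OF g] AW.ip_0_iff by blast
  ultimately have "AW.ip f E = AW.ip E E" by simp
  moreover have "AW.ip f f = AW.ip f E + AW.ip f g"
    using AW.ip_add_right[of f E g] fE by simp
  ultimately show ?thesis unfolding pairing_eq by (simp add: tensor_add_left 1)
qed

section \<open>The norm formulas\<close>

lemma P_nth_0 [simp]: "fps_nth P_c 0 = 0" "fps_nth P_d 0 = 0" "fps_nth P_q 0 = 0"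
  by (simp_all add: P_c_def P_d_def P_q_def power2_eq_square)

definition norm_den_neg :: "nat \<Rightarrow> R fps" where
  "norm_den_neg n = (let a = P_a; b = P_b; c = P_c; d = P_d; q = P_q in
     qpochs_inf [q ^ (n + 1), a * b * q ^ (n + 1), a * c * q ^ n, a * d * q ^ n,
                      b * c * q ^ n, b * d * q ^ n, c * d * q ^ n] q *
                    qpoch (a * b * c * d * q ^ n) q n)"

definition norm_den_pos :: "nat \<Rightarrow> R fps" where
  "norm_den_pos n = (let a = P_a; b = P_b; c = P_c; d = P_d; q = P_q in
     qpochs_inf [q ^ (n + 1), a * b * q ^ (n + 1), a * c * q ^ (n + 1), a * d * q ^ (n + 1),
                      b * c * q ^ (n + 1), b * d * q ^ (n + 1), c * d * q ^ n] q *
                    qpoch (a * b * c * d * q ^ n) q (n + 1))"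

definition norm_neg :: "nat \<Rightarrow> R fps" where
  "norm_neg n = qpoch_inf (P_a * P_b * P_c * P_d * P_q ^ (2 * n)) P_q * fps_inv1 (norm_den_neg n)"

definition norm_pos :: "nat \<Rightarrow> R fps" where
  "norm_pos n = qpoch_inf (P_a * P_b * P_c * P_d * P_q ^ (2 * n + 1)) P_q * fps_inv1 (norm_den_pos n)"

lemma qpoch_nth_0: "fps_nth x 0 = 0 \<Longrightarrow> fps_nth (qpoch x q n) 0 = 1"
  for x :: "'a::comm_ring_1 fps"
  by (induction n) (simp_all add: qpoch_Suc)

lemma norm_den_inv:
  "norm_den_neg n * fps_inv1 (norm_den_neg n) = 1" "norm_den_pos n * fps_inv1 (norm_den_pos n) = 1"
  by (rule fps_inv1, simp add: norm_den_neg_def norm_den_pos_def Let_def qpochs_inf_def qpoch_inf_nth_0 qpoch_nth_0)+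

lemma qpoch_inf_P_q:
  assumes "fps_nth x 0 = 0" "x * P_q = y" shows "qpoch_inf x P_q = (1 - x) * qpoch_inf y P_q"
  using qpoch_inf_rec[of P_q x] assms by simp

text \<open>Four infinite products lose their first factor, and the finite one gains its last factor
  1 - abcd q^(2n).\<close>

lemma norm_den_neg_pos:
  "norm_den_neg n * (1 - P_a * P_b * P_c * P_d * P_q ^ (2 * n)) =
    ((1 - P_a * P_c * P_q ^ n) * (1 - P_a * P_d * P_q ^ n) * (1 - P_b * P_c * P_q ^ n) * (1 - P_b * P_d * P_q ^ n)) * norm_den_pos n"
proof -
  let ?q = P_q
  have r: "qpoch_inf (P_a * P_c * ?q ^ n) ?q = (1 - P_a * P_c * ?q ^ n) * qpoch_inf (P_a * P_c * ?q ^ (n + 1)) ?q"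
    "qpoch_inf (P_a * P_d * ?q ^ n) ?q = (1 - P_a * P_d * ?q ^ n) * qpoch_inf (P_a * P_d * ?q ^ (n + 1)) ?q"
    "qpoch_inf (P_b * P_c * ?q ^ n) ?q = (1 - P_b * P_c * ?q ^ n) * qpoch_inf (P_b * P_c * ?q ^ (n + 1)) ?q"
    "qpoch_inf (P_b * P_d * ?q ^ n) ?q = (1 - P_b * P_d * ?q ^ n) * qpoch_inf (P_b * P_d * ?q ^ (n + 1)) ?q"
    by (rule qpoch_inf_P_q; simp add: mult_ac)+
  have "qpoch (P_a * P_b * P_c * P_d * ?q ^ n) ?q (n + 1) = qpoch (P_a * P_b * P_c * P_d * ?q ^ n) ?q n * (1 - P_a * P_b * P_c * P_d * ?q ^ (2 * n))"
    by (simp add: qpoch_Suc mult_2 power_add mult.assoc)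
  then show ?thesis
    unfolding norm_den_neg_def norm_den_pos_def Let_def qpochs_inf_def list.map prod_list.Cons prod_list.Nil r
    by (simp only: mult_ac)
qed

lemma norm_den_pos_neg:
  "norm_den_pos n * (1 - P_a * P_b * P_c * P_d * P_q ^ (2 * n + 1)) =
    ((1 - P_q ^ Suc n) * (1 - P_c * P_d * P_q ^ n) * (1 - P_a * P_b * P_q ^ Suc n) * (1 - P_a * P_b * P_c * P_d * P_q ^ n)) * norm_den_neg (Suc n)"
proof -
  let ?q = P_q and ?x = "P_a * P_b * P_c * P_d"
  have r: "qpoch_inf (?q ^ Suc n) ?q = (1 - ?q ^ Suc n) * qpoch_inf (?q ^ Suc (Suc n)) ?q"
    "qpoch_inf (P_a * P_b * ?q ^ Suc n) ?q = (1 - P_a * P_b * ?q ^ Suc n) * qpoch_inf (P_a * P_b * ?q ^ Suc (Suc n)) ?q"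
    "qpoch_inf (P_c * P_d * ?q ^ n) ?q = (1 - P_c * P_d * ?q ^ n) * qpoch_inf (P_c * P_d * ?q ^ Suc n) ?q"
    by (rule qpoch_inf_P_q; simp add: mult_ac)+
  have "qpoch (?x * ?q ^ n) ?q (Suc n) * (1 - ?x * ?q ^ (2 * n + 1)) = (1 - ?x * ?q ^ n) * (qpoch (?x * ?q ^ n * ?q) ?q n * (1 - ?x * ?q ^ (2 * n + 1)))"
    by (simp only: qpoch_rec mult.assoc)
  also have "qpoch (?x * ?q ^ n * ?q) ?q n * (1 - ?x * ?q ^ (2 * n + 1)) = qpoch (?x * ?q ^ Suc n) ?q (Suc n)"
  proof -
    have "?q ^ (2 * n + 1) = ?q * ?q ^ n * ?q ^ n" by (simp add: mult_2 power_add mult.assoc)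
    then show ?thesis by (simp only: qpoch_Suc power_Suc mult_ac)
  qed
  finally have p: "qpoch (?x * ?q ^ n) ?q (Suc n) * (1 - ?x * ?q ^ (2 * n + 1)) = (1 - ?x * ?q ^ n) * qpoch (?x * ?q ^ Suc n) ?q (Suc n)" .
  show ?thesis
    unfolding norm_den_neg_def norm_den_pos_def Let_def qpochs_inf_def list.map prod_list.Cons prod_list.Nil Suc_eq_plus1[symmetric]
      mult.assoc[of _ "qpoch _ _ _"] p[unfolded Suc_eq_plus1[symmetric]] r
    by (simp only: mult_ac)
qed

text \<open>One factor 1 - y comes from the infinite product in the numerator and one from the
  denominators, which explains the square in the norm ratios.\<close>

lemma norm_recursion:
  fixes y :: "'a::comm_ring_1"
  assumes "N = (1 - y) * N'" "D * (1 - y) = p * D'" "D * Di = 1" "D' * Di' = 1"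
  shows "N' * Di' * (1 - y)\<^sup>2 = N * Di * p"
proof -
  have "(1 - y) * Di' = (D * Di) * (1 - y) * Di'" by (simp add: assms(3))
  also have "\<dots> = Di * (D * (1 - y)) * Di'" by (simp only: mult_ac)
  also have "\<dots> = Di * p * (D' * Di')" unfolding assms(2) by (simp only: mult_ac)
  finally have "(1 - y) * Di' = Di * p" by (simp add: assms(4))
  then have "N' * (1 - y) * ((1 - y) * Di') = N' * (1 - y) * (Di * p)" by simp
  then show ?thesis unfolding assms(1) by (simp only: power2_eq_square mult_ac)
qed

lemma norm_pos_eq:
  "norm_pos n * (1 - P_a * P_b * P_c * P_d * P_q ^ (2 * n))\<^sup>2 =
    norm_neg n * ((1 - P_a * P_c * P_q ^ n) * (1 - P_a * P_d * P_q ^ n) * (1 - P_b * P_c * P_q ^ n) * (1 - P_b * P_d * P_q ^ n))"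
  unfolding norm_pos_def norm_neg_def
  by (rule norm_recursion[OF _ norm_den_neg_pos norm_den_inv]) (rule qpoch_inf_P_q, simp_all add: mult_ac)

lemma norm_neg_eq:
  "norm_neg (Suc n) * (1 - P_a * P_b * P_c * P_d * P_q ^ (2 * n + 1))\<^sup>2 =
    norm_pos n * ((1 - P_q ^ Suc n) * (1 - P_c * P_d * P_q ^ n) * (1 - P_a * P_b * P_q ^ Suc n) * (1 - P_a * P_b * P_c * P_d * P_q ^ n))"
  unfolding norm_pos_def norm_neg_def
  by (rule norm_recursion[OF _ norm_den_pos_neg norm_den_inv(2,1)]) (rule qpoch_inf_P_q, simp_all add: mult_ac)

lemma norm_neg_0: "norm_neg 0 = aw_moment 0"
proof -
  have d: "norm_den_neg 0 = qpochs_inf [P_q, P_a * P_b * P_q, P_a * P_c, P_a * P_d, P_b * P_c, P_b * P_d, P_c * P_d] P_q"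
    by (simp add: norm_den_neg_def Let_def)
  have "qpoch_inf (P_a * P_b * P_c * P_d) P_q = aw_moment 0 * norm_den_neg 0"
    unfolding d by (rule aw_moment_0[symmetric])
  then have "norm_neg 0 = aw_moment 0 * (norm_den_neg 0 * fps_inv1 (norm_den_neg 0))"
    by (simp add: norm_neg_def mult.assoc)
  then show ?thesis by (simp add: norm_den_inv)
qed

text \<open>\<open>movable\<close> is not set up for inverses, so the recursion between the series
  enters cross-multiplied: y^2 is carried to the left factor, where it cancels against
  \<delta>^2.\<close>

lemma tensor_norm_step:
  assumes IH: "\<And>k. (k * N) \<otimes>\<^sub>S x = k \<otimes>\<^sub>S fps_to_fls t" and "movable \<nu> p" "movable \<delta> y" "\<delta> \<noteq> 0" and t: "t' * y\<^sup>2 = t * p"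
  shows "(k * (\<nu> / \<delta>\<^sup>2 * N)) \<otimes>\<^sub>S x = k \<otimes>\<^sub>S fps_to_fls t'"
proof -
  have "k * (\<nu> / \<delta>\<^sup>2 * N) = (k / \<delta>\<^sup>2 * \<nu>) * N" by simp
  then have "(k * (\<nu> / \<delta>\<^sup>2 * N)) \<otimes>\<^sub>S x = (k / \<delta>\<^sup>2 * \<nu>) \<otimes>\<^sub>S fps_to_fls t" by (simp only: IH)
  also have "\<dots> = (k / \<delta>\<^sup>2) \<otimes>\<^sub>S fps_to_fls (y\<^sup>2 * t')"
    unfolding movableD[OF assms(2), symmetric] mult.commute[of p] t[symmetric] by (simp only: mult.commute)
  also have "\<dots> = (k / \<delta>\<^sup>2 * \<delta>\<^sup>2) \<otimes>\<^sub>S fps_to_fls t'"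
    by (rule movableD[OF movable_power[OF assms(3)]])
  finally show ?thesis using assms(4) by simp
qed

lemma tensor_norm_pos:
  assumes "\<And>k. (k * N) \<otimes>\<^sub>S x = k \<otimes>\<^sub>S fps_to_fls (norm_neg n)"
  shows "(k * (AW.pos_factor n * N)) \<otimes>\<^sub>S x = k \<otimes>\<^sub>S fps_to_fls (norm_pos n)"
  unfolding AW.pos_factor_def
  by (rule tensor_norm_step[OF assms _ _ _ norm_pos_eq]; (intro movable_intros)?)
    (use K_abcd_neq[of "2 * n"] in simp)

lemma tensor_norm_neg_Suc:
  assumes "\<And>k. (k * N) \<otimes>\<^sub>S x = k \<otimes>\<^sub>S fps_to_fls (norm_pos n)"
  shows "(k * (AW.neg_factor n * N)) \<otimes>\<^sub>S x = k \<otimes>\<^sub>S fps_to_fls (norm_neg (Suc n))"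
  unfolding AW.neg_factor_def
  by (rule tensor_norm_step[OF assms _ _ _ norm_neg_eq]; (intro movable_intros)?)
    (use K_abcd_neq[of "2 * n + 1"] in simp)

lemma tensor_norm_neg: "(k * AW.neg_norm n) \<otimes>\<^sub>S moment_fls 0 = k \<otimes>\<^sub>S fps_to_fls (norm_neg n)"
proof (induction n arbitrary: k)
  case 0
  show ?case by (simp add: norm_neg_0)
next
  case (Suc n)
  show ?case unfolding AW.neg_norm.simps by (rule tensor_norm_neg_Suc[OF tensor_norm_pos[OF Suc]])
qed

lemma pairing_neg:
  assumes "is_nonsym_AW (- int n) f" shows "pairing f f = tensor_fps (norm_neg n)"
proof -
  obtain E where E: "AW.is_neg n E" "AW.ip E E = AW.neg_norm n" using AW.is_neg_exists by blast
  have Es: "m = - int n \<or> 1 - int n \<le> m \<and> m \<le> int n" if "lcoeff E m \<noteq> 0" for m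
    using E(1) that by (auto simp: AW.is_neg_def lsupp_def)
  have "pairing f f = AW.ip E E \<otimes>\<^sub>S moment_fls 0"
    by (rule pairing_norm[OF assms _ _ Es])
      (use E(1) in \<open>auto simp: AW.is_neg_def mono_less_def mono_rank_def\<close>)
  then show ?thesis using tensor_norm_neg[of 1 n] by (simp add: E(2) tensor_fps_def)
qed

lemma pairing_pos:
  assumes "is_nonsym_AW (int n + 1) g" shows "pairing g g = tensor_fps (norm_pos n)"
proof -
  obtain E where E: "AW.is_pos n E" "AW.ip E E = AW.pos_factor n * AW.neg_norm n" using AW.is_pos_exists by blast
  have Es: "m = int n + 1 \<or> - int n \<le> m \<and> m \<le> int n" if "lcoeff E m \<noteq> 0" for m
    using E(1) that unfolding AW.is_pos_def lsupp_def by fastforce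
  have "pairing g g = AW.ip E E \<otimes>\<^sub>S moment_fls 0"
    by (rule pairing_norm[OF assms _ _ Es])
      (use E(1) in \<open>auto simp: AW.is_pos_def mono_less_def mono_rank_def\<close>)
  then show ?thesis using tensor_norm_pos[OF tensor_norm_neg, of 1 n] by (simp add: E(2) tensor_fps_def)
qed

theorem corollary5p7:
  fixes n :: nat and f g :: "K laurent"
  shows "let a = P_a; b = P_b; c = P_c; d = P_d; q = P_q in
    (is_nonsym_AW (- int n) f \<longrightarrow>
       pairing f f = tensor_fps
         (qpoch_inf (a * b * c * d * q ^ (2 * n)) q *
          fps_inv1 (qpochs_inf [q ^ (n + 1), a * b * q ^ (n + 1), a * c * q ^ n, a * d * q ^ n,
                      b * c * q ^ n, b * d * q ^ n, c * d * q ^ n] q *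
                    qpoch (a * b * c * d * q ^ n) q n))) \<and>
    (is_nonsym_AW (int n + 1) g \<longrightarrow>
       pairing g g = tensor_fps
         (qpoch_inf (a * b * c * d * q ^ (2 * n + 1)) q *
          fps_inv1 (qpochs_inf [q ^ (n + 1), a * b * q ^ (n + 1), a * c * q ^ (n + 1), a * d * q ^ (n + 1),
                      b * c * q ^ (n + 1), b * d * q ^ (n + 1), c * d * q ^ n] q *
                    qpoch (a * b * c * d * q ^ n) q (n + 1))))"
  using pairing_neg[of n f] pairing_pos[of n g]
  unfolding norm_neg_def norm_pos_def norm_den_neg_def norm_den_pos_def Let_def by (intro conjI impI)

end
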